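(* Let $X,Y$ be two disjoint finite non-empty sets and let $P(X)$ and $P(Y)$ be regular path complexes on $X$ and $Y$ respectively. Set $Z=X\sqcup Y$ and consider the join path complex $P(Z)=P(X)*P(Y)$. Then there is an isomorphism of chain complexes $$\Omega_\bullet(Z)\cong\Omega'_\bullet(X)\otimes\Omega_\bullet(Y),$$ where $\Omega'_n(X)=\Omega_{n-1}(X)$ and the mapping $\Omega'_\bullet(X)\otimes\Omega_\bullet(Y)\to\Omega_\bullet(Z)$ is given by $u\otimes v\mapsto uv$. In particular, for any $r\ge-1$, $$\Omega_r(Z)\cong\bigoplus_{p,q\ge-1,\ p+q=r-1}\Omega_p(X)\otimes\Omega_q(Y),$$ and, for any $r\ge0$, $$\widetilde H_r(Z)\cong\bigoplus_{p,q\ge0,\ p+q=r-1}\widetilde H_p(X)\otimes\widetilde H_q(Y).$$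
   Context: Fix a field $\mathbb K$; all vector spaces are over $\mathbb K$. For a finite set $V$ and $p\ge 0$, an elementary $p$-path is a sequence $i_0\dots i_p$ of vertices of $V$; the only elementary $(-1)$-path is the empty path. A path $i_0\dots i_p$ is regular if $i_{k-1}\ne i_k$ for all $k$. $\mathcal R_p(V)$ is the vector space with basis $\{e_{i_0\dots i_p}: i_0\dots i_p \text{ regular}\}$; $\mathcal R_{-1}(V)=\mathbb K e$ where $e$ is the empty path, $\mathcal R_{-2}=\{0\}$. The regular boundary operator $\partial:\mathcal R_p(V)\to\mathcal R_{p-1}(V)$, $p\ge0$, is $\partial e_{i_0\dots i_p}=\sum_{q=0}^p(-1)^q e_{i_0\dots\widehat{i_q}\dots i_p}$, where every term with a non-regular index sequence is replaced by $0$ (so $\partial e_i=e$); $\partial e=0$. One has $\partial^2=0$. A path complex $P(V)$ over $V$ is a non-empty collection of elementary paths such that if $i_0\dots i_n\in P(V)$, $n\ge 0$, then $i_0\dots i_{n-1}$ and $i_1\dots i_n$ are in $P(V)$ (in particular the empty path is in $P(V)$); the vertex set is always taken so that all vertices of $V$ are in $P(V)$. It is regular if it contains no $1$-path $ii$. Paths in $P(V)$ are called allowed. For $n\ge-1$, $\mathcal A_n(V)$ is the span of $e_x$ over allowed $n$-paths $x$, $\mathcal A_{-2}=\{0\}$, and $\Omega_n(V)=\{v\in\mathcal A_n(V):\partial v\in\mathcal A_{n-1}(V)\}$. $\Omega_\bullet(V)$ denotes the (non-truncated) chain complex $0\leftarrow\mathbb K=\Omega_{-1}(V)\leftarrow\Omega_0(V)\leftarrow\Omega_1(V)\leftarrow\cdots$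 with differential $\partial$, and its homologies are the reduced path homologies $\widetilde H_n(V)$, $n\ge-1$. The join $P(X)*P(Y)$ of path complexes on disjoint sets $X,Y$ is the path complex on $Z=X\sqcup Y$ consisting of all sequences $uv$ (concatenation of sequences) with $u\in P(X)$, $v\in P(Y)$, where $u$ or $v$ may be empty. The join of paths is the bilinear operation with $e_{i_0\dots i_p}e_{j_0\dots j_q}=e_{i_0\dots i_pj_0\dots j_q}$ ($e$ being neutral), so $uv\in\mathcal R_{p+q+1}(Z)$ for $u\in\mathcal R_p(X)$, $v\in\mathcal R_q(Y)$. $\Omega'_\bullet(X)$ is the complex $\Omega_\bullet(X)$ with grading shifted: $\Omega'_n(X)=\Omega_{n-1}(X)$, $n\ge0$, same differential. The tensor product of chain complexes $A_\bullet,B_\bullet$ is $C_r=\bigoplus_{p+q=r}A_p\otimes B_q$ with $\partial(u\otimes v)=(\partial u)\otimes v+(-1)^pu\otimes\partial v$ for $u\in A_p$, $v\in B_q$. *)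

theory Defs
  imports "HOL-Algebra.AbelCoset" "Jordan_Normal_Form.Missing_VectorSpace"
begin

section \<open>Linear algebra over a field\<close>

text \<open>
  Vector spaces are \<^locale>\<open>vectorspace\<close>s, i.e. records of type \<^type>\<open>module\<close>.  Their ring
  multiplication and unit play no role and are left \<^const>\<open>undefined\<close>.
\<close>

definition linear_iso ::
    "('k, 's) ring_scheme \<Rightarrow> ('k, 'a) module \<Rightarrow> ('k, 'b) module \<Rightarrow> ('a \<Rightarrow> 'b) \<Rightarrow> bool" where
  "linear_iso K V W f \<longleftrightarrow> linear_map K V W f \<and> bij_betw f (carrier V) (carrier W)"

definition isomorphic_spaces ::
    "('k, 's) ring_scheme \<Rightarrow> ('k, 'a) module \<Rightarrow> ('k, 'b) module \<Rightarrow> bool" where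
  "isomorphic_spaces K V W \<longleftrightarrow> (\<exists>f. linear_iso K V W f)"

text \<open>
  The vector space with basis \<open>S\<close>: finitely supported families of scalars, extended by zero
  outside of \<open>S\<close>, so that free spaces on different sets of the same type share their operations.
\<close>

definition free_space :: "('k, 's) ring_scheme \<Rightarrow> 'i set \<Rightarrow> ('k, 'i \<Rightarrow> 'k) module" where
  "free_space K S =
    \<lparr>carrier = {f. range f \<subseteq> carrier K \<and> {i. f i \<noteq> \<zero>\<^bsub>K\<^esub>} \<subseteq> S \<and> finite {i. f i \<noteq> \<zero>\<^bsub>K\<^esub>}},
     mult = undefined, one = undefined,
     zero = (\<lambda>i. \<zero>\<^bsub>K\<^esub>),
     add = (\<lambda>f g i. f i \<oplus>\<^bsub>K\<^esub> g i),
     smult = (\<lambda>c f i. c \<otimes>\<^bsub>K\<^esub> f i)\<rparr>"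

definition basis_vec :: "('k, 's) ring_scheme \<Rightarrow> 'i \<Rightarrow> 'i \<Rightarrow> 'k" where
  "basis_vec K i = (\<lambda>j. if j = i then \<one>\<^bsub>K\<^esub> else \<zero>\<^bsub>K\<^esub>)"

text \<open>The linear extension to free spaces of a map \<open>b\<close> prescribed on basis elements.\<close>

definition lin_ext ::
    "('k, 's) ring_scheme \<Rightarrow> ('i \<Rightarrow> 'j \<Rightarrow> 'k) \<Rightarrow> ('i \<Rightarrow> 'k) \<Rightarrow> 'j \<Rightarrow> 'k" where
  "lin_ext K b f = (\<lambda>j. \<Oplus>\<^bsub>K\<^esub>i\<in>{i. f i \<noteq> \<zero>\<^bsub>K\<^esub>}. f i \<otimes>\<^bsub>K\<^esub> b i j)"

text \<open>
  The quotient of \<open>M\<close> by a subspace \<open>N\<close>, with cosets as elements; for such \<open>N\<close> all members of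
  the union defining the scalar multiple of a coset are equal.
\<close>

definition quotient_space :: "('k, 'a) module \<Rightarrow> 'a set \<Rightarrow> ('k, 'a set) module" where
  "quotient_space M N =
    \<lparr>carrier = a_rcosets\<^bsub>M\<^esub> N,
     mult = undefined, one = undefined,
     zero = N,
     add = set_add M,
     smult = (\<lambda>c C. \<Union>x\<in>C. N +>\<^bsub>M\<^esub> (c \<odot>\<^bsub>M\<^esub> x))\<rparr>"

definition direct_sum_space :: "'i set \<Rightarrow> ('i \<Rightarrow> ('k, 'a) module) \<Rightarrow> ('k, 'i \<Rightarrow> 'a) module" where
  "direct_sum_space I M =
    \<lparr>carrier = {x \<in> \<Pi>\<^sub>E i\<in>I. carrier (M i). finite {i \<in> I. x i \<noteq> \<zero>\<^bsub>M i\<^esub>}},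
     mult = undefined, one = undefined,
     zero = (\<lambda>i\<in>I. \<zero>\<^bsub>M i\<^esub>),
     add = (\<lambda>x y. \<lambda>i\<in>I. x i \<oplus>\<^bsub>M i\<^esub> y i),
     smult = (\<lambda>c x. \<lambda>i\<in>I. c \<odot>\<^bsub>M i\<^esub> x i)\<rparr>"

definition direct_sum_inj :: "'i set \<Rightarrow> ('i \<Rightarrow> ('k, 'a) module) \<Rightarrow> 'i \<Rightarrow> 'a \<Rightarrow> 'i \<Rightarrow> 'a" where
  "direct_sum_inj I M j x = (\<lambda>i\<in>I. if i = j then x else \<zero>\<^bsub>M i\<^esub>)"


section \<open>Tensor products\<close>

text \<open>
  The tensor product of \<open>M\<close> and \<open>N\<close> is the free space on \<open>carrier M \<times> carrier N\<close> modulo the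
  subspace generated by the relations expressing bilinearity.
\<close>

definition tensor_free ::
    "('k, 's) ring_scheme \<Rightarrow> ('k, 'a) module \<Rightarrow> ('k, 'b) module \<Rightarrow> ('k, 'a \<times> 'b \<Rightarrow> 'k) module" where
  "tensor_free K M N = free_space K (carrier M \<times> carrier N)"

definition tensor_relations ::
    "('k, 's) ring_scheme \<Rightarrow> ('k, 'a) module \<Rightarrow> ('k, 'b) module \<Rightarrow> ('a \<times> 'b \<Rightarrow> 'k) set" where
  "tensor_relations K M N = (let F = tensor_free K M N; e = (\<lambda>m n. basis_vec K (m, n)) in
     {e (m \<oplus>\<^bsub>M\<^esub> m') n \<ominus>\<^bsub>F\<^esub> (e m n \<oplus>\<^bsub>F\<^esub> e m' n) | m m' n.
        m \<in> carrier M \<and> m' \<in> carrier M \<and> n \<in> carrier N} \<union>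
     {e m (n \<oplus>\<^bsub>N\<^esub> n') \<ominus>\<^bsub>F\<^esub> (e m n \<oplus>\<^bsub>F\<^esub> e m n') | m n n'.
        m \<in> carrier M \<and> n \<in> carrier N \<and> n' \<in> carrier N} \<union>
     {e (c \<odot>\<^bsub>M\<^esub> m) n \<ominus>\<^bsub>F\<^esub> (c \<odot>\<^bsub>F\<^esub> e m n) | c m n.
        c \<in> carrier K \<and> m \<in> carrier M \<and> n \<in> carrier N} \<union>
     {e m (c \<odot>\<^bsub>N\<^esub> n) \<ominus>\<^bsub>F\<^esub> (c \<odot>\<^bsub>F\<^esub> e m n) | c m n.
        c \<in> carrier K \<and> m \<in> carrier M \<and> n \<in> carrier N})"

definition tensor_null ::
    "('k, 's) ring_scheme \<Rightarrow> ('k, 'a) module \<Rightarrow> ('k, 'b) module \<Rightarrow> ('a \<times> 'b \<Rightarrow> 'k) set" where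
  "tensor_null K M N = module.span K (tensor_free K M N) (tensor_relations K M N)"

definition tensor_product ::
    "('k, 's) ring_scheme \<Rightarrow> ('k, 'a) module \<Rightarrow> ('k, 'b) module
      \<Rightarrow> ('k, ('a \<times> 'b \<Rightarrow> 'k) set) module" where
  "tensor_product K M N = quotient_space (tensor_free K M N) (tensor_null K M N)"

definition pure_tensor ::
    "('k, 's) ring_scheme \<Rightarrow> ('k, 'a) module \<Rightarrow> ('k, 'b) module \<Rightarrow> 'a \<Rightarrow> 'b
      \<Rightarrow> ('a \<times> 'b \<Rightarrow> 'k) set" where
  "pure_tensor K M N m n = tensor_null K M N +>\<^bsub>tensor_free K M N\<^esub> basis_vec K (m, n)"

text \<open>
  The map \<open>f \<otimes> g\<close> from \<open>M \<otimes> N\<close> to \<open>M' \<otimes> N'\<close> induced by linear maps \<open>f\<close> and \<open>g\<close>: the class of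
  \<open>\<Sum> c\<^sub>i (m\<^sub>i, n\<^sub>i)\<close> goes to the class of \<open>\<Sum> c\<^sub>i (f m\<^sub>i, g n\<^sub>i)\<close>.
  For linear \<open>f\<close> and \<open>g\<close> all members of the union are equal.
\<close>

definition tensor_map ::
    "('k, 's) ring_scheme \<Rightarrow> ('k, 'a) module \<Rightarrow> ('k, 'b) module \<Rightarrow> ('c \<Rightarrow> 'a) \<Rightarrow> ('d \<Rightarrow> 'b)
      \<Rightarrow> ('c \<times> 'd \<Rightarrow> 'k) set \<Rightarrow> ('a \<times> 'b \<Rightarrow> 'k) set" where
  "tensor_map K M' N' f g C =
    (\<Union>t\<in>C. tensor_null K M' N' +>\<^bsub>tensor_free K M' N'\<^esub>
              lin_ext K (\<lambda>(m, n). basis_vec K (f m, g n)) t)"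


section \<open>Chain complexes\<close>

text \<open>Complexes are indexed by all integers; those of interest vanish in degrees below \<open>-1\<close>.\<close>

record ('k, 'a) graded_complex =
  chains :: "int \<Rightarrow> ('k, 'a) module"
  bdry :: "int \<Rightarrow> 'a \<Rightarrow> 'a"

locale chain_complex =
  fixes K :: "('k, 's) ring_scheme" and C :: "('k, 'a) graded_complex"
  assumes bdry_linear: "\<And>n. linear_map K (chains C n) (chains C (n - 1)) (bdry C n)"
    and bdry_bdry: "\<And>n x. x \<in> carrier (chains C n) \<Longrightarrow>
      bdry C (n - 1) (bdry C n x) = \<zero>\<^bsub>chains C (n - 2)\<^esub>"

definition chain_iso ::
    "('k, 's) ring_scheme \<Rightarrow> ('k, 'a) graded_complex \<Rightarrow> ('k, 'b) graded_complex
      \<Rightarrow> (int \<Rightarrow> 'a \<Rightarrow> 'b) \<Rightarrow> bool" where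
  "chain_iso K C D \<phi> \<longleftrightarrow> chain_complex K C \<and> chain_complex K D \<and>
    (\<forall>n. linear_iso K (chains C n) (chains D n) (\<phi> n)) \<and>
    (\<forall>n. \<forall>x\<in>carrier (chains C n). \<phi> (n - 1) (bdry C n x) = bdry D n (\<phi> n x))"

definition homology :: "('k, 'a) graded_complex \<Rightarrow> int \<Rightarrow> ('k, 'a set) module" where
  "homology C n = quotient_space
     (chains C n \<lparr>carrier := {z \<in> carrier (chains C n). bdry C n z = \<zero>\<^bsub>chains C (n - 1)\<^esub>}\<rparr>)
     (bdry C (n + 1) ` carrier (chains C (n + 1)))"

definition shift_complex :: "('k, 'a) graded_complex \<Rightarrow> ('k, 'a) graded_complex" where
  "shift_complex C = \<lparr>chains = (\<lambda>n. chains C (n - 1)), bdry = (\<lambda>n. bdry C (n - 1))\<rparr>"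

definition ring_sign :: "('k, 's) ring_scheme \<Rightarrow> int \<Rightarrow> 'k" where
  "ring_sign K p = (if even p then \<one>\<^bsub>K\<^esub> else \<ominus>\<^bsub>K\<^esub> \<one>\<^bsub>K\<^esub>)"

definition tensor_summand ::
    "('k, 's) ring_scheme \<Rightarrow> ('k, 'a) graded_complex \<Rightarrow> ('k, 'b) graded_complex
      \<Rightarrow> int \<times> int \<Rightarrow> ('k, ('a \<times> 'b \<Rightarrow> 'k) set) module" where
  "tensor_summand K A B = (\<lambda>(p, q). tensor_product K (chains A p) (chains B q))"

text \<open>
  The \<open>(p, q)\<close> component of the boundary of \<open>t\<close> receives contributions from the components
  \<open>(p + 1, q)\<close> and \<open>(p, q + 1)\<close> of \<open>t\<close>, so that on pure tensors
  \<open>\<partial> (u \<otimes> v) = \<partial> u \<otimes> v + (-1)\<^sup>p u \<otimes> \<partial> v\<close> for \<open>u\<close> of degree \<open>p\<close>.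
\<close>

definition tensor_complex ::
    "('k, 's) ring_scheme \<Rightarrow> ('k, 'a) graded_complex \<Rightarrow> ('k, 'b) graded_complex
      \<Rightarrow> ('k, int \<times> int \<Rightarrow> ('a \<times> 'b \<Rightarrow> 'k) set) graded_complex" where
  "tensor_complex K A B =
    \<lparr>chains = (\<lambda>r. direct_sum_space {(p, q). p + q = r} (tensor_summand K A B)),
     bdry = (\<lambda>r t. \<lambda>(p, q)\<in>{(p, q). p + q = r - 1}.
       tensor_map K (chains A p) (chains B q) (bdry A (p + 1)) id (t (p + 1, q))
       \<oplus>\<^bsub>tensor_summand K A B (p, q)\<^esub>
       ring_sign K p \<odot>\<^bsub>tensor_summand K A B (p, q)\<^esub>
         tensor_map K (chains A p) (chains B q) id (bdry B (q + 1)) (t (p, q + 1)))\<rparr>"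

text \<open>The element \<open>u \<otimes> v\<close>, for \<open>u\<close> of degree \<open>p\<close> and \<open>v\<close> of degree \<open>q\<close>, of the tensor complex.\<close>

definition complex_tensor ::
    "('k, 's) ring_scheme \<Rightarrow> ('k, 'a) graded_complex \<Rightarrow> ('k, 'b) graded_complex
      \<Rightarrow> int \<Rightarrow> int \<Rightarrow> 'a \<Rightarrow> 'b \<Rightarrow> int \<times> int \<Rightarrow> ('a \<times> 'b \<Rightarrow> 'k) set" where
  "complex_tensor K A B p q u v =
    direct_sum_inj {(p', q'). p' + q' = p + q} (tensor_summand K A B) (p, q)
      (pure_tensor K (chains A p) (chains B q) u v)"


section \<open>Path complexes\<close>

text \<open>An elementary \<open>p\<close>-path is a list of length \<open>p + 1\<close>; the empty list is the empty path.\<close>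

locale path_complex =
  fixes V :: "'v set" and P :: "'v list set"
  assumes nonempty: "P \<noteq> {}"
    and vertices: "x \<in> P \<Longrightarrow> set x \<subseteq> V"
    and vertex_paths: "i \<in> V \<Longrightarrow> [i] \<in> P"
    and butlast_closed: "x \<in> P \<Longrightarrow> x \<noteq> [] \<Longrightarrow> butlast x \<in> P"
    and tl_closed: "x \<in> P \<Longrightarrow> x \<noteq> [] \<Longrightarrow> tl x \<in> P"

locale regular_path_complex = path_complex +
  assumes no_loops: "[i, i] \<notin> P"

definition regular_chains ::
    "('k, 's) ring_scheme \<Rightarrow> 'v set \<Rightarrow> int \<Rightarrow> ('k, 'v list \<Rightarrow> 'k) module" where
  "regular_chains K V p =
    free_space K {x. set x \<subseteq> V \<and> int (length x) = p + 1 \<and> distinct_adj x}"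

definition remove_nth :: "nat \<Rightarrow> 'v list \<Rightarrow> 'v list" where
  "remove_nth q x = take q x @ drop (Suc q) x"

definition path_boundary :: "('k, 's) ring_scheme \<Rightarrow> 'v list \<Rightarrow> 'v list \<Rightarrow> 'k" where
  "path_boundary K x = (\<lambda>y. \<Oplus>\<^bsub>K\<^esub>q\<in>{..<length x}.
     ring_sign K (int q) \<otimes>\<^bsub>K\<^esub>
       (if distinct_adj (remove_nth q x) then basis_vec K (remove_nth q x) y else \<zero>\<^bsub>K\<^esub>))"

definition boundary ::
    "('k, 's) ring_scheme \<Rightarrow> ('v list \<Rightarrow> 'k) \<Rightarrow> 'v list \<Rightarrow> 'k" where
  "boundary K = lin_ext K (path_boundary K)"

definition allowed_chains ::
    "('k, 's) ring_scheme \<Rightarrow> 'v set \<Rightarrow> 'v list set \<Rightarrow> int \<Rightarrow> ('v list \<Rightarrow> 'k) set" where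
  "allowed_chains K V P n =
    module.span K (regular_chains K V n) (basis_vec K ` {x \<in> P. int (length x) = n + 1})"

definition Omega ::
    "('k, 's) ring_scheme \<Rightarrow> 'v set \<Rightarrow> 'v list set \<Rightarrow> int \<Rightarrow> ('k, 'v list \<Rightarrow> 'k) module" where
  "Omega K V P n = regular_chains K V n
     \<lparr>carrier := {v \<in> allowed_chains K V P n. boundary K v \<in> allowed_chains K V P (n - 1)}\<rparr>"

definition Omega_complex ::
    "('k, 's) ring_scheme \<Rightarrow> 'v set \<Rightarrow> 'v list set \<Rightarrow> ('k, 'v list \<Rightarrow> 'k) graded_complex" where
  "Omega_complex K V P = \<lparr>chains = Omega K V P, bdry = (\<lambda>n. boundary K)\<rparr>"

definition reduced_homology ::
    "('k, 's) ring_scheme \<Rightarrow> 'v set \<Rightarrow> 'v list set \<Rightarrow> int \<Rightarrow> ('k, ('v list \<Rightarrow> 'k) set) module" where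
  "reduced_homology K V P = homology (Omega_complex K V P)"

definition join_paths :: "'v list set \<Rightarrow> 'v list set \<Rightarrow> 'v list set" where
  "join_paths P Q = {u @ v | u v. u \<in> P \<and> v \<in> Q}"

text \<open>The bilinear extension of the concatenation of paths.\<close>

definition join_chains ::
    "('k, 's) ring_scheme \<Rightarrow> ('v list \<Rightarrow> 'k) \<Rightarrow> ('v list \<Rightarrow> 'k) \<Rightarrow> 'v list \<Rightarrow> 'k" where
  "join_chains K u v = lin_ext K (\<lambda>x. lin_ext K (\<lambda>y. basis_vec K (x @ y)) v) u"

end

theory Submission
  imports Defs
begin

text \<open>
  Chains on the join are matrices.  Since \<open>X\<close> and \<open>Y\<close> are disjoint, a path of the join splits
  uniquely as \<open>x @ y\<close>, so a chain \<open>z\<close> on \<open>X \<union> Y\<close> is the same as the matrix \<open>w (x, y) = z (x @ y)\<close>.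
  The columns \<open>\<lambda>x. w (x, y)\<close> are chains on \<open>X\<close>, the rows \<open>\<lambda>y. w (x, y)\<close> are chains on \<open>Y\<close>, and
  the boundary of \<open>z\<close> corresponds to applying the boundary of \<open>X\<close> to the columns plus the boundary of
  \<open>Y\<close> to the rows, with the sign \<open>(-1)\<close> to the length of \<open>x\<close> (\<open>unjoin_boundary\<close>).  If \<open>x\<close> is not an
  allowed path, then the row at \<open>x\<close> vanishes, and the second summand contributes nothing at \<open>(x, y)\<close>;
  so the boundary of \<open>z\<close> is allowed only if every column has an allowed boundary, and in the same way
  for rows.  Hence the elements of \<open>\<Omega>\<close> of the join are exactly the matrices with columns in
  \<open>\<Omega>\<close> of \<open>X\<close> and rows in \<open>\<Omega>\<close> of \<open>Y\<close> (\<open>unjoin_in\<close>, \<open>join_in\<close>).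

  Such matrices form a tensor product.  A finite-dimensional space \<open>U\<close> of functions has an echelon
  basis: elements \<open>b d\<close>, one for each pivot \<open>d\<close>, such that the coordinates of \<open>u \<in> U\<close> are its values
  \<open>u d\<close> at the pivots (\<open>echelon_basis_exists\<close>).  Therefore a matrix \<open>w\<close> with columns in \<open>U\<close> is the sum
  of the products \<open>b d x * w (d, y)\<close>, so it comes from a tensor (\<open>evaluate_surj\<close>); and a tensor whose
  matrix is zero is zero, since it can be rewritten as a sum of tensors \<open>b d \<otimes> v d\<close>, in which the
  \<open>v d\<close> are rows of the matrix (\<open>null_eq_kernel\<close>).

  For homology, the same coordinates provide, on any finite-dimensional complex over a field, an
  operator \<open>h\<close> of degree one for which \<open>\<pi> = 1 - d h - h d\<close> is a projection with \<open>d \<pi> = \<pi> d = 0\<close>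
  (\<open>contraction_exists\<close>).  The image of \<open>\<pi>\<close> consists of cycles, called harmonic, one for each
  homology class (\<open>homology_model\<close>).  On matrices, applying \<open>h\<close> to columns and, with a sign, \<open>\<pi>\<close> to columns and
  \<open>h\<close> to rows gives a homotopy between the identity and the map that applies \<open>\<pi>\<close> to columns and rows
  (\<open>homotopy\<close>).  So the homology of the join is the space of matrices with harmonic columns and rows,
  which is again a tensor product.  Its summands with \<open>p = -1\<close> or \<open>q = -1\<close> vanish because every
  multiple of the empty path is the boundary of a multiple of a vertex (\<open>augmentation_surj\<close>).
\<close>

section \<open>Sums in a field\<close>

context field
begin

definition scalar_valued :: "('i \<Rightarrow> 'a) \<Rightarrow> bool" where
  "scalar_valued f \<longleftrightarrow> range f \<subseteq> carrier R"

lemma scalar_valuedI: "(\<And>i. f i \<in> carrier R) \<Longrightarrow> scalar_valued f"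
  by (auto simp: scalar_valued_def)

lemma scalar_valuedD [simp]: "scalar_valued f \<Longrightarrow> f i \<in> carrier R"
  by (auto simp: scalar_valued_def)

lemma finsum_if_single:
  assumes "finite A" "a \<in> carrier R" "i \<in> A"
  shows "(\<Oplus>j\<in>A. if j = i then a else \<zero>) = a"
  using assms add.finprod_singleton[of i A "\<lambda>_. a"] by (simp add: eq_commute)

lemma finsum_swap:
  assumes "finite A" "finite B" "\<And>a b. a \<in> A \<Longrightarrow> b \<in> B \<Longrightarrow> f a b \<in> carrier R"
  shows "(\<Oplus>a\<in>A. \<Oplus>b\<in>B. f a b) = (\<Oplus>b\<in>B. \<Oplus>a\<in>A. f a b)"
  using assms(1,3)
proof (induction A rule: finite_induct)
  case empty
  then show ?case by (simp add: add.finprod_one_eqI)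
next
  case (insert x F)
  have "(\<Oplus>b\<in>B. \<Oplus>a\<in>insert x F. f a b) = (\<Oplus>b\<in>B. f x b \<oplus> (\<Oplus>a\<in>F. f a b))"
    using insert by (intro add.finprod_cong') (auto simp: Pi_iff)
  also have "\<dots> = (\<Oplus>b\<in>B. f x b) \<oplus> (\<Oplus>b\<in>B. \<Oplus>a\<in>F. f a b)"
    using insert by (intro finsum_addf) (auto simp: Pi_iff)
  finally show ?case using insert by (simp add: Pi_iff)
qed

section \<open>Function spaces\<close>

text \<open>
  The operations are those of \<^const>\<open>free_space\<close>, and they do not depend on the carrier.  So every space
  obtained from a free space by changing the carrier is literally a \<open>function_space\<close>.
\<close>

definition function_space :: "('i \<Rightarrow> 'a) set \<Rightarrow> ('a, 'i \<Rightarrow> 'a) module" where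
  "function_space U = \<lparr>carrier = U, mult = undefined, one = undefined, zero = (\<lambda>i. \<zero>),
     add = (\<lambda>f g i. f i \<oplus> g i), smult = (\<lambda>c f i. c \<otimes> f i)\<rparr>"

lemma function_space_simps [simp]:
  "carrier (function_space U) = U"
  "\<zero>\<^bsub>function_space U\<^esub> = (\<lambda>i. \<zero>)"
  "f \<oplus>\<^bsub>function_space U\<^esub> g = (\<lambda>i. f i \<oplus> g i)"
  "c \<odot>\<^bsub>function_space U\<^esub> f = (\<lambda>i. c \<otimes> f i)"
  by (simp_all add: function_space_def)

definition function_subspace :: "('i \<Rightarrow> 'a) set \<Rightarrow> bool" where
  "function_subspace U \<longleftrightarrow> (\<forall>f\<in>U. scalar_valued f) \<and> (\<lambda>i. \<zero>) \<in> U \<and>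
     (\<forall>f\<in>U. \<forall>g\<in>U. (\<lambda>i. f i \<oplus> g i) \<in> U) \<and> (\<forall>c\<in>carrier R. \<forall>f\<in>U. (\<lambda>i. c \<otimes> f i) \<in> U)"

lemma function_subspaceI:
  assumes "\<And>f i. f \<in> U \<Longrightarrow> f i \<in> carrier R" "(\<lambda>i. \<zero>) \<in> U"
    "\<And>f g. f \<in> U \<Longrightarrow> g \<in> U \<Longrightarrow> (\<lambda>i. f i \<oplus> g i) \<in> U"
    "\<And>c f. c \<in> carrier R \<Longrightarrow> f \<in> U \<Longrightarrow> (\<lambda>i. c \<otimes> f i) \<in> U"
  shows "function_subspace U"
  using assms by (auto simp: function_subspace_def scalar_valued_def)

lemma
  assumes "function_subspace U"
  shows subspace_scalar: "f \<in> U \<Longrightarrow> scalar_valued f"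
    and subspace_closed: "f \<in> U \<Longrightarrow> f i \<in> carrier R"
    and subspace_zero: "(\<lambda>i. \<zero>) \<in> U"
    and subspace_add: "f \<in> U \<Longrightarrow> g \<in> U \<Longrightarrow> (\<lambda>i. f i \<oplus> g i) \<in> U"
    and subspace_smult: "c \<in> carrier R \<Longrightarrow> f \<in> U \<Longrightarrow> (\<lambda>i. c \<otimes> f i) \<in> U"
  using assms by (auto simp: function_subspace_def)

lemma subspace_uminus:
  assumes "function_subspace U" "f \<in> U"
  shows "(\<lambda>i. \<ominus> f i) \<in> U"
proof -
  have "(\<lambda>i. \<ominus> f i) = (\<lambda>i. (\<ominus> \<one>) \<otimes> f i)"
    using subspace_closed[OF assms] by (simp add: l_minus)
  then show ?thesis using subspace_smult[OF assms(1) _ assms(2), of "\<ominus> \<one>"] by simp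
qed

lemma subspace_minus:
  assumes "function_subspace U" "f \<in> U" "g \<in> U"
  shows "(\<lambda>i. f i \<ominus> g i) \<in> U"
  using subspace_add[OF assms(1,2) subspace_uminus[OF assms(1,3)]] by (simp add: a_minus_def)

lemma subspace_finsum:
  assumes "function_subspace U" "finite A" "\<And>a. a \<in> A \<Longrightarrow> f a \<in> U"
  shows "(\<lambda>i. \<Oplus>a\<in>A. f a i) \<in> U"
  using assms(2,3)
proof (induction A rule: finite_induct)
  case (insert x F)
  have "(\<lambda>i. \<Oplus>a\<in>insert x F. f a i) = (\<lambda>i. f x i \<oplus> (\<Oplus>a\<in>F. f a i))"
    using insert subspace_closed[OF assms(1)] by (auto simp: Pi_iff)
  also have "\<dots> \<in> U" using insert by (intro subspace_add[OF assms(1)]) auto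
  finally show ?case .
qed (simp add: subspace_zero[OF assms(1)])

lemma subspace_lincomb:
  assumes "function_subspace U" "finite A" "\<And>a. a \<in> A \<Longrightarrow> f a \<in> U" "\<And>a. a \<in> A \<Longrightarrow> c a \<in> carrier R"
  shows "(\<lambda>i. \<Oplus>a\<in>A. c a \<otimes> f a i) \<in> U"
  using subspace_finsum[OF assms(1,2), of "\<lambda>a i. c a \<otimes> f a i"] subspace_smult[OF assms(1)] assms(3,4)
  by blast

text \<open>
  Quotients, tensor products and direct sums acquire their vector space structure from a bijection
  with a space of functions that respects the operations; no axiom is ever verified for cosets.
\<close>

lemma vectorspace_by_iso:
  fixes M :: "('a, 'c) module"
  assumes U: "function_subspace U" and bij: "bij_betw \<alpha> (carrier M) U"
    and zero: "\<zero>\<^bsub>M\<^esub> \<in> carrier M" "\<alpha> \<zero>\<^bsub>M\<^esub> = (\<lambda>i. \<zero>)"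
    and add: "\<And>x y. x \<in> carrier M \<Longrightarrow> y \<in> carrier M \<Longrightarrow>
      x \<oplus>\<^bsub>M\<^esub> y \<in> carrier M \<and> \<alpha> (x \<oplus>\<^bsub>M\<^esub> y) = (\<lambda>i. \<alpha> x i \<oplus> \<alpha> y i)"
    and smult: "\<And>c x. c \<in> carrier R \<Longrightarrow> x \<in> carrier M \<Longrightarrow>
      c \<odot>\<^bsub>M\<^esub> x \<in> carrier M \<and> \<alpha> (c \<odot>\<^bsub>M\<^esub> x) = (\<lambda>i. c \<otimes> \<alpha> x i)"
  shows "vectorspace R M"
proof -
  have inj: "x = y" if "x \<in> carrier M" "y \<in> carrier M" "\<alpha> x = \<alpha> y" for x y
    using bij that by (auto simp: bij_betw_def inj_on_def)
  have im: "\<alpha> x \<in> U" if "x \<in> carrier M" for x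
    using bij that by (auto simp: bij_betw_def)
  note cl [simp] = subspace_closed[OF U im] add[THEN conjunct1] smult[THEN conjunct1]
    add[THEN conjunct2] smult[THEN conjunct2] zero
  have grp: "abelian_group M"
  proof (rule abelian_groupI)
    fix x assume x: "x \<in> carrier M"
    have "(\<lambda>i. \<ominus> \<alpha> x i) \<in> U" by (intro subspace_uminus U im x)
    then obtain y where y: "y \<in> carrier M" "\<alpha> y = (\<lambda>i. \<ominus> \<alpha> x i)"
      using bij by (auto simp: bij_betw_def)
    then have "y \<oplus>\<^bsub>M\<^esub> x = \<zero>\<^bsub>M\<^esub>" using x by (intro inj) (auto simp: l_neg)
    with y show "\<exists>y\<in>carrier M. y \<oplus>\<^bsub>M\<^esub> x = \<zero>\<^bsub>M\<^esub>" by blast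
  qed (auto intro!: inj simp: a_ac)
  have "module R M"
    by (rule moduleI[OF is_cring grp]) (auto intro!: inj simp: l_distr r_distr m_assoc)
  then show ?thesis by (simp add: vectorspace_def field_axioms)
qed

lemma vectorspace_function_space [simp, intro]:
  assumes "function_subspace U" shows "vectorspace R (function_space U)"
  by (rule vectorspace_by_iso[OF assms, of id]) 
    (auto intro: subspace_add[OF assms] subspace_smult[OF assms] subspace_zero[OF assms])

lemma linear_mapI:
  fixes M :: "('a, 'c) module" and N :: "('a, 'd) module"
  assumes "vectorspace R M" "vectorspace R N" "\<And>x. x \<in> carrier M \<Longrightarrow> f x \<in> carrier N"
    "\<And>x y. x \<in> carrier M \<Longrightarrow> y \<in> carrier M \<Longrightarrow> f (x \<oplus>\<^bsub>M\<^esub> y) = f x \<oplus>\<^bsub>N\<^esub> f y"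
    "\<And>c x. c \<in> carrier R \<Longrightarrow> x \<in> carrier M \<Longrightarrow> f (c \<odot>\<^bsub>M\<^esub> x) = c \<odot>\<^bsub>N\<^esub> f x"
  shows "linear_map R M N f"
  using assms
  by (auto simp: linear_map_def mod_hom_def mod_hom_axioms_def module_hom_def vectorspace_def)

lemma
  fixes M :: "('a, 'c) module" and N :: "('a, 'd) module"
  assumes "linear_map R M N f"
  shows linear_map_closed: "x \<in> carrier M \<Longrightarrow> f x \<in> carrier N"
    and linear_map_add: "x \<in> carrier M \<Longrightarrow> y \<in> carrier M \<Longrightarrow> f (x \<oplus>\<^bsub>M\<^esub> y) = f x \<oplus>\<^bsub>N\<^esub> f y"
    and linear_map_smult: "c \<in> carrier R \<Longrightarrow> x \<in> carrier M \<Longrightarrow> f (c \<odot>\<^bsub>M\<^esub> x) = c \<odot>\<^bsub>N\<^esub> f x"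
    and linear_map_zero: "f \<zero>\<^bsub>M\<^esub> = \<zero>\<^bsub>N\<^esub>"
    and linear_map_vs1: "vectorspace R M"
    and linear_map_vs2: "vectorspace R N"
  using assms mod_hom.f0_is_0[of R M N f]
  by (auto simp: linear_map_def mod_hom_def mod_hom_axioms_def module_hom_def)

lemma linear_iso_linear: "linear_iso R V W f \<Longrightarrow> linear_map R V W f"
  by (simp add: linear_iso_def)

lemma linear_iso_id: "function_subspace U \<Longrightarrow> linear_iso R (function_space U) (function_space U) id"
  unfolding linear_iso_def by (auto intro: linear_mapI)

lemma linear_iso_by_model:
  fixes M :: "('a, 'c) module"
  assumes "function_subspace U" "bij_betw \<alpha> (carrier M) U"
    "\<zero>\<^bsub>M\<^esub> \<in> carrier M" "\<alpha> \<zero>\<^bsub>M\<^esub> = (\<lambda>i. \<zero>)"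
    "\<And>x y. x \<in> carrier M \<Longrightarrow> y \<in> carrier M \<Longrightarrow>
      x \<oplus>\<^bsub>M\<^esub> y \<in> carrier M \<and> \<alpha> (x \<oplus>\<^bsub>M\<^esub> y) = (\<lambda>i. \<alpha> x i \<oplus> \<alpha> y i)"
    "\<And>c x. c \<in> carrier R \<Longrightarrow> x \<in> carrier M \<Longrightarrow>
      c \<odot>\<^bsub>M\<^esub> x \<in> carrier M \<and> \<alpha> (c \<odot>\<^bsub>M\<^esub> x) = (\<lambda>i. c \<otimes> \<alpha> x i)"
  shows "linear_iso R M (function_space U) \<alpha>"
  unfolding linear_iso_def
  using vectorspace_by_iso[OF assms] assms
  by (auto intro!: linear_mapI simp: bij_betw_def)

lemma linear_iso_comp:
  fixes M :: "('a, 'c) module" and N :: "('a, 'd) module" and P :: "('a, 'e) module"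
  assumes "linear_iso R M N f" "linear_iso R N P g"
  shows "linear_iso R M P (g \<circ> f)"
proof -
  have f: "linear_map R M N f" and g: "linear_map R N P g"
    and bij: "bij_betw f (carrier M) (carrier N)" "bij_betw g (carrier N) (carrier P)"
    using assms by (auto simp: linear_iso_def)
  note [simp] = linear_map_closed[OF f] linear_map_closed[OF g] linear_map_add[OF f]
    linear_map_add[OF g] linear_map_smult[OF f] linear_map_smult[OF g]
  have "linear_map R M P (g \<circ> f)"
    by (rule linear_mapI[OF linear_map_vs1[OF f] linear_map_vs2[OF g]]) simp_all
  then show ?thesis using bij_betw_trans[OF bij] by (simp add: linear_iso_def)
qed

lemma linear_iso_inv:
  fixes M :: "('a, 'c) module" and N :: "('a, 'd) module"
  assumes "linear_iso R M N f"
  shows "linear_iso R N M (inv_into (carrier M) f)"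
proof -
  have lin: "linear_map R M N f" and bij: "bij_betw f (carrier M) (carrier N)"
    using assms by (auto simp: linear_iso_def)
  interpret M: vectorspace R M by (rule linear_map_vs1[OF lin])
  let ?g = "inv_into (carrier M) f"
  have g: "?g y \<in> carrier M" "f (?g y) = y" if "y \<in> carrier N" for y
    using bij that by (auto simp: bij_betw_def inv_into_into f_inv_into_f)
  have gf: "?g (f x) = x" if "x \<in> carrier M" for x
    using bij that by (auto simp: bij_betw_def)
  have "linear_map R N M ?g"
  proof (rule linear_mapI)
    fix x y assume "x \<in> carrier N" "y \<in> carrier N"
    then show "?g (x \<oplus>\<^bsub>N\<^esub> y) = ?g x \<oplus>\<^bsub>M\<^esub> ?g y"
      using gf[of "?g x \<oplus>\<^bsub>M\<^esub> ?g y"] g by (simp add: linear_map_add[OF lin])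
  next
    fix c x assume "c \<in> carrier R" "x \<in> carrier N"
    then show "?g (c \<odot>\<^bsub>N\<^esub> x) = c \<odot>\<^bsub>M\<^esub> ?g x"
      using gf[of "c \<odot>\<^bsub>M\<^esub> ?g x"] g by (simp add: linear_map_smult[OF lin])
  qed (auto intro: linear_map_vs1[OF lin] linear_map_vs2[OF lin] g)
  then show ?thesis using bij by (simp add: linear_iso_def bij_betw_inv_into)
qed

section \<open>Echelon bases\<close>

text \<open>
  A basis in reduced echelon form, with pivots \<open>D\<close>.  The coordinates of an element are its values at
  the pivots.
\<close>

definition echelon_basis :: "('i \<Rightarrow> 'a) set \<Rightarrow> 'i set \<Rightarrow> ('i \<Rightarrow> 'i \<Rightarrow> 'a) \<Rightarrow> bool" where
  "echelon_basis U D b \<longleftrightarrow> finite D \<and> (\<forall>d\<in>D. b d \<in> U) \<and>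
     (\<forall>d\<in>D. \<forall>e\<in>D. b d e = (if e = d then \<one> else \<zero>)) \<and>
     (\<forall>u\<in>U. \<forall>i. u i = (\<Oplus>d\<in>D. u d \<otimes> b d i))"

text \<open>
  Gaussian elimination, by induction on the set \<open>S\<close> that supports all members of \<open>U\<close>.  When some
  \<open>u0 \<in> U\<close> has the value one at a new point \<open>s\<close>, every \<open>u \<in> U\<close> differs from \<open>u s * u0\<close> by a function
  vanishing at \<open>s\<close>, to which the induction hypothesis applies; \<open>s\<close> becomes a pivot.
\<close>

lemma echelon_basis_exists:
  assumes "finite S" "function_subspace U" "\<And>u i. u \<in> U \<Longrightarrow> u i \<noteq> \<zero> \<Longrightarrow> i \<in> S"
  shows "\<exists>D b. D \<subseteq> S \<and> echelon_basis U D b"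
  using assms
proof (induction S arbitrary: U rule: finite_induct)
  case empty
  then show ?case by (intro exI[of _ "{}"]) (auto simp: echelon_basis_def)
next
  case (insert s S)
  note U = \<open>function_subspace U\<close>
  note cl [simp] = subspace_closed[OF U]
  show ?case
  proof (cases "\<forall>u\<in>U. u s = \<zero>")
    case True
    have "\<exists>D b. D \<subseteq> S \<and> echelon_basis U D b"
    proof (rule insert.IH[OF U])
      fix u i assume "u \<in> U" "u i \<noteq> \<zero>"
      then show "i \<in> S" using insert.prems(2)[of u i] True by auto
    qed
    then show ?thesis by blast
  next
    case False
    then obtain u1 where u1: "u1 \<in> U" "u1 s \<noteq> \<zero>" by blast
    define u0 where "u0 = (\<lambda>i. inv (u1 s) \<otimes> u1 i)"
    have inv: "inv (u1 s) \<in> carrier R" "inv (u1 s) \<otimes> u1 s = \<one>"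
      using u1 by (auto intro!: Units_inv_closed Units_l_inv simp: field_Units)
    then have u0: "u0 \<in> U" "u0 s = \<one>"
      using subspace_smult[OF U inv(1) u1(1)] by (auto simp: u0_def)
    define U1 where "U1 = {u \<in> U. u s = \<zero>}"
    have U1: "function_subspace U1"
      using subspace_zero[OF U] subspace_add[OF U] subspace_smult[OF U]
      by (intro function_subspaceI) (auto simp: U1_def)
    have "\<exists>D b. D \<subseteq> S \<and> echelon_basis U1 D b"
    proof (rule insert.IH[OF U1])
      fix u i assume "u \<in> U1" "u i \<noteq> \<zero>"
      then show "i \<in> S" using insert.prems(2)[of u i] by (auto simp: U1_def)
    qed
    then obtain D b where D: "D \<subseteq> S" and b: "echelon_basis U1 D b" by blast
    from b have finD: "finite D" and bU: "\<And>d. d \<in> D \<Longrightarrow> b d \<in> U" and bs: "\<And>d. d \<in> D \<Longrightarrow> b d s = \<zero>"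
      and delta: "\<And>d e. d \<in> D \<Longrightarrow> e \<in> D \<Longrightarrow> b d e = (if e = d then \<one> else \<zero>)"
      and ex: "\<And>u i. u \<in> U1 \<Longrightarrow> u i = (\<Oplus>d\<in>D. u d \<otimes> b d i)"
      by (auto simp: echelon_basis_def U1_def)
    have sD: "s \<notin> D" using D insert.hyps by blast
    \<comment> \<open>Clearing the entries of \<open>u0\<close> at the old pivots.\<close>
    define b' where "b' = (\<lambda>i. u0 i \<ominus> (\<Oplus>d\<in>D. u0 d \<otimes> b d i))"
    have sumU: "(\<lambda>i. \<Oplus>d\<in>D. u d \<otimes> b d i) \<in> U" if "u \<in> U" for u
      using that by (intro subspace_lincomb[OF U finD] bU) auto
    have b'U: "b' \<in> U"
      unfolding b'_def by (intro subspace_minus[OF U u0(1)] sumU u0)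
    have sum_s: "(\<Oplus>d\<in>D. u d \<otimes> b d s) = \<zero>" if "u \<in> U" for u
      using that bs by (intro add.finprod_one_eqI) auto
    have sum_e: "(\<Oplus>d\<in>D. u d \<otimes> b d e) = u e" if "u \<in> U" "e \<in> D" for u e
    proof -
      have "(\<Oplus>d\<in>D. u d \<otimes> b d e) = (\<Oplus>d\<in>D. if d = e then u e else \<zero>)"
        using that delta by (intro add.finprod_cong') auto
      then show ?thesis using that finD by (simp add: finsum_if_single)
    qed
    define B where "B = (\<lambda>d. if d = s then b' else b d)"
    have "echelon_basis U (insert s D) B"
      unfolding echelon_basis_def
    proof (intro conjI ballI allI)
      fix d e assume "d \<in> insert s D" "e \<in> insert s D"
      then show "B d e = (if e = d then \<one> else \<zero>)"
        using delta bs sD u0 sum_s[OF u0(1)] sum_e[OF u0(1)]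
        by (auto simp: B_def b'_def a_minus_def r_neg)
    next
      fix u i assume u: "u \<in> U"
      define v where "v = (\<lambda>i. u i \<ominus> u s \<otimes> u0 i)"
      have vU: "v \<in> U" unfolding v_def using u u0 by (intro subspace_minus[OF U] subspace_smult[OF U]) auto
      have "v \<in> U1" using vU u u0 by (auto simp: U1_def v_def)
      then have "v i = (\<Oplus>d\<in>D. v d \<otimes> b d i)" by (rule ex)
      also have "\<dots> = (\<Oplus>d\<in>D. u d \<otimes> b d i \<oplus> (\<ominus> (u s)) \<otimes> (u0 d \<otimes> b d i))"
        using u u0 bU by (intro add.finprod_cong') (auto simp: v_def a_minus_def l_distr l_minus m_assoc)
      also have "\<dots> = (\<Oplus>d\<in>D. u d \<otimes> b d i) \<oplus> (\<ominus> (u s)) \<otimes> (\<Oplus>d\<in>D. u0 d \<otimes> b d i)"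
        using u u0 bU finD by (simp add: finsum_addf finsum_rdistr Pi_iff)
      finally have veq: "u i \<ominus> u s \<otimes> u0 i = (\<Oplus>d\<in>D. u d \<otimes> b d i) \<oplus> (\<ominus> (u s)) \<otimes> (\<Oplus>d\<in>D. u0 d \<otimes> b d i)"
        by (simp add: v_def)
      define p q where "p = (\<Oplus>d\<in>D. u d \<otimes> b d i)" and "q = (\<Oplus>d\<in>D. u0 d \<otimes> b d i)"
      have pq: "p \<in> carrier R" "q \<in> carrier R"
        using u u0 bU by (auto simp: p_def q_def intro!: finsum_closed)
      have "(\<Oplus>d\<in>insert s D. u d \<otimes> B d i) = u s \<otimes> b' i \<oplus> (\<Oplus>d\<in>D. u d \<otimes> B d i)"
        using finD sD u b'U bU by (subst finsum_insert) (auto simp: B_def Pi_iff)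
      also have "(\<Oplus>d\<in>D. u d \<otimes> B d i) = p"
        unfolding p_def using sD u bU by (intro add.finprod_cong') (auto simp: B_def)
      also have "u s \<otimes> b' i \<oplus> p = u i"
      proof -
        have e: "u i \<ominus> u s \<otimes> u0 i = p \<oplus> (\<ominus> (u s)) \<otimes> q" using veq by (simp add: p_def q_def)
        have "u i = (u i \<ominus> u s \<otimes> u0 i) \<oplus> u s \<otimes> u0 i"
          using u u0 by (simp add: a_minus_def a_assoc l_neg)
        also have "\<dots> = u s \<otimes> (u0 i \<ominus> q) \<oplus> p"
          unfolding e using u u0 pq by (simp add: a_minus_def r_distr l_minus r_minus a_ac)
        finally show ?thesis by (simp add: b'_def q_def)
      qed
      finally show "u i = (\<Oplus>d\<in>insert s D. u d \<otimes> B d i)" by simp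
    qed (use finD b'U bU in \<open>auto simp: B_def\<close>)
    then show ?thesis using D by (intro exI[of _ "insert s D"] exI[of _ B]) auto
  qed
qed

section \<open>Finite combinations of evaluations\<close>

text \<open>
  On \<open>U\<close> with an echelon basis every linear functional has this form.  A functional of this form can be
  applied to each column of a matrix without extending any map to a tensor product: the values it
  produces are a linear combination of rows (\<open>functional_slices\<close>), and applications to columns
  and to rows commute, as finite sums do (\<open>functionals_commute\<close>).
\<close>

definition local_functional :: "'i set \<Rightarrow> (('i \<Rightarrow> 'a) \<Rightarrow> 'a) \<Rightarrow> bool" where
  "local_functional E \<phi> \<longleftrightarrow> (\<exists>D c. finite D \<and> D \<subseteq> E \<and> c \<in> D \<rightarrow> carrier R \<and>
     (\<forall>u. scalar_valued u \<longrightarrow> \<phi> u = (\<Oplus>e\<in>D. c e \<otimes> u e)))"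

lemma local_functionalI:
  assumes "finite D" "D \<subseteq> E" "\<And>e. e \<in> D \<Longrightarrow> c e \<in> carrier R"
    "\<And>u. scalar_valued u \<Longrightarrow> \<phi> u = (\<Oplus>e\<in>D. c e \<otimes> u e)"
  shows "local_functional E \<phi>"
  using assms unfolding local_functional_def by blast

lemma local_functionalE:
  assumes "local_functional E \<phi>"
  obtains D c where "finite D" "D \<subseteq> E" "\<And>e. e \<in> D \<Longrightarrow> c e \<in> carrier R"
    "\<And>u. scalar_valued u \<Longrightarrow> \<phi> u = (\<Oplus>e\<in>D. c e \<otimes> u e)"
proof -
  obtain D c where "finite D" "D \<subseteq> E" "c \<in> D \<rightarrow> carrier R"
    "\<forall>u. scalar_valued u \<longrightarrow> \<phi> u = (\<Oplus>e\<in>D. c e \<otimes> u e)"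
    using assms unfolding local_functional_def by blast
  then show thesis by (intro that[of D c]) auto
qed

lemma local_functional_zero: "local_functional E (\<lambda>u. \<zero>)"
  by (rule local_functionalI[of "{}"]) auto

lemma local_functional_eval: "e \<in> E \<Longrightarrow> local_functional E (\<lambda>u. u e)"
  by (rule local_functionalI[of "{e}" _ "\<lambda>_. \<one>"]) auto

lemma local_functional_smult:
  fixes \<phi> :: "('i \<Rightarrow> 'a) \<Rightarrow> 'a"
  assumes "local_functional E \<phi>" "a \<in> carrier R"
  shows "local_functional E (\<lambda>u. a \<otimes> \<phi> u)"
proof (rule local_functionalE[OF assms(1)])
  fix D c assume *: "finite D" "D \<subseteq> E" "\<And>e. e \<in> D \<Longrightarrow> c e \<in> carrier R"
    "\<And>u. scalar_valued u \<Longrightarrow> \<phi> u = (\<Oplus>e\<in>D. c e \<otimes> u e)"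
  show ?thesis
  proof (rule local_functionalI[OF *(1,2), of "\<lambda>e. a \<otimes> c e"])
    fix u :: "'i \<Rightarrow> 'a" assume "scalar_valued u"
    then show "a \<otimes> \<phi> u = (\<Oplus>e\<in>D. (a \<otimes> c e) \<otimes> u e)"
      using * assms(2) by (simp add: finsum_rdistr m_assoc Pi_iff cong: add.finprod_cong)
  qed (use * assms(2) in auto)
qed

lemma local_functional_add:
  fixes \<phi> :: "('i \<Rightarrow> 'a) \<Rightarrow> 'a"
  assumes "local_functional E \<phi>" "local_functional E \<psi>"
  shows "local_functional E (\<lambda>u. \<phi> u \<oplus> \<psi> u)"
proof (rule local_functionalE[OF assms(1)], rule local_functionalE[OF assms(2)])
  fix D1 c1 D2 c2
  assume 1: "finite D1" "D1 \<subseteq> E" "\<And>e. e \<in> D1 \<Longrightarrow> c1 e \<in> carrier R"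
      "\<And>u. scalar_valued u \<Longrightarrow> \<phi> u = (\<Oplus>e\<in>D1. c1 e \<otimes> u e)"
    and 2: "finite D2" "D2 \<subseteq> E" "\<And>e. e \<in> D2 \<Longrightarrow> c2 e \<in> carrier R"
      "\<And>u. scalar_valued u \<Longrightarrow> \<psi> u = (\<Oplus>e\<in>D2. c2 e \<otimes> u e)"
  let ?D = "D1 \<union> D2"
  let ?c1 = "\<lambda>e. if e \<in> D1 then c1 e else \<zero>" and ?c2 = "\<lambda>e. if e \<in> D2 then c2 e else \<zero>"
  show ?thesis
  proof (rule local_functionalI[of ?D _ "\<lambda>e. ?c1 e \<oplus> ?c2 e"])
    fix u :: "'i \<Rightarrow> 'a" assume u: "scalar_valued u"
    have "\<phi> u = (\<Oplus>e\<in>?D. ?c1 e \<otimes> u e)"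
      unfolding 1(4)[OF u] using 1(1-3) 2(1) u
      by (intro add.finprod_mono_neutral_cong_left) auto
    moreover have "\<psi> u = (\<Oplus>e\<in>?D. ?c2 e \<otimes> u e)"
      unfolding 2(4)[OF u] using 2(1-3) 1(1) u
      by (intro add.finprod_mono_neutral_cong_left) auto
    ultimately have "\<phi> u \<oplus> \<psi> u = (\<Oplus>e\<in>?D. ?c1 e \<otimes> u e \<oplus> ?c2 e \<otimes> u e)"
      using u 1 2 by (simp add: finsum_addf Pi_iff)
    also have "\<dots> = (\<Oplus>e\<in>?D. (?c1 e \<oplus> ?c2 e) \<otimes> u e)"
      using u 1 2 by (intro add.finprod_cong') (auto simp: l_distr)
    finally show "\<phi> u \<oplus> \<psi> u = (\<Oplus>e\<in>?D. (?c1 e \<oplus> ?c2 e) \<otimes> u e)" .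
  qed (use 1 2 in auto)
qed

context
  fixes E :: "'i set" and \<phi> :: "('i \<Rightarrow> 'a) \<Rightarrow> 'a"
  assumes \<phi>: "local_functional E \<phi>"
begin

lemma functional_closed: "scalar_valued u \<Longrightarrow> \<phi> u \<in> carrier R"
  by (rule local_functionalE[OF \<phi>]) (auto intro!: finsum_closed)

lemma functional_cong:
  assumes "scalar_valued u" "scalar_valued v" "\<And>e. e \<in> E \<Longrightarrow> u e = v e"
  shows "\<phi> u = \<phi> v"
  by (rule local_functionalE[OF \<phi>]) (use assms in \<open>auto intro!: add.finprod_cong'\<close>)

lemma functional_add:
  assumes "scalar_valued u" "scalar_valued v"
  shows "\<phi> (\<lambda>i. u i \<oplus> v i) = \<phi> u \<oplus> \<phi> v"
proof (rule local_functionalE[OF \<phi>])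
  fix D c assume *: "finite D" "D \<subseteq> E" "\<And>e. e \<in> D \<Longrightarrow> c e \<in> carrier R"
    "\<And>u. scalar_valued u \<Longrightarrow> \<phi> u = (\<Oplus>e\<in>D. c e \<otimes> u e)"
  have "\<phi> (\<lambda>i. u i \<oplus> v i) = (\<Oplus>e\<in>D. c e \<otimes> (u e \<oplus> v e))"
    using assms by (intro *(4) scalar_valuedI) auto
  also have "\<dots> = (\<Oplus>e\<in>D. c e \<otimes> u e \<oplus> c e \<otimes> v e)"
    using assms * by (intro add.finprod_cong') (auto simp: r_distr)
  also have "\<dots> = \<phi> u \<oplus> \<phi> v"
    using assms * by (simp add: finsum_addf Pi_iff)
  finally show ?thesis .
qed

lemma functional_smult:
  assumes "a \<in> carrier R" "scalar_valued u"
  shows "\<phi> (\<lambda>i. a \<otimes> u i) = a \<otimes> \<phi> u"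
proof (rule local_functionalE[OF \<phi>])
  fix D c assume *: "finite D" "D \<subseteq> E" "\<And>e. e \<in> D \<Longrightarrow> c e \<in> carrier R"
    "\<And>u. scalar_valued u \<Longrightarrow> \<phi> u = (\<Oplus>e\<in>D. c e \<otimes> u e)"
  have "\<phi> (\<lambda>i. a \<otimes> u i) = (\<Oplus>e\<in>D. c e \<otimes> (a \<otimes> u e))"
    using assms by (intro *(4) scalar_valuedI) auto
  also have "\<dots> = (\<Oplus>e\<in>D. a \<otimes> (c e \<otimes> u e))"
    using assms * by (intro add.finprod_cong') (auto simp: m_lcomm)
  also have "\<dots> = a \<otimes> \<phi> u"
    using assms * by (simp add: finsum_rdistr Pi_iff)
  finally show ?thesis .
qed

lemma functional_zero: "\<phi> (\<lambda>i. \<zero>) = \<zero>"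
  using functional_smult[of \<zero> "\<lambda>i. \<zero>"] functional_closed[of "\<lambda>i. \<zero>"]
  by (simp add: scalar_valued_def)

lemma functional_minus:
  assumes "scalar_valued u" "scalar_valued v"
  shows "\<phi> (\<lambda>i. u i \<ominus> v i) = \<phi> u \<ominus> \<phi> v"
proof -
  have sv: "scalar_valued (\<lambda>i. (\<ominus> \<one>) \<otimes> v i)" using assms by (auto intro!: scalar_valuedI)
  have "(\<lambda>i. u i \<ominus> v i) = (\<lambda>i. u i \<oplus> (\<ominus> \<one>) \<otimes> v i)"
    using assms by (auto simp: a_minus_def l_minus)
  then have "\<phi> (\<lambda>i. u i \<ominus> v i) = \<phi> u \<oplus> \<phi> (\<lambda>i. (\<ominus> \<one>) \<otimes> v i)"
    using functional_add[OF assms(1) sv] by simp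
  also have "\<phi> (\<lambda>i. (\<ominus> \<one>) \<otimes> v i) = \<ominus> \<phi> v"
    using functional_smult[of "\<ominus> \<one>" v] functional_closed[OF assms(2)] assms(2) by (simp add: l_minus)
  finally show ?thesis by (simp add: a_minus_def)
qed

lemma functional_finsum:
  assumes "finite A" "\<And>a. a \<in> A \<Longrightarrow> scalar_valued (f a)"
  shows "\<phi> (\<lambda>i. \<Oplus>a\<in>A. f a i) = (\<Oplus>a\<in>A. \<phi> (f a))"
  using assms
proof (induction A rule: finite_induct)
  case empty
  then show ?case by (simp add: functional_zero)
next
  case (insert x F)
  have "(\<lambda>i. \<Oplus>a\<in>insert x F. f a i) = (\<lambda>i. f x i \<oplus> (\<Oplus>a\<in>F. f a i))"
    using insert by (auto simp: Pi_iff)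
  moreover have "\<phi> (\<lambda>i. f x i \<oplus> (\<Oplus>a\<in>F. f a i)) = \<phi> (f x) \<oplus> \<phi> (\<lambda>i. \<Oplus>a\<in>F. f a i)"
    using insert.prems by (intro functional_add) (auto intro!: scalar_valuedI finsum_closed)
  ultimately have "\<phi> (\<lambda>i. \<Oplus>a\<in>insert x F. f a i) = \<phi> (f x) \<oplus> (\<Oplus>a\<in>F. \<phi> (f a))"
    using insert by simp
  then show ?case using insert by (auto simp: functional_closed Pi_iff)
qed

lemma functional_slices:
  assumes "function_subspace V" "\<And>e. e \<in> E \<Longrightarrow> (\<lambda>y. w (e, y)) \<in> V" "\<And>y. scalar_valued (\<lambda>x. w (x, y))"
  shows "(\<lambda>y. \<phi> (\<lambda>x. w (x, y))) \<in> V"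
proof (rule local_functionalE[OF \<phi>])
  fix D c assume *: "finite D" "D \<subseteq> E" "\<And>e. e \<in> D \<Longrightarrow> c e \<in> carrier R"
    "\<And>u. scalar_valued u \<Longrightarrow> \<phi> u = (\<Oplus>e\<in>D. c e \<otimes> u e)"
  have "(\<lambda>y. \<Oplus>e\<in>D. c e \<otimes> w (e, y)) \<in> V"
    using * assms(2) by (intro subspace_lincomb[OF assms(1)]) auto
  then show ?thesis using assms(3) by (simp add: *(4))
qed

end

lemma local_functional_finsum:
  fixes \<phi> :: "'c \<Rightarrow> ('i \<Rightarrow> 'a) \<Rightarrow> 'a"
  assumes "finite A" "\<And>a. a \<in> A \<Longrightarrow> local_functional E (\<phi> a)"
  shows "local_functional E (\<lambda>u. \<Oplus>a\<in>A. \<phi> a u)"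
  using assms
proof (induction A rule: finite_induct)
  case empty
  then show ?case by (simp add: local_functional_zero)
next
  case (insert x F)
  have "local_functional E (\<lambda>u. \<phi> x u \<oplus> (\<Oplus>a\<in>F. \<phi> a u))"
    using insert by (intro local_functional_add) auto
  then show ?case
  proof (rule local_functionalE)
    fix D c assume *: "finite D" "D \<subseteq> E" "\<And>e. e \<in> D \<Longrightarrow> c e \<in> carrier R"
      "\<And>u. scalar_valued u \<Longrightarrow> \<phi> x u \<oplus> (\<Oplus>a\<in>F. \<phi> a u) = (\<Oplus>e\<in>D. c e \<otimes> u e)"
    show ?thesis
    proof (rule local_functionalI[OF *(1-3)])
      fix u :: "'i \<Rightarrow> 'a" assume "scalar_valued u"
      then show "(\<Oplus>a\<in>insert x F. \<phi> a u) = (\<Oplus>e\<in>D. c e \<otimes> u e)"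
        using insert.hyps *(4) functional_closed[OF insert.prems] by (subst finsum_insert) (auto simp: Pi_iff)
    qed auto
  qed
qed

lemma local_functional_comp:
  assumes "local_functional E \<phi>" "\<And>e. e \<in> E \<Longrightarrow> local_functional E' (\<lambda>u. F u e)"
    "\<And>u. scalar_valued u \<Longrightarrow> scalar_valued (F u)"
  shows "local_functional E' (\<lambda>u. \<phi> (F u))"
proof (rule local_functionalE[OF assms(1)])
  fix D c assume *: "finite D" "D \<subseteq> E" "\<And>e. e \<in> D \<Longrightarrow> c e \<in> carrier R"
    "\<And>u. scalar_valued u \<Longrightarrow> \<phi> u = (\<Oplus>e\<in>D. c e \<otimes> u e)"
  have "local_functional E' (\<lambda>u. \<Oplus>e\<in>D. c e \<otimes> F u e)"
    using * assms(2) by (intro local_functional_finsum local_functional_smult) auto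
  then show ?thesis
  proof (rule local_functionalE)
    fix D' c' assume **: "finite D'" "D' \<subseteq> E'" "\<And>e. e \<in> D' \<Longrightarrow> c' e \<in> carrier R"
      "\<And>u. scalar_valued u \<Longrightarrow> (\<Oplus>e\<in>D. c e \<otimes> F u e) = (\<Oplus>e\<in>D'. c' e \<otimes> u e)"
    show ?thesis
      using *(4) ** assms(3) by (intro local_functionalI[OF **(1-3)]) auto
  qed
qed

lemma functionals_commute:
  assumes "local_functional E \<phi>" "local_functional E' \<psi>" "scalar_valued w"
  shows "\<phi> (\<lambda>x. \<psi> (\<lambda>y. w (x, y))) = \<psi> (\<lambda>y. \<phi> (\<lambda>x. w (x, y)))"
proof (rule local_functionalE[OF assms(2)])
  fix D c assume *: "finite D" "D \<subseteq> E'" "\<And>e. e \<in> D \<Longrightarrow> c e \<in> carrier R"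
    "\<And>u. scalar_valued u \<Longrightarrow> \<psi> u = (\<Oplus>e\<in>D. c e \<otimes> u e)"
  have sv: "scalar_valued (\<lambda>y. w (x, y))" "scalar_valued (\<lambda>x. w (x, y))" for x y
    using assms(3) by (auto intro!: scalar_valuedI)
  have "\<phi> (\<lambda>x. \<psi> (\<lambda>y. w (x, y))) = \<phi> (\<lambda>x. \<Oplus>e\<in>D. c e \<otimes> w (x, e))"
    by (simp add: *(4) sv)
  also have "\<dots> = (\<Oplus>e\<in>D. \<phi> (\<lambda>x. c e \<otimes> w (x, e)))"
    using * assms(3) by (intro functional_finsum[OF assms(1)]) (auto intro!: scalar_valuedI)
  also have "\<dots> = (\<Oplus>e\<in>D. c e \<otimes> \<phi> (\<lambda>x. w (x, e)))"
    using * sv functional_closed[OF assms(1)]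
    by (intro add.finprod_cong') (auto simp: functional_smult[OF assms(1)])
  also have "\<dots> = \<psi> (\<lambda>y. \<phi> (\<lambda>x. w (x, y)))"
    using assms(3) by (intro *(4)[symmetric]) (auto intro!: scalar_valuedI functional_closed[OF assms(1)])
  finally show ?thesis .
qed

section \<open>Quotient spaces\<close>

context
  fixes C :: "('i \<Rightarrow> 'a) set" and U :: "('j \<Rightarrow> 'a) set" and f
  assumes C: "function_subspace C" and U: "function_subspace U" and surj: "f ` C = U"
    and f_add: "\<And>x y. x \<in> C \<Longrightarrow> y \<in> C \<Longrightarrow> f (\<lambda>i. x i \<oplus> y i) = (\<lambda>i. f x i \<oplus> f y i)"
    and f_smult: "\<And>c x. c \<in> carrier R \<Longrightarrow> x \<in> C \<Longrightarrow> f (\<lambda>i. c \<otimes> x i) = (\<lambda>i. c \<otimes> f x i)"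
begin

lemma kernel_coset:
  assumes "x \<in> C"
  shows "{x \<in> C. f x = (\<lambda>i. \<zero>)} +>\<^bsub>function_space C\<^esub> x = {y \<in> C. f y = f x}"
proof (intro equalityI subsetI)
  note [simp] = subspace_closed[OF C] subspace_closed[OF U]
  have fU [simp]: "f x i \<in> carrier R" if "x \<in> C" for x i using that surj by auto
  fix y
  { assume "y \<in> {x \<in> C. f x = (\<lambda>i. \<zero>)} +>\<^bsub>function_space C\<^esub> x"
    then obtain n where n: "n \<in> C" "f n = (\<lambda>i. \<zero>)" "y = (\<lambda>i. n i \<oplus> x i)"
      by (auto simp: a_r_coset_def')
    then have "f y = f x" "y \<in> C"
      using assms f_add[of n x] subspace_add[OF C, of n x] by simp_all
    then show "y \<in> {y \<in> C. f y = f x}" by simp }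
  assume "y \<in> {y \<in> C. f y = f x}"
  then have y: "y \<in> C" "f y = f x" by auto
  define n where "n = (\<lambda>i. y i \<oplus> (\<ominus> \<one>) \<otimes> x i)"
  have mx: "(\<lambda>i. (\<ominus> \<one>) \<otimes> x i) \<in> C" using subspace_smult[OF C _ assms, of "\<ominus> \<one>"] by simp
  have n: "n \<in> C" unfolding n_def by (intro subspace_add[OF C] y mx)
  have "f n = (\<lambda>i. f y i \<oplus> (\<ominus> \<one>) \<otimes> f x i)"
    unfolding n_def using f_add[OF y(1) mx] f_smult[OF _ assms, of "\<ominus> \<one>"] by simp
  also have "\<dots> = (\<lambda>i. \<zero>)" using y assms by (simp add: l_minus r_neg)
  finally have "f n = (\<lambda>i. \<zero>)" .
  moreover have "y = (\<lambda>i. n i \<oplus> x i)"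
    using y assms by (auto simp: n_def l_minus a_assoc l_neg)
  ultimately show "y \<in> {x \<in> C. f x = (\<lambda>i. \<zero>)} +>\<^bsub>function_space C\<^esub> x"
    using n by (auto simp: a_r_coset_def')
qed

lemma some_in_fibre:
  assumes "x \<in> C" "X = {y \<in> C. f y = f x}"
  shows "f (SOME y. y \<in> X) = f x"
proof -
  have "(SOME y. y \<in> X) \<in> X" by (rule someI[of _ x]) (simp add: assms)
  moreover have "\<And>y. y \<in> X \<Longrightarrow> f y = f x" by (simp add: assms(2))
  ultimately show ?thesis by blast
qed

text \<open>
  The first isomorphism theorem.  The isomorphism evaluates \<open>f\<close> at an arbitrary representative.
\<close>

lemma quotient_by_kernel:
  assumes N: "N = {x \<in> C. f x = (\<lambda>i. \<zero>)}"
  shows "linear_iso R (quotient_space (function_space C) N) (function_space U) (\<lambda>X. f (SOME x. x \<in> X))"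
    and "x \<in> C \<Longrightarrow> f (SOME y. y \<in> N +>\<^bsub>function_space C\<^esub> x) = f x"
proof -
  define fib where "fib = (\<lambda>x. {y \<in> C. f y = f x})"
  have coset: "N +>\<^bsub>function_space C\<^esub> x = fib x" if "x \<in> C" for x
    using kernel_coset[OF that] by (simp add: N fib_def)
  have val: "f (SOME y. y \<in> fib x) = f x" if "x \<in> C" for x
    using some_in_fibre[OF that] by (simp add: fib_def)
  show "x \<in> C \<Longrightarrow> f (SOME y. y \<in> N +>\<^bsub>function_space C\<^esub> x) = f x"
    using coset val by simp
  let ?Q = "quotient_space (function_space C) N"
  have car: "carrier ?Q = fib ` C"
    using coset by (auto simp: quotient_space_def A_RCOSETS_def')
  have f0: "f (\<lambda>i. \<zero>) = (\<lambda>i. \<zero>)"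
  proof -
    have "f (\<lambda>i. \<zero>) \<in> U" using surj subspace_zero[OF C] by auto
    then show ?thesis
      using f_smult[OF zero_closed subspace_zero[OF C]] subspace_closed[OF U] by simp
  qed
  have zero: "\<zero>\<^bsub>?Q\<^esub> = fib (\<lambda>i. \<zero>)"
    by (simp add: quotient_space_def N fib_def f0)
  have add: "fib x \<oplus>\<^bsub>?Q\<^esub> fib y = fib (\<lambda>i. x i \<oplus> y i)" if "x \<in> C" "y \<in> C" for x y
  proof -
    have "fib x \<oplus>\<^bsub>?Q\<^esub> fib y = (\<Union>h\<in>fib x. \<Union>k\<in>fib y. {\<lambda>i. h i \<oplus> k i})"
      by (simp add: quotient_space_def set_add_def')
    also have "\<dots> = fib (\<lambda>i. x i \<oplus> y i)"
    proof (intro equalityI subsetI)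
      fix z assume "z \<in> (\<Union>h\<in>fib x. \<Union>k\<in>fib y. {\<lambda>i. h i \<oplus> k i})"
      then show "z \<in> fib (\<lambda>i. x i \<oplus> y i)"
        using that by (auto simp: fib_def f_add subspace_add[OF C])
    next
      fix z assume z: "z \<in> fib (\<lambda>i. x i \<oplus> y i)"
      have "z \<in> N +>\<^bsub>function_space C\<^esub> (\<lambda>i. x i \<oplus> y i)"
        using z coset that subspace_add[OF C] by auto
      then obtain n where n: "n \<in> N" "z = (\<lambda>i. n i \<oplus> (x i \<oplus> y i))"
        by (auto simp: a_r_coset_def')
      then have "z = (\<lambda>i. (n i \<oplus> x i) \<oplus> y i)"
        using that by (auto simp: N a_assoc subspace_closed[OF C])
      moreover have "(\<lambda>i. n i \<oplus> x i) \<in> N +>\<^bsub>function_space C\<^esub> x"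
        using n by (auto simp: a_r_coset_def')
      ultimately show "z \<in> (\<Union>h\<in>fib x. \<Union>k\<in>fib y. {\<lambda>i. h i \<oplus> k i})"
        using coset that by (fastforce simp: fib_def)
    qed
    finally show ?thesis .
  qed
  have smult: "c \<odot>\<^bsub>?Q\<^esub> fib x = fib (\<lambda>i. c \<otimes> x i)" if "c \<in> carrier R" "x \<in> C" for c x
  proof -
    have "c \<odot>\<^bsub>?Q\<^esub> fib x = (\<Union>y\<in>fib x. N +>\<^bsub>function_space C\<^esub> (\<lambda>i. c \<otimes> y i))"
      by (simp add: quotient_space_def)
    also have "\<dots> = (\<Union>y\<in>fib x. fib (\<lambda>i. c \<otimes> x i))"
    proof (intro SUP_cong refl)
      fix y assume y: "y \<in> fib x"
      then have "N +>\<^bsub>function_space C\<^esub> (\<lambda>i. c \<otimes> y i) = fib (\<lambda>i. c \<otimes> y i)"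
        using that by (intro coset subspace_smult[OF C]) (auto simp: fib_def)
      also have "\<dots> = fib (\<lambda>i. c \<otimes> x i)" using that y by (auto simp: fib_def f_smult)
      finally show "N +>\<^bsub>function_space C\<^esub> (\<lambda>i. c \<otimes> y i) = fib (\<lambda>i. c \<otimes> x i)" .
    qed
    also have "\<dots> = fib (\<lambda>i. c \<otimes> x i)" using that by (auto simp: fib_def)
    finally show ?thesis .
  qed
  show "linear_iso R ?Q (function_space U) (\<lambda>X. f (SOME x. x \<in> X))"
  proof (rule linear_iso_by_model[OF U])
    show "bij_betw (\<lambda>X. f (SOME x. x \<in> X)) (carrier ?Q) U"
      unfolding bij_betw_def car
    proof
      show "inj_on (\<lambda>X. f (SOME x. x \<in> X)) (fib ` C)"
        by (auto simp: inj_on_def val) (simp_all add: fib_def)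
      show "(\<lambda>X. f (SOME x. x \<in> X)) ` fib ` C = U"
        using surj by (force simp: image_image val)
    qed
    show "\<zero>\<^bsub>?Q\<^esub> \<in> carrier ?Q" using subspace_zero[OF C] by (auto simp: car zero)
    show "f (SOME x. x \<in> \<zero>\<^bsub>?Q\<^esub>) = (\<lambda>i. \<zero>)" by (simp add: zero val subspace_zero[OF C] f0)
  next
    fix X Y assume "X \<in> carrier ?Q" "Y \<in> carrier ?Q"
    then show "X \<oplus>\<^bsub>?Q\<^esub> Y \<in> carrier ?Q \<and>
       f (SOME x. x \<in> X \<oplus>\<^bsub>?Q\<^esub> Y) = (\<lambda>i. f (SOME x. x \<in> X) i \<oplus> f (SOME x. x \<in> Y) i)"
      by (auto simp: car add val subspace_add[OF C] f_add)
  next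
    fix c X assume "c \<in> carrier R" "X \<in> carrier ?Q"
    then show "c \<odot>\<^bsub>?Q\<^esub> X \<in> carrier ?Q \<and>
       f (SOME x. x \<in> c \<odot>\<^bsub>?Q\<^esub> X) = (\<lambda>i. c \<otimes> f (SOME x. x \<in> X) i)"
      by (auto simp: car smult val subspace_smult[OF C] f_smult)
  qed
qed

end

section \<open>Free spaces and spans\<close>

lemma free_space_carrier:
  "f \<in> carrier (free_space R S) \<longleftrightarrow>
     scalar_valued f \<and> (\<forall>i. f i \<noteq> \<zero> \<longrightarrow> i \<in> S) \<and> finite {i. f i \<noteq> \<zero>}"
  by (auto simp: free_space_def scalar_valued_def)

lemma free_space_eq: "free_space R S = function_space (carrier (free_space R S))"
  by (simp add: free_space_def function_space_def)

lemma free_space_subspace: "function_subspace (carrier (free_space R S))"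
proof (rule function_subspaceI)
  fix f g assume "f \<in> carrier (free_space R S)" "g \<in> carrier (free_space R S)"
  then have *: "scalar_valued f" "scalar_valued g" "finite ({i. f i \<noteq> \<zero>} \<union> {i. g i \<noteq> \<zero>})"
    "{i. f i \<noteq> \<zero>} \<union> {i. g i \<noteq> \<zero>} \<subseteq> S"
    by (auto simp: free_space_carrier)
  have sub: "{i. f i \<oplus> g i \<noteq> \<zero>} \<subseteq> {i. f i \<noteq> \<zero>} \<union> {i. g i \<noteq> \<zero>}"
    by auto
  show "(\<lambda>i. f i \<oplus> g i) \<in> carrier (free_space R S)"
    using *(1,2) finite_subset[OF sub *(3)] subset_trans[OF sub *(4)]
    unfolding free_space_carrier by (intro conjI scalar_valuedI) auto
next
  fix c f assume c: "c \<in> carrier R" and "f \<in> carrier (free_space R S)"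
  then have *: "scalar_valued f" "finite {i. f i \<noteq> \<zero>}" "{i. f i \<noteq> \<zero>} \<subseteq> S"
    by (auto simp: free_space_carrier)
  have sub: "{i. c \<otimes> f i \<noteq> \<zero>} \<subseteq> {i. f i \<noteq> \<zero>}" using c by auto
  show "(\<lambda>i. c \<otimes> f i) \<in> carrier (free_space R S)"
    using c *(1) finite_subset[OF sub *(2)] subset_trans[OF sub *(3)]
    unfolding free_space_carrier by (intro conjI scalar_valuedI) auto
qed (auto simp: free_space_carrier scalar_valued_def)

lemma basis_vec_scalar [simp]: "basis_vec R i j \<in> carrier R"
  by (simp add: basis_vec_def)

lemma basis_vec_in: "i \<in> S \<Longrightarrow> basis_vec R i \<in> carrier (free_space R S)"
  by (auto simp: free_space_carrier basis_vec_def intro!: scalar_valuedI)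

lemma free_space_induct [consumes 1, case_names zero step]:
  assumes "f \<in> carrier (free_space R S)" "Q (\<lambda>i. \<zero>)"
    "\<And>f c i. f \<in> carrier (free_space R S) \<Longrightarrow> c \<in> carrier R \<Longrightarrow> i \<in> S \<Longrightarrow> Q f \<Longrightarrow>
       Q (\<lambda>j. f j \<oplus> c \<otimes> basis_vec R i j)"
  shows "Q f"
proof -
  have "Q f" if "finite A" "{i. f i \<noteq> \<zero>} = A" "f \<in> carrier (free_space R S)" for A f
    using that
  proof (induction A arbitrary: f rule: finite_induct)
    case empty
    then have "f = (\<lambda>i. \<zero>)" by auto
    then show ?case using assms(2) by simp
  next
    case (insert a A)
    define g where "g = (\<lambda>i. if i = a then \<zero> else f i)"
    have g: "{i. g i \<noteq> \<zero>} = A" using insert by (auto simp: g_def)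
    have gS: "g \<in> carrier (free_space R S)"
      using insert g by (auto simp: free_space_carrier g_def split: if_splits intro!: scalar_valuedI)
    have "f a \<in> carrier R" "a \<in> S" using insert by (auto simp: free_space_carrier)
    then have "Q (\<lambda>j. g j \<oplus> f a \<otimes> basis_vec R a j)"
      using insert.IH[OF g gS] gS by (intro assms(3))
    moreover have "(\<lambda>j. g j \<oplus> f a \<otimes> basis_vec R a j) = f"
      using insert by (auto simp: g_def basis_vec_def free_space_carrier)
    ultimately show ?case by simp
  qed
  then show ?thesis using assms(1) by (auto simp: free_space_carrier)
qed

text \<open>
  Sums over the supports of two functions can be compared only after enlarging both supports to a
  common finite set.
\<close>

lemma lin_ext_eq:
  assumes "finite A" "\<And>i. f i \<noteq> \<zero> \<Longrightarrow> i \<in> A" "scalar_valued f"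
    "\<And>i. i \<in> A \<Longrightarrow> f i \<noteq> \<zero> \<Longrightarrow> b i j \<in> carrier R"
    "\<And>i. i \<in> A \<Longrightarrow> b i j \<in> carrier R"
  shows "lin_ext R b f j = (\<Oplus>i\<in>A. f i \<otimes> b i j)"
  unfolding lin_ext_def
  using assms by (intro add.finprod_mono_neutral_cong_left) auto

context
  fixes S :: "'i set" and b :: "'i \<Rightarrow> 'j \<Rightarrow> 'a"
  assumes b: "\<And>i. i \<in> S \<Longrightarrow> scalar_valued (b i)"
begin

lemma lin_ext_closed: "f \<in> carrier (free_space R S) \<Longrightarrow> lin_ext R b f j \<in> carrier R"
  unfolding lin_ext_def using b by (auto intro!: finsum_closed simp: free_space_carrier)

lemma lin_ext_zero: "lin_ext R b (\<lambda>i. \<zero>) = (\<lambda>j. \<zero>)"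
  by (simp add: lin_ext_def)

lemma lin_ext_basis: "i \<in> S \<Longrightarrow> lin_ext R b (basis_vec R i) = b i"
  using b by (auto simp: lin_ext_def basis_vec_def)

lemma lin_ext_add:
  assumes "f \<in> carrier (free_space R S)" "g \<in> carrier (free_space R S)"
  shows "lin_ext R b (\<lambda>i. f i \<oplus> g i) = (\<lambda>j. lin_ext R b f j \<oplus> lin_ext R b g j)"
proof
  fix j
  let ?A = "{i. f i \<noteq> \<zero>} \<union> {i. g i \<noteq> \<zero>}"
  have fg: "scalar_valued f" "scalar_valued g" "finite ?A" "?A \<subseteq> S"
    using assms by (auto simp: free_space_carrier)
  then have [simp]: "b i j \<in> carrier R" if "i \<in> ?A" for i using b that by auto
  have "lin_ext R b (\<lambda>i. f i \<oplus> g i) j = (\<Oplus>i\<in>?A. (f i \<oplus> g i) \<otimes> b i j)"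
    using fg by (intro lin_ext_eq) (auto intro!: scalar_valuedI)
  also have "\<dots> = (\<Oplus>i\<in>?A. f i \<otimes> b i j \<oplus> g i \<otimes> b i j)"
    using fg by (intro add.finprod_cong') (auto simp: l_distr)
  also have "\<dots> = (\<Oplus>i\<in>?A. f i \<otimes> b i j) \<oplus> (\<Oplus>i\<in>?A. g i \<otimes> b i j)"
    using fg by (intro finsum_addf) auto
  also have "(\<Oplus>i\<in>?A. f i \<otimes> b i j) = lin_ext R b f j"
    using fg by (intro lin_ext_eq[symmetric]) auto
  also have "(\<Oplus>i\<in>?A. g i \<otimes> b i j) = lin_ext R b g j"
    using fg by (intro lin_ext_eq[symmetric]) auto
  finally show "lin_ext R b (\<lambda>i. f i \<oplus> g i) j = lin_ext R b f j \<oplus> lin_ext R b g j" .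
qed

lemma lin_ext_smult:
  assumes "c \<in> carrier R" "f \<in> carrier (free_space R S)"
  shows "lin_ext R b (\<lambda>i. c \<otimes> f i) = (\<lambda>j. c \<otimes> lin_ext R b f j)"
proof
  fix j
  let ?A = "{i. f i \<noteq> \<zero>}"
  have f: "scalar_valued f" "finite ?A" "?A \<subseteq> S"
    using assms by (auto simp: free_space_carrier)
  then have [simp]: "b i j \<in> carrier R" if "i \<in> ?A" for i using b that by auto
  have "lin_ext R b (\<lambda>i. c \<otimes> f i) j = (\<Oplus>i\<in>?A. (c \<otimes> f i) \<otimes> b i j)"
    using f assms by (intro lin_ext_eq) (auto intro!: scalar_valuedI)
  also have "\<dots> = (\<Oplus>i\<in>?A. c \<otimes> (f i \<otimes> b i j))"
    using f assms by (intro add.finprod_cong') (auto simp: m_assoc)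
  also have "\<dots> = c \<otimes> lin_ext R b f j"
    unfolding lin_ext_def using f assms by (intro finsum_rdistr[symmetric]) auto
  finally show "lin_ext R b (\<lambda>i. c \<otimes> f i) j = c \<otimes> lin_ext R b f j" .
qed

lemma lin_ext_in:
  assumes "f \<in> carrier (free_space R S)" "function_subspace U" "\<And>i. i \<in> S \<Longrightarrow> b i \<in> U"
  shows "lin_ext R b f \<in> U"
  using assms(1)
proof (induction rule: free_space_induct)
  case zero
  then show ?case using subspace_zero[OF assms(2)] by (simp add: lin_ext_zero)
next
  case (step f c i)
  have bv: "(\<lambda>j. c \<otimes> basis_vec R i j) \<in> carrier (free_space R S)"
    using step by (intro subspace_smult[OF free_space_subspace] basis_vec_in)
  have "lin_ext R b (\<lambda>j. f j \<oplus> c \<otimes> basis_vec R i j) = (\<lambda>j. lin_ext R b f j \<oplus> c \<otimes> b i j)"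
    using lin_ext_add[OF step(1) bv] lin_ext_smult[OF step(2) basis_vec_in[OF step(3)]]
      lin_ext_basis[OF step(3)] by simp
  then show ?case using step assms(2,3) by (simp add: subspace_add subspace_smult)
qed

lemma lin_ext_finsum:
  assumes "finite A" "\<And>a. a \<in> A \<Longrightarrow> f a \<in> carrier (free_space R S)"
  shows "lin_ext R b (\<lambda>i. \<Oplus>a\<in>A. f a i) = (\<lambda>j. \<Oplus>a\<in>A. lin_ext R b (f a) j)"
  using assms
proof (induction A rule: finite_induct)
  case empty
  then show ?case by (simp add: lin_ext_zero)
next
  case (insert x F)
  note cl = subspace_closed[OF free_space_subspace[of S]]
  have "(\<lambda>i. \<Oplus>a\<in>insert x F. f a i) = (\<lambda>i. f x i \<oplus> (\<Oplus>a\<in>F. f a i))"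
    using insert by (intro ext finsum_insert) (auto intro!: cl)
  moreover have "lin_ext R b (\<lambda>i. f x i \<oplus> (\<Oplus>a\<in>F. f a i)) =
      (\<lambda>j. lin_ext R b (f x) j \<oplus> lin_ext R b (\<lambda>i. \<Oplus>a\<in>F. f a i) j)"
    using insert by (intro lin_ext_add subspace_finsum[OF free_space_subspace]) auto
  moreover have "(\<lambda>j. \<Oplus>a\<in>insert x F. lin_ext R b (f a) j) =
      (\<lambda>j. lin_ext R b (f x) j \<oplus> (\<Oplus>a\<in>F. lin_ext R b (f a) j))"
    using insert by (intro ext finsum_insert) (auto intro!: lin_ext_closed)
  ultimately show ?case using insert by simp
qed

end

lemma
  assumes "function_subspace C" "B \<subseteq> C"
  shows span_subspace: "function_subspace (module.span R (function_space C) B)"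
    and span_superset: "B \<subseteq> module.span R (function_space C) B"
    and span_least: "\<And>N. function_subspace N \<Longrightarrow> B \<subseteq> N \<Longrightarrow> N \<subseteq> C \<Longrightarrow> module.span R (function_space C) B \<subseteq> N"
proof -
  interpret V: vectorspace R "function_space C" using assms(1) by (rule vectorspace_function_space)
  have B: "B \<subseteq> carrier (function_space C)" using assms by simp
  have in_C: "module.span R (function_space C) B \<subseteq> C" using V.span_is_subset2[OF B] by simp
  show "B \<subseteq> module.span R (function_space C) B" using V.in_own_span[OF B] .
  have sub: "submodule R (module.span R (function_space C) B) (function_space C)"
    by (rule V.span_is_submodule[OF B])
  show "function_subspace (module.span R (function_space C) B)"
    using sub in_C subspace_closed[OF assms(1)]
    by (intro function_subspaceI) (auto simp: submodule_def)
  fix N assume N: "function_subspace N" "B \<subseteq> N" "N \<subseteq> C"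
  have "submodule R N (function_space C)"
    using N V.module_axioms subspace_zero[OF N(1)] subspace_add[OF N(1)] subspace_smult[OF N(1)]
    by (auto simp: submodule_def)
  then show "module.span R (function_space C) B \<subseteq> N"
    using N by (intro V.span_is_subset) auto
qed

lemma function_space_minus:
  assumes "function_subspace C" "f \<in> C" "g \<in> C"
  shows "f \<ominus>\<^bsub>function_space C\<^esub> g = (\<lambda>i. f i \<ominus> g i)"
proof -
  interpret V: vectorspace R "function_space C" using assms(1) by (rule vectorspace_function_space)
  have "\<ominus>\<^bsub>function_space C\<^esub> g = (\<lambda>i. \<ominus> g i)"
    using assms subspace_uminus[OF assms(1,3)] subspace_closed[OF assms(1)]
    by (intro V.minus_equality) (auto simp: l_neg)
  then show ?thesis by (simp add: a_minus_def)
qed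

lemma span_basis_vecs:
  assumes "T \<subseteq> S"
  shows "module.span R (free_space R S) (basis_vec R ` T) = carrier (free_space R T)"
proof -
  let ?C = "carrier (free_space R S)"
  have B: "basis_vec R ` T \<subseteq> ?C" using assms by (auto intro: basis_vec_in)
  note sp = span_subspace[OF free_space_subspace B, folded free_space_eq]
  note sup = span_superset[OF free_space_subspace B, folded free_space_eq]
  show ?thesis
  proof
    show "module.span R (free_space R S) (basis_vec R ` T) \<subseteq> carrier (free_space R T)"
    proof (rule span_least[OF free_space_subspace B, folded free_space_eq])
      show "carrier (free_space R T) \<subseteq> ?C"
        using assms unfolding subset_iff free_space_carrier by blast
    qed (auto intro: basis_vec_in free_space_subspace)
    show "carrier (free_space R T) \<subseteq> module.span R (free_space R S) (basis_vec R ` T)"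
    proof
      fix f assume "f \<in> carrier (free_space R T)"
      then show "f \<in> module.span R (free_space R S) (basis_vec R ` T)"
      proof (induction rule: free_space_induct)
        case zero
        then show ?case by (rule subspace_zero[OF sp])
      next
        case (step f c i)
        then show ?case using sup by (intro subspace_add[OF sp] subspace_smult[OF sp]) auto
      qed
    qed
  qed
qed

end

section \<open>Tensor products as spaces of matrices\<close>

definition matrices :: "('i \<Rightarrow> 'k) set \<Rightarrow> ('j \<Rightarrow> 'k) set \<Rightarrow> ('i \<times> 'j \<Rightarrow> 'k) set" where
  "matrices U V = {w. (\<forall>y. (\<lambda>x. w (x, y)) \<in> U) \<and> (\<forall>x. (\<lambda>y. w (x, y)) \<in> V)}"

lemma (in field) matrices_subspace:
  assumes "function_subspace U" "function_subspace V"
  shows "function_subspace (matrices U V)"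
  using assms
  by (intro function_subspaceI) (auto simp: matrices_def subspace_zero subspace_add subspace_smult
      dest: subspace_closed)

text \<open>
  The factors are identified with function spaces by \<open>\<alpha>\<close> and \<open>\<beta>\<close> instead of being such spaces, because
  the factors will also be homology spaces, whose elements are cosets.
\<close>

locale matrix_tensor = field R for R (structure) +
  fixes M :: "('a, 'c) module" and N :: "('a, 'd) module"
    and \<alpha> :: "'c \<Rightarrow> 'i \<Rightarrow> 'a" and \<beta> :: "'d \<Rightarrow> 'j \<Rightarrow> 'a" and U V D b
  assumes U: "function_subspace U" and V: "function_subspace V"
    and \<alpha>: "linear_iso R M (function_space U) \<alpha>" and \<beta>: "linear_iso R N (function_space V) \<beta>"
    and b: "echelon_basis U D b"
begin

definition free_pairs :: "('c \<times> 'd \<Rightarrow> 'a) set" where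
  "free_pairs = carrier (tensor_free R M N)"

abbreviation "e m n \<equiv> basis_vec R (m, n)"

definition rank_one :: "'c \<Rightarrow> 'd \<Rightarrow> 'i \<times> 'j \<Rightarrow> 'a" where
  "rank_one m n = (\<lambda>(x, y). \<alpha> m x \<otimes> \<beta> n y)"

text \<open>
  The matrix of a formal combination of pairs.  This is a map on representatives of tensors;
  \<open>null_eq_kernel\<close> says that two of them represent the same tensor iff they have the same matrix.
\<close>

definition evaluate :: "('c \<times> 'd \<Rightarrow> 'a) \<Rightarrow> 'i \<times> 'j \<Rightarrow> 'a" where
  "evaluate = lin_ext R (\<lambda>(m, n). rank_one m n)"

sublocale M: vectorspace R M using \<alpha> by (auto simp: linear_iso_def dest: linear_map_vs1)
sublocale N: vectorspace R N using \<beta> by (auto simp: linear_iso_def dest: linear_map_vs1)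

lemma
  shows \<alpha>_in: "m \<in> carrier M \<Longrightarrow> \<alpha> m \<in> U"
    and \<beta>_in: "n \<in> carrier N \<Longrightarrow> \<beta> n \<in> V"
    and \<alpha>_add: "m \<in> carrier M \<Longrightarrow> m' \<in> carrier M \<Longrightarrow> \<alpha> (m \<oplus>\<^bsub>M\<^esub> m') = (\<lambda>i. \<alpha> m i \<oplus> \<alpha> m' i)"
    and \<beta>_add: "n \<in> carrier N \<Longrightarrow> n' \<in> carrier N \<Longrightarrow> \<beta> (n \<oplus>\<^bsub>N\<^esub> n') = (\<lambda>i. \<beta> n i \<oplus> \<beta> n' i)"
    and \<alpha>_smult: "c \<in> carrier R \<Longrightarrow> m \<in> carrier M \<Longrightarrow> \<alpha> (c \<odot>\<^bsub>M\<^esub> m) = (\<lambda>i. c \<otimes> \<alpha> m i)"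
    and \<beta>_smult: "c \<in> carrier R \<Longrightarrow> n \<in> carrier N \<Longrightarrow> \<beta> (c \<odot>\<^bsub>N\<^esub> n) = (\<lambda>i. c \<otimes> \<beta> n i)"
    and \<alpha>_inj: "m \<in> carrier M \<Longrightarrow> m' \<in> carrier M \<Longrightarrow> \<alpha> m = \<alpha> m' \<Longrightarrow> m = m'"
    and \<beta>_inj: "n \<in> carrier N \<Longrightarrow> n' \<in> carrier N \<Longrightarrow> \<beta> n = \<beta> n' \<Longrightarrow> n = n'"
    and \<alpha>_surj: "u \<in> U \<Longrightarrow> \<exists>m\<in>carrier M. \<alpha> m = u"
    and \<beta>_surj: "v \<in> V \<Longrightarrow> \<exists>n\<in>carrier N. \<beta> n = v"
    and \<alpha>_zero: "\<alpha> \<zero>\<^bsub>M\<^esub> = (\<lambda>i. \<zero>)"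
    and \<beta>_zero: "\<beta> \<zero>\<^bsub>N\<^esub> = (\<lambda>i. \<zero>)"
proof -
  have a: "linear_map R M (function_space U) \<alpha>" "bij_betw \<alpha> (carrier M) U"
    and b: "linear_map R N (function_space V) \<beta>" "bij_betw \<beta> (carrier N) V"
    using \<alpha> \<beta> by (auto simp: linear_iso_def)
  note f = linear_map_closed[OF a(1)] linear_map_closed[OF b(1)] linear_map_add[OF a(1)]
    linear_map_add[OF b(1)] linear_map_smult[OF a(1)] linear_map_smult[OF b(1)]
    linear_map_zero[OF a(1)] linear_map_zero[OF b(1)]
  note g = f[simplified]
  show "m \<in> carrier M \<Longrightarrow> \<alpha> m \<in> U" "n \<in> carrier N \<Longrightarrow> \<beta> n \<in> V"
    "m \<in> carrier M \<Longrightarrow> m' \<in> carrier M \<Longrightarrow> \<alpha> (m \<oplus>\<^bsub>M\<^esub> m') = (\<lambda>i. \<alpha> m i \<oplus> \<alpha> m' i)"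
    "n \<in> carrier N \<Longrightarrow> n' \<in> carrier N \<Longrightarrow> \<beta> (n \<oplus>\<^bsub>N\<^esub> n') = (\<lambda>i. \<beta> n i \<oplus> \<beta> n' i)"
    "c \<in> carrier R \<Longrightarrow> m \<in> carrier M \<Longrightarrow> \<alpha> (c \<odot>\<^bsub>M\<^esub> m) = (\<lambda>i. c \<otimes> \<alpha> m i)"
    "c \<in> carrier R \<Longrightarrow> n \<in> carrier N \<Longrightarrow> \<beta> (c \<odot>\<^bsub>N\<^esub> n) = (\<lambda>i. c \<otimes> \<beta> n i)"
    "\<alpha> \<zero>\<^bsub>M\<^esub> = (\<lambda>i. \<zero>)" "\<beta> \<zero>\<^bsub>N\<^esub> = (\<lambda>i. \<zero>)"
    by (fact g)+
  show "m \<in> carrier M \<Longrightarrow> m' \<in> carrier M \<Longrightarrow> \<alpha> m = \<alpha> m' \<Longrightarrow> m = m'"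
    "u \<in> U \<Longrightarrow> \<exists>m\<in>carrier M. \<alpha> m = u"
    using inj_onD[OF bij_betw_imp_inj_on[OF a(2)]] bij_betw_imp_surj_on[OF a(2)] by blast+
  show "n \<in> carrier N \<Longrightarrow> n' \<in> carrier N \<Longrightarrow> \<beta> n = \<beta> n' \<Longrightarrow> n = n'"
    "v \<in> V \<Longrightarrow> \<exists>n\<in>carrier N. \<beta> n = v"
    using inj_onD[OF bij_betw_imp_inj_on[OF b(2)]] bij_betw_imp_surj_on[OF b(2)] by blast+
qed

lemma \<alpha>_closed [simp]: "m \<in> carrier M \<Longrightarrow> \<alpha> m i \<in> carrier R"
  using \<alpha>_in subspace_closed[OF U] by blast

lemma \<beta>_closed [simp]: "n \<in> carrier N \<Longrightarrow> \<beta> n i \<in> carrier R"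
  using \<beta>_in subspace_closed[OF V] by blast

lemma rank_one_in: "m \<in> carrier M \<Longrightarrow> n \<in> carrier N \<Longrightarrow> rank_one m n \<in> matrices U V"
proof -
  assume m: "m \<in> carrier M" and n: "n \<in> carrier N"
  have "(\<lambda>x. \<alpha> m x \<otimes> \<beta> n y) \<in> U" for y
    using subspace_smult[OF U \<beta>_closed[OF n] \<alpha>_in[OF m], of y] m n by (simp add: m_comm)
  moreover have "(\<lambda>y. \<alpha> m x \<otimes> \<beta> n y) \<in> V" for x
    using subspace_smult[OF V \<alpha>_closed[OF m] \<beta>_in[OF n], of x] .
  ultimately show ?thesis by (simp add: matrices_def rank_one_def)
qed

lemma rank_one_scalar: "i \<in> carrier M \<times> carrier N \<Longrightarrow> scalar_valued ((\<lambda>(m, n). rank_one m n) i)"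
  by (auto simp: rank_one_def intro!: scalar_valuedI)

lemma free_pairs_eq: "free_pairs = carrier (free_space R (carrier M \<times> carrier N))"
  by (simp add: free_pairs_def tensor_free_def)

lemma tensor_free_eq: "tensor_free R M N = function_space free_pairs"
  unfolding tensor_free_def free_pairs_def by (rule free_space_eq)

lemma free_pairs_subspace: "function_subspace free_pairs"
  unfolding free_pairs_eq by (rule free_space_subspace)

lemma e_in: "m \<in> carrier M \<Longrightarrow> n \<in> carrier N \<Longrightarrow> e m n \<in> free_pairs"
  unfolding free_pairs_eq by (intro basis_vec_in) auto

lemma evaluate_add:
  "s \<in> free_pairs \<Longrightarrow> t \<in> free_pairs \<Longrightarrow> evaluate (\<lambda>i. s i \<oplus> t i) = (\<lambda>i. evaluate s i \<oplus> evaluate t i)"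
  unfolding evaluate_def free_pairs_eq
  by (rule lin_ext_add[where S = "carrier M \<times> carrier N", OF rank_one_scalar])

lemma evaluate_smult:
  "c \<in> carrier R \<Longrightarrow> t \<in> free_pairs \<Longrightarrow> evaluate (\<lambda>i. c \<otimes> t i) = (\<lambda>i. c \<otimes> evaluate t i)"
  unfolding evaluate_def free_pairs_eq
  by (rule lin_ext_smult[where S = "carrier M \<times> carrier N", OF rank_one_scalar])

lemma evaluate_closed: "t \<in> free_pairs \<Longrightarrow> evaluate t i \<in> carrier R"
  unfolding evaluate_def free_pairs_eq
  by (rule lin_ext_closed[where S = "carrier M \<times> carrier N", OF rank_one_scalar])

lemma evaluate_finsum:
  "finite A \<Longrightarrow> (\<And>a. a \<in> A \<Longrightarrow> f a \<in> free_pairs) \<Longrightarrow>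
    evaluate (\<lambda>i. \<Oplus>a\<in>A. f a i) = (\<lambda>i. \<Oplus>a\<in>A. evaluate (f a) i)"
  unfolding evaluate_def free_pairs_eq
  by (rule lin_ext_finsum[where S = "carrier M \<times> carrier N", OF rank_one_scalar])

lemma evaluate_zero: "evaluate (\<lambda>i. \<zero>) = (\<lambda>i. \<zero>)"
  unfolding evaluate_def by (simp add: lin_ext_def)

lemma evaluate_e: "m \<in> carrier M \<Longrightarrow> n \<in> carrier N \<Longrightarrow> evaluate (e m n) = rank_one m n"
  using lin_ext_basis[where S = "carrier M \<times> carrier N" and b = "\<lambda>(m, n). rank_one m n"
      and i = "(m, n)", OF rank_one_scalar] by (simp add: evaluate_def)

lemma evaluate_in: "t \<in> free_pairs \<Longrightarrow> evaluate t \<in> matrices U V"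
  unfolding evaluate_def free_pairs_eq
  by (rule lin_ext_in[where S = "carrier M \<times> carrier N", OF rank_one_scalar _ matrices_subspace[OF U V]]) (auto intro: rank_one_in)

lemma evaluate_minus:
  assumes "s \<in> free_pairs" "t \<in> free_pairs"
  shows "evaluate (\<lambda>i. s i \<ominus> t i) = (\<lambda>i. evaluate s i \<ominus> evaluate t i)"
proof -
  note cl [simp] = subspace_closed[OF free_pairs_subspace]
  have "(\<lambda>i. s i \<ominus> t i) = (\<lambda>i. s i \<oplus> (\<ominus> \<one>) \<otimes> t i)"
    using assms by (auto simp: a_minus_def l_minus)
  then have "evaluate (\<lambda>i. s i \<ominus> t i) = (\<lambda>i. evaluate s i \<oplus> evaluate (\<lambda>i. (\<ominus> \<one>) \<otimes> t i) i)"
    using evaluate_add[OF assms(1) subspace_smult[OF free_pairs_subspace _ assms(2)], of "\<ominus> \<one>"] by simp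
  also have "evaluate (\<lambda>i. (\<ominus> \<one>) \<otimes> t i) = (\<lambda>i. (\<ominus> \<one>) \<otimes> evaluate t i)"
    using assms by (intro evaluate_smult) auto
  finally show ?thesis
    using evaluate_closed[OF assms(2)] by (simp add: l_minus a_minus_def)
qed

abbreviation "null \<equiv> tensor_null R M N"

lemma tensor_relations_eq:
  "tensor_relations R M N =
     {\<lambda>i. e (m \<oplus>\<^bsub>M\<^esub> m') n i \<ominus> (e m n i \<oplus> e m' n i) | m m' n.
        m \<in> carrier M \<and> m' \<in> carrier M \<and> n \<in> carrier N} \<union>
     {\<lambda>i. e m (n \<oplus>\<^bsub>N\<^esub> n') i \<ominus> (e m n i \<oplus> e m n' i) | m n n'.
        m \<in> carrier M \<and> n \<in> carrier N \<and> n' \<in> carrier N} \<union>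
     {\<lambda>i. e (c \<odot>\<^bsub>M\<^esub> m) n i \<ominus> (c \<otimes> e m n i) | c m n.
        c \<in> carrier R \<and> m \<in> carrier M \<and> n \<in> carrier N} \<union>
     {\<lambda>i. e m (c \<odot>\<^bsub>N\<^esub> n) i \<ominus> (c \<otimes> e m n i) | c m n.
        c \<in> carrier R \<and> m \<in> carrier M \<and> n \<in> carrier N}"
proof -
  note mi = function_space_minus[OF free_pairs_subspace]
  note cl = e_in subspace_add[OF free_pairs_subspace] subspace_smult[OF free_pairs_subspace]
  show ?thesis
    unfolding tensor_relations_def Let_def tensor_free_eq function_space_simps
    apply (intro arg_cong2[where f = "(\<union>)"] Collect_cong)
    subgoal by (intro ex_cong1) (auto simp: mi cl cong: conj_cong)
    subgoal by (intro ex_cong1) (auto simp: mi cl cong: conj_cong)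
    subgoal by (intro ex_cong1) (auto simp: mi cl cong: conj_cong)
    subgoal by (intro ex_cong1) (auto simp: mi cl cong: conj_cong)
    done
qed

lemma relations_in: "tensor_relations R M N \<subseteq> free_pairs"
  unfolding tensor_relations_eq
  by (auto intro!: subspace_minus[OF free_pairs_subspace] subspace_add[OF free_pairs_subspace]
      subspace_smult[OF free_pairs_subspace] e_in)

lemma null_eq: "null = module.span R (function_space free_pairs) (tensor_relations R M N)"
  by (simp add: tensor_null_def flip: tensor_free_eq)

lemmas null_subspace = span_subspace[OF free_pairs_subspace relations_in, folded null_eq]
lemmas relations_null = span_superset[OF free_pairs_subspace relations_in, folded null_eq]

lemma null_le_kernel: "null \<subseteq> {t \<in> free_pairs. evaluate t = (\<lambda>i. \<zero>)}"
  unfolding null_eq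
proof (rule span_least[OF free_pairs_subspace relations_in])
  note cl = e_in subspace_add[OF free_pairs_subspace] subspace_smult[OF free_pairs_subspace]
  show "function_subspace {t \<in> free_pairs. evaluate t = (\<lambda>i. \<zero>)}"
    using subspace_zero[OF free_pairs_subspace] cl
    by (intro function_subspaceI)
      (auto simp: evaluate_zero evaluate_add evaluate_smult dest: subspace_closed[OF free_pairs_subspace])
  have z: "a \<ominus> a = \<zero>" if "a \<in> carrier R" for a using that by (simp add: a_minus_def r_neg)
  have "evaluate t = (\<lambda>i. \<zero>)" if "t \<in> tensor_relations R M N" for t
    using that unfolding tensor_relations_eq
    by (elim UnE CollectE exE conjE; hypsubst)
      (simp_all add: evaluate_minus cl evaluate_add evaluate_smult evaluate_e,
       simp_all add: rank_one_def \<alpha>_add \<beta>_add \<alpha>_smult \<beta>_smult l_distr r_distr m_assoc m_lcomm z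
          split_beta)
  then show "tensor_relations R M N \<subseteq> {t \<in> free_pairs. evaluate t = (\<lambda>i. \<zero>)}"
    using relations_in by auto
qed auto

definition congruent_mod_null (infix "\<approx>" 50) where
  "s \<approx> t \<longleftrightarrow> s \<in> free_pairs \<and> t \<in> free_pairs \<and> (\<lambda>i. s i \<ominus> t i) \<in> null"

lemma cong_by_relation:
  assumes "s \<in> free_pairs" "t \<in> free_pairs" "(\<lambda>i. s i \<ominus> t i) \<in> tensor_relations R M N"
  shows "s \<approx> t"
  using assms relations_null by (auto simp: congruent_mod_null_def)

lemma cong_refl: "t \<in> free_pairs \<Longrightarrow> t \<approx> t"
  using subspace_zero[OF null_subspace] subspace_closed[OF free_pairs_subspace]
  by (simp add: congruent_mod_null_def a_minus_def r_neg)

lemma cong_sym: "s \<approx> t \<Longrightarrow> t \<approx> s"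
proof -
  assume *: "s \<approx> t"
  have "(\<lambda>i. \<ominus> (s i \<ominus> t i)) \<in> null"
    using * by (intro subspace_uminus[OF null_subspace]) (auto simp: congruent_mod_null_def)
  moreover have "(\<lambda>i. \<ominus> (s i \<ominus> t i)) = (\<lambda>i. t i \<ominus> s i)"
    using * subspace_closed[OF free_pairs_subspace]
    by (auto simp: congruent_mod_null_def a_minus_def minus_add a_comm)
  ultimately show ?thesis using * by (auto simp: congruent_mod_null_def)
qed

lemma cong_add: "s \<approx> t \<Longrightarrow> s' \<approx> t' \<Longrightarrow> (\<lambda>i. s i \<oplus> s' i) \<approx> (\<lambda>i. t i \<oplus> t' i)"
proof -
  assume *: "s \<approx> t" "s' \<approx> t'"
  have "(\<lambda>i. (s i \<ominus> t i) \<oplus> (s' i \<ominus> t' i)) \<in> null"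
    using * by (intro subspace_add[OF null_subspace]) (auto simp: congruent_mod_null_def)
  moreover have "(\<lambda>i. (s i \<ominus> t i) \<oplus> (s' i \<ominus> t' i)) = (\<lambda>i. (s i \<oplus> s' i) \<ominus> (t i \<oplus> t' i))"
    using * subspace_closed[OF free_pairs_subspace]
    by (auto simp: congruent_mod_null_def a_minus_def minus_add a_ac)
  ultimately show ?thesis using * subspace_add[OF free_pairs_subspace]
    by (auto simp: congruent_mod_null_def)
qed

lemma cong_smult: "c \<in> carrier R \<Longrightarrow> s \<approx> t \<Longrightarrow> (\<lambda>i. c \<otimes> s i) \<approx> (\<lambda>i. c \<otimes> t i)"
proof -
  assume *: "c \<in> carrier R" "s \<approx> t"
  have "(\<lambda>i. c \<otimes> (s i \<ominus> t i)) \<in> null"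
    using * by (intro subspace_smult[OF null_subspace]) (auto simp: congruent_mod_null_def)
  moreover have "(\<lambda>i. c \<otimes> (s i \<ominus> t i)) = (\<lambda>i. c \<otimes> s i \<ominus> c \<otimes> t i)"
    using * subspace_closed[OF free_pairs_subspace]
    by (auto simp: congruent_mod_null_def a_minus_def r_distr r_minus)
  ultimately show ?thesis using * subspace_smult[OF free_pairs_subspace]
    by (auto simp: congruent_mod_null_def)
qed

lemma cong_trans [trans]: "r \<approx> s \<Longrightarrow> s \<approx> t \<Longrightarrow> r \<approx> t"
proof -
  assume *: "r \<approx> s" "s \<approx> t"
  have "(\<lambda>i. (r i \<ominus> s i) \<oplus> (s i \<ominus> t i)) \<in> null"
    using * by (intro subspace_add[OF null_subspace]) (auto simp: congruent_mod_null_def)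
  moreover have "(\<lambda>i. (r i \<ominus> s i) \<oplus> (s i \<ominus> t i)) = (\<lambda>i. r i \<ominus> t i)"
  proof
    fix i
    have "r i \<in> carrier R" "s i \<in> carrier R" "t i \<in> carrier R"
      using * subspace_closed[OF free_pairs_subspace] by (auto simp: congruent_mod_null_def)
    then show "(r i \<ominus> s i) \<oplus> (s i \<ominus> t i) = r i \<ominus> t i"
      by (simp add: a_minus_def a_assoc r_neg1)
  qed
  ultimately show ?thesis using * by (auto simp: congruent_mod_null_def)
qed

lemma cong_finsum:
  assumes "finite A" "\<And>a. a \<in> A \<Longrightarrow> f a \<approx> g a"
  shows "(\<lambda>i. \<Oplus>a\<in>A. f a i) \<approx> (\<lambda>i. \<Oplus>a\<in>A. g a i)"
  using assms
proof (induction A rule: finite_induct)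
  case empty
  then show ?case by (simp add: cong_refl subspace_zero[OF free_pairs_subspace])
next
  case (insert x F)
  have cl: "f a i \<in> carrier R" "g a i \<in> carrier R" if "a \<in> insert x F" for a i
    using insert.prems[OF that] subspace_closed[OF free_pairs_subspace]
    by (auto simp: congruent_mod_null_def)
  have "(\<lambda>i. \<Oplus>a\<in>insert x F. f a i) = (\<lambda>i. f x i \<oplus> (\<Oplus>a\<in>F. f a i))"
    "(\<lambda>i. \<Oplus>a\<in>insert x F. g a i) = (\<lambda>i. g x i \<oplus> (\<Oplus>a\<in>F. g a i))"
    using insert.hyps cl by (auto intro!: finsum_insert)
  then show ?case using insert by (auto intro: cong_add)
qed

lemma e_add1:
  assumes "m \<in> carrier M" "m' \<in> carrier M" "n \<in> carrier N"
  shows "e (m \<oplus>\<^bsub>M\<^esub> m') n \<approx> (\<lambda>i. e m n i \<oplus> e m' n i)"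
proof (rule cong_by_relation)
  show "e (m \<oplus>\<^bsub>M\<^esub> m') n \<in> free_pairs" using assms by (intro e_in) auto
  show "(\<lambda>i. e m n i \<oplus> e m' n i) \<in> free_pairs" using assms by (intro subspace_add[OF free_pairs_subspace] e_in)
  show "(\<lambda>i. e (m \<oplus>\<^bsub>M\<^esub> m') n i \<ominus> (e m n i \<oplus> e m' n i)) \<in> tensor_relations R M N"
    unfolding tensor_relations_eq
    by (rule UnI1, rule UnI1, rule UnI1, rule CollectI, intro exI conjI, rule refl) (rule assms)+
qed

lemma e_add2:
  assumes "m \<in> carrier M" "n \<in> carrier N" "n' \<in> carrier N"
  shows "e m (n \<oplus>\<^bsub>N\<^esub> n') \<approx> (\<lambda>i. e m n i \<oplus> e m n' i)"
proof (rule cong_by_relation)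
  show "e m (n \<oplus>\<^bsub>N\<^esub> n') \<in> free_pairs" using assms by (intro e_in) auto
  show "(\<lambda>i. e m n i \<oplus> e m n' i) \<in> free_pairs" using assms by (intro subspace_add[OF free_pairs_subspace] e_in)
  show "(\<lambda>i. e m (n \<oplus>\<^bsub>N\<^esub> n') i \<ominus> (e m n i \<oplus> e m n' i)) \<in> tensor_relations R M N"
    unfolding tensor_relations_eq
    by (rule UnI1, rule UnI1, rule UnI2, rule CollectI, intro exI conjI, rule refl) (rule assms)+
qed

lemma e_smult1:
  assumes "c \<in> carrier R" "m \<in> carrier M" "n \<in> carrier N"
  shows "e (c \<odot>\<^bsub>M\<^esub> m) n \<approx> (\<lambda>i. c \<otimes> e m n i)"
proof (rule cong_by_relation)
  show "e (c \<odot>\<^bsub>M\<^esub> m) n \<in> free_pairs" using assms by (intro e_in) auto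
  show "(\<lambda>i. c \<otimes> e m n i) \<in> free_pairs" using assms by (intro subspace_smult[OF free_pairs_subspace] e_in)
  show "(\<lambda>i. e (c \<odot>\<^bsub>M\<^esub> m) n i \<ominus> (c \<otimes> e m n i)) \<in> tensor_relations R M N"
    unfolding tensor_relations_eq
    by (rule UnI1, rule UnI2, rule CollectI, intro exI conjI, rule refl) (rule assms)+
qed

lemma e_smult2:
  assumes "c \<in> carrier R" "m \<in> carrier M" "n \<in> carrier N"
  shows "e m (c \<odot>\<^bsub>N\<^esub> n) \<approx> (\<lambda>i. c \<otimes> e m n i)"
proof (rule cong_by_relation)
  show "e m (c \<odot>\<^bsub>N\<^esub> n) \<in> free_pairs" using assms by (intro e_in) auto
  show "(\<lambda>i. c \<otimes> e m n i) \<in> free_pairs" using assms by (intro subspace_smult[OF free_pairs_subspace] e_in)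
  show "(\<lambda>i. e m (c \<odot>\<^bsub>N\<^esub> n) i \<ominus> (c \<otimes> e m n i)) \<in> tensor_relations R M N"
    unfolding tensor_relations_eq
    by (rule UnI2, rule CollectI, intro exI conjI, rule refl) (rule assms)+
qed

lemma e_zero1:
  assumes "n \<in> carrier N" shows "e \<zero>\<^bsub>M\<^esub> n \<approx> (\<lambda>i. \<zero>)"
  using e_smult1[of \<zero> "\<zero>\<^bsub>M\<^esub>" n] assms by simp

lemma e_zero2:
  assumes "m \<in> carrier M" shows "e m \<zero>\<^bsub>N\<^esub> \<approx> (\<lambda>i. \<zero>)"
  using e_smult2[of \<zero> m "\<zero>\<^bsub>N\<^esub>"] assms by simp

lemma finD: "finite D" and b_in: "d \<in> D \<Longrightarrow> b d \<in> U"
  and b_delta: "d \<in> D \<Longrightarrow> d' \<in> D \<Longrightarrow> b d d' = (if d' = d then \<one> else \<zero>)"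
  and expand: "u \<in> U \<Longrightarrow> u i = (\<Oplus>d\<in>D. u d \<otimes> b d i)"
  using b by (auto simp: echelon_basis_def)

definition basis_elt :: "'i \<Rightarrow> 'c" where
  "basis_elt d = (SOME m. m \<in> carrier M \<and> \<alpha> m = b d)"

lemma basis_elt: "d \<in> D \<Longrightarrow> basis_elt d \<in> carrier M" "d \<in> D \<Longrightarrow> \<alpha> (basis_elt d) = b d"
proof -
  have "basis_elt d \<in> carrier M \<and> \<alpha> (basis_elt d) = b d" if "d \<in> D"
    unfolding basis_elt_def using \<alpha>_surj[OF b_in[OF that]]
    by (intro someI_ex[of "\<lambda>m. m \<in> carrier M \<and> \<alpha> m = b d"]) blast
  then show "d \<in> D \<Longrightarrow> basis_elt d \<in> carrier M" "d \<in> D \<Longrightarrow> \<alpha> (basis_elt d) = b d" by blast+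
qed

text \<open>
  The class of \<open>(m, n)\<close> is additive in \<open>m\<close>, so the expansion of \<open>m\<close> in the basis carries over to pairs.
  The induction over subsets of \<open>D\<close> builds the partial sums of the expansion as elements of \<open>M\<close>.
\<close>

lemma expand_pair:
  assumes m: "m \<in> carrier M" and n: "n \<in> carrier N"
  shows "e m n \<approx> (\<lambda>i. \<Oplus>d\<in>D. \<alpha> m d \<otimes> e (basis_elt d) n i)"
proof -
  have "\<exists>m'\<in>carrier M. \<alpha> m' = (\<lambda>i. \<Oplus>d\<in>A. \<alpha> m d \<otimes> b d i) \<and>
      e m' n \<approx> (\<lambda>i. \<Oplus>d\<in>A. \<alpha> m d \<otimes> e (basis_elt d) n i)" if "finite A" "A \<subseteq> D" for A
    using that
  proof (induction A rule: finite_induct)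
    case empty
    show ?case using n by (intro bexI[of _ "\<zero>\<^bsub>M\<^esub>"]) (auto simp: \<alpha>_zero e_zero1)
  next
    case (insert x F)
    then obtain m' where m': "m' \<in> carrier M" "\<alpha> m' = (\<lambda>i. \<Oplus>d\<in>F. \<alpha> m d \<otimes> b d i)"
      "e m' n \<approx> (\<lambda>i. \<Oplus>d\<in>F. \<alpha> m d \<otimes> e (basis_elt d) n i)" by auto
    have x: "basis_elt x \<in> carrier M" "\<alpha> (basis_elt x) = b x" "x \<in> D" using insert basis_elt by auto
    let ?m = "\<alpha> m x \<odot>\<^bsub>M\<^esub> basis_elt x \<oplus>\<^bsub>M\<^esub> m'"
    have 1: "\<alpha> ?m = (\<lambda>i. \<Oplus>d\<in>insert x F. \<alpha> m d \<otimes> b d i)"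
    proof
      fix i
      have "(\<Oplus>d\<in>insert x F. \<alpha> m d \<otimes> b d i) = \<alpha> m x \<otimes> b x i \<oplus> (\<Oplus>d\<in>F. \<alpha> m d \<otimes> b d i)"
        using insert m b_in subspace_closed[OF U] by (intro finsum_insert) auto
      then show "\<alpha> ?m i = (\<Oplus>d\<in>insert x F. \<alpha> m d \<otimes> b d i)"
        using m m' x by (simp add: \<alpha>_add \<alpha>_smult)
    qed
    have "e ?m n \<approx> (\<lambda>i. e (\<alpha> m x \<odot>\<^bsub>M\<^esub> basis_elt x) n i \<oplus> e m' n i)"
      using m m' x n by (intro e_add1) auto
    also have "\<dots> \<approx> (\<lambda>i. \<alpha> m x \<otimes> e (basis_elt x) n i \<oplus> (\<Oplus>d\<in>F. \<alpha> m d \<otimes> e (basis_elt d) n i))"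
      using m m' x n by (intro cong_add e_smult1) auto
    also have "\<dots> = (\<lambda>i. \<Oplus>d\<in>insert x F. \<alpha> m d \<otimes> e (basis_elt d) n i)"
      using insert m by (intro ext finsum_insert[symmetric]) auto
    finally have 2: "e ?m n \<approx> (\<lambda>i. \<Oplus>d\<in>insert x F. \<alpha> m d \<otimes> e (basis_elt d) n i)" .
    show ?case using 1 2 m m' x by (intro bexI[of _ ?m]) auto
  qed
  from this[OF finD order_refl] obtain m' where m': "m' \<in> carrier M"
    "\<alpha> m' = (\<lambda>i. \<Oplus>d\<in>D. \<alpha> m d \<otimes> b d i)"
    "e m' n \<approx> (\<lambda>i. \<Oplus>d\<in>D. \<alpha> m d \<otimes> e (basis_elt d) n i)" by blast
  have "\<alpha> m' = \<alpha> m" unfolding m'(2) by (intro ext expand[OF \<alpha>_in[OF m], symmetric])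
  then show ?thesis using m' m \<alpha>_inj by blast
qed

text \<open>
  After expanding the first components in the basis, the second components that occur with the same
  basis element can be collected into one.
\<close>

lemma normal_form:
  assumes "t \<in> free_pairs"
  shows "\<exists>v. (\<forall>d\<in>D. v d \<in> carrier N) \<and> t \<approx> (\<lambda>i. \<Oplus>d\<in>D. e (basis_elt d) (v d) i)"
  using assms unfolding free_pairs_eq
proof (induction rule: free_space_induct)
  case zero
  have "(\<lambda>i. \<Oplus>d\<in>D. e (basis_elt d) \<zero>\<^bsub>N\<^esub> i) \<approx> (\<lambda>i. \<Oplus>d\<in>D. \<zero>)"
    using finD basis_elt by (intro cong_finsum e_zero2)
  then show ?case by (intro exI[of _ "\<lambda>_. \<zero>\<^bsub>N\<^esub>"]) (simp add: cong_sym)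
next
  case (step f c p)
  obtain m n where p: "p = (m, n)" and m: "m \<in> carrier M" and n: "n \<in> carrier N" using step(3) by auto
  obtain v where v: "\<And>d. d \<in> D \<Longrightarrow> v d \<in> carrier N"
    and fv: "f \<approx> (\<lambda>i. \<Oplus>d\<in>D. e (basis_elt d) (v d) i)" using step(4) by auto
  note c = \<open>c \<in> carrier R\<close>
  let ?v = "\<lambda>d. v d \<oplus>\<^bsub>N\<^esub> (c \<otimes> \<alpha> m d) \<odot>\<^bsub>N\<^esub> n"
  have "(\<lambda>j. f j \<oplus> c \<otimes> e m n j) \<approx> (\<lambda>j. (\<Oplus>d\<in>D. e (basis_elt d) (v d) j) \<oplus>
      c \<otimes> (\<Oplus>d\<in>D. \<alpha> m d \<otimes> e (basis_elt d) n j))"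
    by (intro cong_add fv cong_smult c expand_pair m n)
  also have "\<dots> = (\<lambda>j. \<Oplus>d\<in>D. e (basis_elt d) (v d) j \<oplus> (c \<otimes> \<alpha> m d) \<otimes> e (basis_elt d) n j)"
  proof
    fix j
    have "(\<Oplus>d\<in>D. e (basis_elt d) (v d) j \<oplus> (c \<otimes> \<alpha> m d) \<otimes> e (basis_elt d) n j) =
      (\<Oplus>d\<in>D. e (basis_elt d) (v d) j \<oplus> c \<otimes> (\<alpha> m d \<otimes> e (basis_elt d) n j))"
      using m c by (intro add.finprod_cong') (auto simp: m_assoc)
    also have "\<dots> = (\<Oplus>d\<in>D. e (basis_elt d) (v d) j) \<oplus> c \<otimes> (\<Oplus>d\<in>D. \<alpha> m d \<otimes> e (basis_elt d) n j)"
      using m c finD by (simp add: finsum_addf finsum_rdistr)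
    finally show "(\<Oplus>d\<in>D. e (basis_elt d) (v d) j) \<oplus> c \<otimes> (\<Oplus>d\<in>D. \<alpha> m d \<otimes> e (basis_elt d) n j) =
      (\<Oplus>d\<in>D. e (basis_elt d) (v d) j \<oplus> (c \<otimes> \<alpha> m d) \<otimes> e (basis_elt d) n j)" by simp
  qed
  also have "\<dots> \<approx> (\<lambda>j. \<Oplus>d\<in>D. e (basis_elt d) (?v d) j)"
  proof (rule cong_finsum[OF finD])
    fix d assume d: "d \<in> D"
    have "e (basis_elt d) (?v d) \<approx>
        (\<lambda>j. e (basis_elt d) (v d) j \<oplus> e (basis_elt d) ((c \<otimes> \<alpha> m d) \<odot>\<^bsub>N\<^esub> n) j)"
      using d v c m n basis_elt by (intro e_add2) auto
    also have "\<dots> \<approx> (\<lambda>j. e (basis_elt d) (v d) j \<oplus> (c \<otimes> \<alpha> m d) \<otimes> e (basis_elt d) n j)"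
      using d v c m n basis_elt by (intro cong_add cong_refl e_in e_smult2) auto
    finally show "(\<lambda>j. e (basis_elt d) (v d) j \<oplus> (c \<otimes> \<alpha> m d) \<otimes> e (basis_elt d) n j) \<approx>
        e (basis_elt d) (?v d)"
      by (rule cong_sym)
  qed
  finally show ?case unfolding p using v c m n by (intro exI[of _ ?v]) auto
qed

lemma evaluate_normal_form:
  assumes "\<And>d. d \<in> D \<Longrightarrow> v d \<in> carrier N"
  shows "evaluate (\<lambda>i. \<Oplus>d\<in>D. e (basis_elt d) (v d) i) (x, y) = (\<Oplus>d\<in>D. b d x \<otimes> \<beta> (v d) y)"
proof -
  have "evaluate (\<lambda>i. \<Oplus>d\<in>D. e (basis_elt d) (v d) i) (x, y) =
      (\<Oplus>d\<in>D. evaluate (e (basis_elt d) (v d)) (x, y))"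
    using assms basis_elt by (subst evaluate_finsum[OF finD]) (auto intro: e_in)
  also have "\<dots> = (\<Oplus>d\<in>D. b d x \<otimes> \<beta> (v d) y)"
    using assms basis_elt b_in subspace_closed[OF U]
    by (intro add.finprod_cong') (auto simp: evaluate_e rank_one_def)
  finally show ?thesis .
qed

text \<open>
  In a normal form, the row of the matrix at a pivot \<open>d\<close> is the second component that belongs to \<open>d\<close>.
  If the matrix is zero then all these components are zero, and \<open>(m, 0)\<close> is null.
\<close>

lemma null_eq_kernel: "null = {t \<in> free_pairs. evaluate t = (\<lambda>i. \<zero>)}"
proof (intro equalityI null_le_kernel subsetI)
  fix t assume "t \<in> {t \<in> free_pairs. evaluate t = (\<lambda>i. \<zero>)}"
  then have t: "t \<in> free_pairs" "evaluate t = (\<lambda>i. \<zero>)" by auto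
  obtain v where v: "\<And>d. d \<in> D \<Longrightarrow> v d \<in> carrier N"
    and tv: "t \<approx> (\<lambda>i. \<Oplus>d\<in>D. e (basis_elt d) (v d) i)" (is "t \<approx> ?s") using normal_form[OF t(1)] by blast
  have s: "?s \<in> free_pairs" "(\<lambda>i. t i \<ominus> ?s i) \<in> null" using tv by (auto simp: congruent_mod_null_def)
  have ev: "evaluate ?s = (\<lambda>i. \<zero>)"
  proof
    fix p
    have "evaluate (\<lambda>i. t i \<ominus> ?s i) = (\<lambda>i. \<zero>)" using s null_le_kernel by blast
    then have "evaluate t p \<ominus> evaluate ?s p = \<zero>"
      unfolding evaluate_minus[OF t(1) s(1)] by (rule fun_cong)
    then show "evaluate ?s p = \<zero>"
      using t evaluate_closed[OF s(1)] by (simp add: a_minus_def)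
  qed
  have "v d = \<zero>\<^bsub>N\<^esub>" if d: "d \<in> D" for d
  proof (rule \<beta>_inj)
    show "\<beta> (v d) = \<beta> \<zero>\<^bsub>N\<^esub>"
    proof
      fix y
      have "\<zero> = (\<Oplus>d'\<in>D. b d' d \<otimes> \<beta> (v d') y)"
        using evaluate_normal_form[of v d y, OF v] ev by simp
      also have "\<dots> = (\<Oplus>d'\<in>D. if d' = d then \<beta> (v d) y else \<zero>)"
        using d v by (intro add.finprod_cong') (auto simp: b_delta)
      also have "\<dots> = \<beta> (v d) y" using d v finD by (intro finsum_if_single) auto
      finally show "\<beta> (v d) y = \<beta> \<zero>\<^bsub>N\<^esub> y" by (simp add: \<beta>_zero)
    qed
  qed (use v d in auto)
  then have "?s = (\<lambda>i. \<Oplus>d\<in>D. e (basis_elt d) \<zero>\<^bsub>N\<^esub> i)"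
    by (intro ext add.finprod_cong') auto
  moreover have "(\<lambda>i. \<Oplus>d\<in>D. e (basis_elt d) \<zero>\<^bsub>N\<^esub> i) \<approx> (\<lambda>i. \<Oplus>d\<in>D. \<zero>)"
    using finD basis_elt by (intro cong_finsum e_zero2)
  ultimately have "t \<approx> (\<lambda>i. \<zero>)" using tv cong_trans by simp
  then show "t \<in> null" using subspace_closed[OF free_pairs_subspace t(1)]
    by (simp add: congruent_mod_null_def a_minus_def)
qed

text \<open>
  A matrix \<open>w\<close> with columns in \<open>U\<close> is the sum of \<open>b d x * w (d, y)\<close> over the pivots, by expanding each
  column.
\<close>

lemma evaluate_surj: "evaluate ` free_pairs = matrices U V"
proof (intro equalityI subsetI)
  fix w assume w: "w \<in> matrices U V"
  define v where "v d = (SOME n. n \<in> carrier N \<and> \<beta> n = (\<lambda>y. w (d, y)))" for d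
  have v: "v d \<in> carrier N \<and> \<beta> (v d) = (\<lambda>y. w (d, y))" for d
    unfolding v_def using \<beta>_surj[of "\<lambda>y. w (d, y)"] w
    by (intro someI_ex[of "\<lambda>n. n \<in> carrier N \<and> \<beta> n = (\<lambda>y. w (d, y))"]) (auto simp: matrices_def)
  let ?s = "\<lambda>i. \<Oplus>d\<in>D. e (basis_elt d) (v d) i"
  have "?s \<in> free_pairs"
    using v basis_elt finD by (intro subspace_finsum[OF free_pairs_subspace] e_in) auto
  moreover have "evaluate ?s = w"
  proof
    fix p :: "'i \<times> 'j" obtain x y where p: "p = (x, y)" by force
    have wU: "(\<lambda>x. w (x, y)) \<in> U" and wc: "w (x, y) \<in> carrier R" for x y
      using w subspace_closed[OF V] by (auto simp: matrices_def)
    have "evaluate ?s (x, y) = (\<Oplus>d\<in>D. b d x \<otimes> \<beta> (v d) y)" using v by (intro evaluate_normal_form) auto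
    also have "\<dots> = (\<Oplus>d\<in>D. w (d, y) \<otimes> b d x)"
      using v b_in subspace_closed[OF U] wc by (intro add.finprod_cong') (auto simp: m_comm)
    also have "\<dots> = w (x, y)" by (rule expand[OF wU, symmetric])
    finally show "evaluate ?s p = w p" by (simp add: p)
  qed
  ultimately show "w \<in> evaluate ` free_pairs" by (intro image_eqI[of _ _ ?s]) auto
qed (auto intro: evaluate_in)

definition to_matrix :: "('c \<times> 'd \<Rightarrow> 'a) set \<Rightarrow> 'i \<times> 'j \<Rightarrow> 'a" where
  "to_matrix X = evaluate (SOME t. t \<in> X)"

lemma to_matrix_iso: "linear_iso R (tensor_product R M N) (function_space (matrices U V)) to_matrix"
  unfolding to_matrix_def tensor_product_def tensor_free_eq
  by (rule quotient_by_kernel(1)[OF free_pairs_subspace matrices_subspace[OF U V] evaluate_surj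
        evaluate_add evaluate_smult null_eq_kernel])

lemma to_matrix_coset:
  assumes "t \<in> free_pairs"
  shows "to_matrix (null +>\<^bsub>tensor_free R M N\<^esub> t) = evaluate t"
  unfolding to_matrix_def tensor_free_eq
  by (rule quotient_by_kernel(2)[OF free_pairs_subspace matrices_subspace[OF U V] evaluate_surj
        evaluate_add evaluate_smult null_eq_kernel assms])

lemma to_matrix_pure:
  "m \<in> carrier M \<Longrightarrow> n \<in> carrier N \<Longrightarrow> to_matrix (pure_tensor R M N m n) = rank_one m n"
  by (simp add: pure_tensor_def to_matrix_coset e_in evaluate_e)

lemma coset_carrier:
  assumes "X \<in> carrier (tensor_product R M N)"
  obtains t where "t \<in> free_pairs" "X = null +>\<^bsub>tensor_free R M N\<^esub> t"
  using assms by (auto simp: tensor_product_def quotient_space_def A_RCOSETS_def' free_pairs_def)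

lemma coset_in: "t \<in> free_pairs \<Longrightarrow> null +>\<^bsub>tensor_free R M N\<^esub> t \<in> carrier (tensor_product R M N)"
  by (auto simp: tensor_product_def quotient_space_def A_RCOSETS_def' free_pairs_def)

lemma coset_members:
  assumes "t \<in> free_pairs"
  shows "null +>\<^bsub>tensor_free R M N\<^esub> t = {s \<in> free_pairs. evaluate s = evaluate t}"
  unfolding null_eq_kernel tensor_free_eq
  by (rule kernel_coset[OF free_pairs_subspace matrices_subspace[OF U V] evaluate_surj
        evaluate_add evaluate_smult assms])

end

context field
begin

text \<open>
  To know \<open>f \<otimes> g\<close> in terms of matrices it suffices to have a linear \<open>\<Theta>\<close> on matrices that is correct on
  matrices of rank one.  Since representatives of a tensor are determined by their matrix up to null
  elements, this also shows that all members of the union in \<^const>\<open>tensor_map\<close> agree.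
\<close>

lemma
  fixes M :: "('a, 'c) module" and N :: "('a, 'd) module"
    and M' :: "('a, 'e) module" and N' :: "('a, 'f) module"
  assumes A: "matrix_tensor R M N \<alpha> \<beta> U V D b" and B: "matrix_tensor R M' N' \<alpha>' \<beta>' U' V' D' b'"
    and f: "\<And>m. m \<in> carrier M \<Longrightarrow> f m \<in> carrier M'" and g: "\<And>n. n \<in> carrier N \<Longrightarrow> g n \<in> carrier N'"
    and \<Theta>_zero: "\<Theta> (\<lambda>i. \<zero>) = (\<lambda>i. \<zero>)"
    and \<Theta>_add: "\<And>w w'. w \<in> matrices U V \<Longrightarrow> w' \<in> matrices U V \<Longrightarrow>
      \<Theta> (\<lambda>i. w i \<oplus> w' i) = (\<lambda>i. \<Theta> w i \<oplus> \<Theta> w' i)"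
    and \<Theta>_smult: "\<And>c w. c \<in> carrier R \<Longrightarrow> w \<in> matrices U V \<Longrightarrow>
      \<Theta> (\<lambda>i. c \<otimes> w i) = (\<lambda>i. c \<otimes> \<Theta> w i)"
    and \<Theta>_rank_one: "\<And>m n. m \<in> carrier M \<Longrightarrow> n \<in> carrier N \<Longrightarrow>
      \<Theta> (\<lambda>(x, y). \<alpha> m x \<otimes> \<beta> n y) = (\<lambda>(x, y). \<alpha>' (f m) x \<otimes> \<beta>' (g n) y)"
    and X: "X \<in> carrier (tensor_product R M N)"
  shows tensor_map_closed: "tensor_map R M' N' f g X \<in> carrier (tensor_product R M' N')"
    and to_matrix_tensor_map: "matrix_tensor.to_matrix R \<alpha>' \<beta>' (tensor_map R M' N' f g X) =
      \<Theta> (matrix_tensor.to_matrix R \<alpha> \<beta> X)"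
proof -
  interpret A: matrix_tensor R M N \<alpha> \<beta> U V D b by (rule A)
  interpret B: matrix_tensor R M' N' \<alpha>' \<beta>' U' V' D' b' by (rule B)
  define G where "G = lin_ext R (\<lambda>(m, n). basis_vec R (f m, g n))"
  let ?S = "carrier M \<times> carrier N" and ?b = "\<lambda>(m, n). basis_vec R (f m, g n)"
  have b: "scalar_valued (?b i)" if "i \<in> ?S" for i
    using that by (auto intro!: scalar_valuedI)
  have bin: "?b i \<in> B.free_pairs" if "i \<in> ?S" for i
    using that f g by (auto intro!: B.e_in)
  have G_in: "G t \<in> B.free_pairs" if "t \<in> A.free_pairs" for t
    using lin_ext_in[where S = ?S and b = ?b, OF b _ B.free_pairs_subspace bin] that
    by (simp add: G_def A.free_pairs_eq)
  have ev: "B.evaluate (G t) = \<Theta> (A.evaluate t)" if "t \<in> A.free_pairs" for t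
    using that unfolding A.free_pairs_eq
  proof (induction rule: free_space_induct)
    case zero
    show ?case by (simp add: G_def lin_ext_def A.evaluate_zero B.evaluate_zero \<Theta>_zero)
  next
    case (step t c p)
    obtain m n where p: "p = (m, n)" and m: "m \<in> carrier M" and n: "n \<in> carrier N" using step(3) by auto
    have t: "t \<in> A.free_pairs" using step(1) by (simp add: A.free_pairs_eq)
    note c = \<open>c \<in> carrier R\<close>
    have ce: "(\<lambda>j. c \<otimes> basis_vec R p j) \<in> A.free_pairs"
      unfolding p by (intro subspace_smult[OF A.free_pairs_subspace] c A.e_in m n)
    have "G (\<lambda>j. t j \<oplus> c \<otimes> basis_vec R p j) = (\<lambda>j. G t j \<oplus> G (\<lambda>j. c \<otimes> basis_vec R p j) j)"
      unfolding G_def using t ce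
      by (intro lin_ext_add[where S = ?S and b = ?b]) (auto simp: A.free_pairs_eq b)
    also have "G (\<lambda>j. c \<otimes> basis_vec R p j) = (\<lambda>j. c \<otimes> G (basis_vec R p) j)"
      unfolding G_def using c step(3)
      by (intro lin_ext_smult[where S = ?S and b = ?b]) (auto simp: b basis_vec_in)
    also have "G (basis_vec R p) = basis_vec R (f m, g n)"
      unfolding G_def using lin_ext_basis[where S = ?S and b = ?b, OF b step(3)] by (simp add: p)
    finally have G: "G (\<lambda>j. t j \<oplus> c \<otimes> basis_vec R p j) =
      (\<lambda>j. G t j \<oplus> c \<otimes> basis_vec R (f m, g n) j)" .
    have "B.evaluate (G (\<lambda>j. t j \<oplus> c \<otimes> basis_vec R p j)) =
      (\<lambda>j. B.evaluate (G t) j \<oplus> c \<otimes> B.rank_one (f m) (g n) j)"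
      unfolding G using f[OF m] g[OF n] c G_in[OF t]
      by (simp add: B.evaluate_add B.evaluate_smult B.e_in B.evaluate_e
          subspace_smult[OF B.free_pairs_subspace])
    also have "B.rank_one (f m) (g n) = \<Theta> (A.rank_one m n)"
      using \<Theta>_rank_one[OF m n] by (simp add: A.rank_one_def B.rank_one_def)
    also have "B.evaluate (G t) = \<Theta> (A.evaluate t)" by (rule step.IH)
    also have "(\<lambda>j. \<Theta> (A.evaluate t) j \<oplus> c \<otimes> \<Theta> (A.rank_one m n) j) =
        \<Theta> (\<lambda>j. A.evaluate t j \<oplus> c \<otimes> A.rank_one m n j)"
      using c A.evaluate_in[OF t] A.rank_one_in[OF m n]
      by (simp add: \<Theta>_add \<Theta>_smult subspace_smult[OF matrices_subspace[OF A.U A.V]])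
    also have "(\<lambda>j. A.evaluate t j \<oplus> c \<otimes> A.rank_one m n j) =
        A.evaluate (\<lambda>j. t j \<oplus> c \<otimes> basis_vec R p j)"
      using c m n t by (simp add: p A.evaluate_add A.evaluate_smult A.e_in A.evaluate_e
          subspace_smult[OF A.free_pairs_subspace])
    finally show ?case .
  qed
  obtain t where t: "t \<in> A.free_pairs" and Xt: "X = A.null +>\<^bsub>tensor_free R M N\<^esub> t"
    using A.coset_carrier[OF X] .
  have "tensor_map R M' N' f g X = (\<Union>s\<in>X. B.null +>\<^bsub>tensor_free R M' N'\<^esub> G t)"
    unfolding tensor_map_def G_def[symmetric]
  proof (intro SUP_cong refl)
    fix s assume "s \<in> X"
    then have s: "s \<in> A.free_pairs" "A.evaluate s = A.evaluate t"
      unfolding Xt A.coset_members[OF t] by auto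
    then show "B.null +>\<^bsub>tensor_free R M' N'\<^esub> G s = B.null +>\<^bsub>tensor_free R M' N'\<^esub> G t"
      using t by (simp add: B.coset_members G_in ev)
  qed
  also have "\<dots> = B.null +>\<^bsub>tensor_free R M' N'\<^esub> G t"
    using t unfolding Xt A.coset_members[OF t] by auto
  finally have eq: "tensor_map R M' N' f g X = B.null +>\<^bsub>tensor_free R M' N'\<^esub> G t" .
  show "tensor_map R M' N' f g X \<in> carrier (tensor_product R M' N')"
    unfolding eq by (intro B.coset_in G_in t)
  show "B.to_matrix (tensor_map R M' N' f g X) = \<Theta> (A.to_matrix X)"
  proof -
    have "B.to_matrix (tensor_map R M' N' f g X) = \<Theta> (A.evaluate t)"
      by (simp only: eq B.to_matrix_coset[OF G_in[OF t]] ev[OF t])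
    also have "A.evaluate t = A.to_matrix X" by (simp only: Xt A.to_matrix_coset[OF t])
    finally show ?thesis .
  qed
qed

section \<open>Direct sums\<close>

text \<open>
  The map \<open>\<kappa>\<close> partitions the points.  A family of functions, one for each \<open>k \<in> I\<close> and supported on the
  \<open>k\<close>-th part, is the same as a single function; so a direct sum of spaces \<open>W k\<close> of this kind is again
  a function space.
\<close>

definition glued :: "'i set \<Rightarrow> ('i \<Rightarrow> ('j \<Rightarrow> 'a) set) \<Rightarrow> ('j \<Rightarrow> 'i) \<Rightarrow> ('j \<Rightarrow> 'a) set" where
  "glued I W \<kappa> = {w. (\<forall>c. w c \<noteq> \<zero> \<longrightarrow> \<kappa> c \<in> I) \<and> (\<forall>k\<in>I. (\<lambda>c. if \<kappa> c = k then w c else \<zero>) \<in> W k)}"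

definition glue :: "'i set \<Rightarrow> ('i \<Rightarrow> 'c \<Rightarrow> 'j \<Rightarrow> 'a) \<Rightarrow> ('j \<Rightarrow> 'i) \<Rightarrow> ('i \<Rightarrow> 'c) \<Rightarrow> 'j \<Rightarrow> 'a" where
  "glue I g \<kappa> t = (\<lambda>c. if \<kappa> c \<in> I then g (\<kappa> c) (t (\<kappa> c)) c else \<zero>)"

context
  fixes I :: "'i set" and N :: "'i \<Rightarrow> ('a, 'c) module" and W :: "'i \<Rightarrow> ('j \<Rightarrow> 'a) set"
    and g :: "'i \<Rightarrow> 'c \<Rightarrow> 'j \<Rightarrow> 'a" and \<kappa> :: "'j \<Rightarrow> 'i" and J :: "'i set"
  assumes W: "\<And>k. k \<in> I \<Longrightarrow> function_subspace (W k)"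
    and g: "\<And>k. k \<in> I \<Longrightarrow> linear_iso R (N k) (function_space (W k)) (g k)"
    and \<kappa>: "\<And>k w c. k \<in> I \<Longrightarrow> w \<in> W k \<Longrightarrow> w c \<noteq> \<zero> \<Longrightarrow> \<kappa> c = k"
    and J: "finite J" "\<And>k w. k \<in> I \<Longrightarrow> k \<notin> J \<Longrightarrow> w \<in> W k \<Longrightarrow> w = (\<lambda>c. \<zero>)"
begin

abbreviation "glued' \<equiv> glued I W \<kappa>"
abbreviation "glue' \<equiv> glue I g \<kappa>"

lemma glued_subspace: "function_subspace glued'"
proof (rule function_subspaceI)
  show cl: "f i \<in> carrier R" if f: "f \<in> glued'" for f i
  proof (cases "\<kappa> i \<in> I")
    case True
    then have "(\<lambda>c. if \<kappa> c = \<kappa> i then f c else \<zero>) \<in> W (\<kappa> i)" using f by (auto simp: glued_def)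
    from subspace_closed[OF W[OF True] this, of i] show ?thesis by simp
  next
    case False
    then have "f i = \<zero>" using f unfolding glued_def by blast
    then show ?thesis by simp
  qed
  show "(\<lambda>i. \<zero>) \<in> glued'" using subspace_zero[OF W] by (auto simp: glued_def)
  show "(\<lambda>i. f i \<oplus> h i) \<in> glued'" if "f \<in> glued'" "h \<in> glued'" for f h
  proof -
    have "(\<lambda>c. if \<kappa> c = k then f c \<oplus> h c else \<zero>) \<in> W k" if k: "k \<in> I" for k
    proof -
      have "(\<lambda>c. (if \<kappa> c = k then f c else \<zero>) \<oplus> (if \<kappa> c = k then h c else \<zero>)) \<in> W k"
        using \<open>f \<in> glued'\<close> \<open>h \<in> glued'\<close> k by (intro subspace_add[OF W]) (auto simp: glued_def)
      also have "(\<lambda>c. (if \<kappa> c = k then f c else \<zero>) \<oplus> (if \<kappa> c = k then h c else \<zero>)) =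
        (\<lambda>c. if \<kappa> c = k then f c \<oplus> h c else \<zero>)" by auto
      finally show ?thesis .
    qed
    moreover have "\<kappa> c \<in> I" if "f c \<oplus> h c \<noteq> \<zero>" for c
    proof (rule ccontr)
      assume "\<kappa> c \<notin> I"
      then have "f c = \<zero>" "h c = \<zero>" using \<open>f \<in> glued'\<close> \<open>h \<in> glued'\<close> unfolding glued_def by blast+
      then show False using that by simp
    qed
    ultimately show ?thesis by (auto simp: glued_def)
  qed
  show "(\<lambda>i. a \<otimes> f i) \<in> glued'" if "a \<in> carrier R" "f \<in> glued'" for a f
  proof -
    have "(\<lambda>c. if \<kappa> c = k then a \<otimes> f c else \<zero>) \<in> W k" if k: "k \<in> I" for k
    proof -
      have "(\<lambda>c. a \<otimes> (if \<kappa> c = k then f c else \<zero>)) \<in> W k"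
        using \<open>a \<in> carrier R\<close> \<open>f \<in> glued'\<close> k by (intro subspace_smult[OF W]) (auto simp: glued_def)
      also have "(\<lambda>c. a \<otimes> (if \<kappa> c = k then f c else \<zero>)) =
        (\<lambda>c. if \<kappa> c = k then a \<otimes> f c else \<zero>)" using \<open>a \<in> carrier R\<close> by auto
      finally show ?thesis .
    qed
    moreover have "\<kappa> c \<in> I" if "a \<otimes> f c \<noteq> \<zero>" for c
    proof (rule ccontr)
      assume "\<kappa> c \<notin> I"
      then have "f c = \<zero>" using \<open>f \<in> glued'\<close> unfolding glued_def by blast
      then show False using that \<open>a \<in> carrier R\<close> by simp
    qed
    ultimately show ?thesis by (auto simp: glued_def)
  qed
qed

text \<open>
  All spaces with index outside of the finite set \<open>J\<close> are zero, so the finiteness condition in a direct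
  sum holds for every family.
\<close>

lemma direct_sum_carrier: "carrier (direct_sum_space I N) = (\<Pi>\<^sub>E i\<in>I. carrier (N i))"
proof -
  have "finite {i \<in> I. x i \<noteq> \<zero>\<^bsub>N i\<^esub>}" if x: "x \<in> (\<Pi>\<^sub>E i\<in>I. carrier (N i))" for x
  proof (rule finite_subset[OF _ J(1)], rule subsetI, rule ccontr)
    fix i assume i: "i \<in> {i \<in> I. x i \<noteq> \<zero>\<^bsub>N i\<^esub>}" "i \<notin> J"
    have iI: "i \<in> I" using i by simp
    have lin: "linear_map R (N i) (function_space (W i)) (g i)" and bij: "bij_betw (g i) (carrier (N i)) (W i)"
      using g[OF iI] by (auto simp: linear_iso_def)
    interpret Ni: vectorspace R "N i" by (rule linear_map_vs1[OF lin])
    have xi: "x i \<in> carrier (N i)" using x iI by auto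
    have "g i (x i) = (\<lambda>c. \<zero>)" using J(2)[OF iI i(2)] linear_map_closed[OF lin xi] by simp
    also have "\<dots> = g i \<zero>\<^bsub>N i\<^esub>" using linear_map_zero[OF lin] by simp
    finally have "x i = \<zero>\<^bsub>N i\<^esub>"
      using bij_betw_imp_inj_on[OF bij] xi by (auto dest: inj_onD)
    with i show False by simp
  qed
  then show ?thesis by (auto simp: direct_sum_space_def)
qed

lemma glue_iso: "linear_iso R (direct_sum_space I N) (function_space glued') glue'"
proof (rule linear_iso_by_model[OF glued_subspace])
  have lin: "linear_map R (N k) (function_space (W k)) (g k)" and bij: "bij_betw (g k) (carrier (N k)) (W k)"
    if "k \<in> I" for k using g[OF that] by (auto simp: linear_iso_def)
  note vs = linear_map_vs1[OF lin]
  have gW: "g k x \<in> W k" if "k \<in> I" "x \<in> carrier (N k)" for k x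
    using linear_map_closed[OF lin] that by simp
  have ring: "abelian_group (N k)" if "k \<in> I" for k
    using vs[OF that] by (simp add: vectorspace_def module_def)
  have smc: "a \<odot>\<^bsub>N k\<^esub> x \<in> carrier (N k)" if "k \<in> I" "a \<in> carrier R" "x \<in> carrier (N k)" for k a x
    using vs[OF that(1)] that module.smult_closed by (auto simp: vectorspace_def)
  have sl: "(\<lambda>c. if \<kappa> c = k then glue' t c else \<zero>) = g k (t k)"
    if "k \<in> I" "t k \<in> carrier (N k)" for k t
  proof
    fix c show "(if \<kappa> c = k then glue' t c else \<zero>) = g k (t k) c"
      using \<kappa>[OF that(1) gW[OF that], of c] that(1)
      by (cases "\<kappa> c = k"; cases "g k (t k) c = \<zero>") (auto simp: glue_def)
  qed
  have glue_in: "glue' t \<in> glued'" if "t \<in> (\<Pi>\<^sub>E i\<in>I. carrier (N i))" for t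
    using that sl gW by (auto simp: glued_def PiE_iff) (auto simp: glue_def split: if_splits)
  show "bij_betw glue' (carrier (direct_sum_space I N)) glued'"
    unfolding direct_sum_carrier bij_betw_def
  proof
    show "inj_on glue' (\<Pi>\<^sub>E i\<in>I. carrier (N i))"
    proof (rule inj_onI)
      fix s t assume s: "s \<in> (\<Pi>\<^sub>E i\<in>I. carrier (N i))" and t: "t \<in> (\<Pi>\<^sub>E i\<in>I. carrier (N i))"
        and eq: "glue' s = glue' t"
      have "s k = t k" if k: "k \<in> I" for k
      proof -
        have sk: "s k \<in> carrier (N k)" "t k \<in> carrier (N k)" using s t k by auto
        have "g k (s k) = g k (t k)"
          unfolding sl[of k s, OF k sk(1), symmetric] sl[of k t, OF k sk(2), symmetric] eq ..
        then show ?thesis using inj_onD[OF bij_betw_imp_inj_on[OF bij[OF k]]] sk by blast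
      qed
      then show "s = t" using s t by (intro PiE_ext)
    qed
    show "glue' ` (\<Pi>\<^sub>E i\<in>I. carrier (N i)) = glued'"
    proof (intro equalityI subsetI)
      fix w assume w: "w \<in> glued'"
      define t where "t = (\<lambda>k\<in>I. inv_into (carrier (N k)) (g k) (\<lambda>c. if \<kappa> c = k then w c else \<zero>))"
      have t: "t k \<in> carrier (N k)" "g k (t k) = (\<lambda>c. if \<kappa> c = k then w c else \<zero>)" if "k \<in> I" for k
      proof -
        have "(\<lambda>c. if \<kappa> c = k then w c else \<zero>) \<in> g k ` carrier (N k)"
          using w that bij_betw_imp_surj_on[OF bij[OF that]] by (auto simp: glued_def)
        then show "t k \<in> carrier (N k)" "g k (t k) = (\<lambda>c. if \<kappa> c = k then w c else \<zero>)"
          using that by (auto simp: t_def inv_into_into f_inv_into_f)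
      qed
      have "glue' t = w"
      proof
        fix c show "glue' t c = w c"
        proof (cases "\<kappa> c \<in> I")
          case False
          then have "w c = \<zero>" using w unfolding glued_def by blast
          then show ?thesis using False by (simp add: glue_def)
        qed (simp add: glue_def t)
      qed
      moreover have "t \<in> (\<Pi>\<^sub>E i\<in>I. carrier (N i))" using t by (auto simp: t_def)
      ultimately show "w \<in> glue' ` (\<Pi>\<^sub>E i\<in>I. carrier (N i))" by (metis image_eqI)
    qed (use glue_in in auto)
  qed
  show "\<zero>\<^bsub>direct_sum_space I N\<^esub> \<in> carrier (direct_sum_space I N)"
    unfolding direct_sum_carrier using ring
    by (auto simp: direct_sum_space_def abelian_group_def abelian_monoid.zero_closed)
  show "glue' \<zero>\<^bsub>direct_sum_space I N\<^esub> = (\<lambda>i. \<zero>)"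
    using linear_map_zero[OF lin] by (auto simp: glue_def direct_sum_space_def)
next
  have lin: "linear_map R (N k) (function_space (W k)) (g k)" if "k \<in> I" for k
    using g[OF that] by (auto simp: linear_iso_def)
  note vs = linear_map_vs1[OF lin]
  fix s t assume st: "s \<in> carrier (direct_sum_space I N)" "t \<in> carrier (direct_sum_space I N)"
  have stk: "s k \<in> carrier (N k)" "t k \<in> carrier (N k)" if "k \<in> I" for k
    using st that unfolding direct_sum_carrier by auto
  have "s k \<oplus>\<^bsub>N k\<^esub> t k \<in> carrier (N k)" if "k \<in> I" for k
    using vs[OF that] stk[OF that]
    by (auto simp: vectorspace_def module_def abelian_group_def intro: abelian_monoid.a_closed)
  moreover have "glue' (s \<oplus>\<^bsub>direct_sum_space I N\<^esub> t) = (\<lambda>i. glue' s i \<oplus> glue' t i)"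
    using linear_map_add[OF lin] stk by (auto simp: glue_def direct_sum_space_def)
  ultimately show "s \<oplus>\<^bsub>direct_sum_space I N\<^esub> t \<in> carrier (direct_sum_space I N) \<and>
       glue' (s \<oplus>\<^bsub>direct_sum_space I N\<^esub> t) = (\<lambda>i. glue' s i \<oplus> glue' t i)"
    unfolding direct_sum_carrier by (auto simp: direct_sum_space_def)
next
  have lin: "linear_map R (N k) (function_space (W k)) (g k)" if "k \<in> I" for k
    using g[OF that] by (auto simp: linear_iso_def)
  note vs = linear_map_vs1[OF lin]
  fix a s assume a: "a \<in> carrier R" and s: "s \<in> carrier (direct_sum_space I N)"
  have sk: "s k \<in> carrier (N k)" if "k \<in> I" for k
    using s that unfolding direct_sum_carrier by auto
  have "a \<odot>\<^bsub>N k\<^esub> s k \<in> carrier (N k)" if "k \<in> I" for k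
    using vs[OF that] sk[OF that] a by (auto simp: vectorspace_def intro: module.smult_closed)
  moreover have "glue' (a \<odot>\<^bsub>direct_sum_space I N\<^esub> s) = (\<lambda>i. a \<otimes> glue' s i)"
    using linear_map_smult[OF lin a] sk a by (auto simp: glue_def direct_sum_space_def)
  ultimately show "a \<odot>\<^bsub>direct_sum_space I N\<^esub> s \<in> carrier (direct_sum_space I N) \<and>
       glue' (a \<odot>\<^bsub>direct_sum_space I N\<^esub> s) = (\<lambda>i. a \<otimes> glue' s i)"
    unfolding direct_sum_carrier by (auto simp: direct_sum_space_def)
qed

end

lemma ring_sign_closed [simp]: "ring_sign R p \<in> carrier R"
  by (simp add: ring_sign_def)

lemma ring_sign_add1: "ring_sign R (p + 1) = \<ominus> ring_sign R p" "ring_sign R (1 + p) = \<ominus> ring_sign R p"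
  by (auto simp: ring_sign_def)

lemma ring_sign_diff1: "ring_sign R (p - 1) = \<ominus> ring_sign R p"
  by (auto simp: ring_sign_def)

lemma ring_sign_square: "a \<in> carrier R \<Longrightarrow> ring_sign R p \<otimes> (ring_sign R p \<otimes> a) = a"
  by (auto simp: ring_sign_def l_minus r_minus)

lemma minus_zero [simp]: "a \<in> carrier R \<Longrightarrow> a \<ominus> \<zero> = a"
  by (simp add: a_minus_def)

lemma minus_self [simp]: "a \<in> carrier R \<Longrightarrow> a \<ominus> a = \<zero>"
  by (simp add: a_minus_def r_neg)

lemma minus_minus_cancel:
  assumes "u \<in> carrier R" "a \<in> carrier R" "b \<in> carrier R"
  shows "u = a \<oplus> b \<oplus> (u \<ominus> a \<ominus> b)"
proof -
  have "u \<ominus> a \<ominus> b = u \<oplus> \<ominus> (a \<oplus> b)"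
    using assms by (simp add: a_minus_def minus_add a_assoc)
  moreover have "(a \<oplus> b) \<oplus> (u \<oplus> \<ominus> (a \<oplus> b)) = u \<oplus> ((a \<oplus> b) \<oplus> \<ominus> (a \<oplus> b))"
    by (rule a_lcomm) (use assms in auto)
  ultimately show ?thesis using assms by (simp add: r_neg)
qed

section \<open>Operators given by finite combinations of evaluations\<close>

lemma local_functional_cong:
  assumes "local_functional E \<phi>" "\<And>u. scalar_valued u \<Longrightarrow> \<psi> u = \<phi> u"
  shows "local_functional E \<psi>"
  using assms unfolding local_functional_def by metis

lemma local_functional_minus:
  assumes "local_functional E \<phi>" "local_functional E \<psi>"
  shows "local_functional E (\<lambda>u. \<phi> u \<ominus> \<psi> u)"
  by (rule local_functional_cong[OF local_functional_add[OF assms(1)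
        local_functional_smult[OF assms(2), of "\<ominus> \<one>"]]])
    (auto simp: a_minus_def l_minus functional_closed[OF assms(2)])

text \<open>
  The value at \<open>x\<close> may depend only on finitely many values at points of degree \<open>deg x + s\<close>; so \<open>s\<close> is
  \<open>1\<close> for a boundary operator and \<open>-1\<close> for a contraction.  The operators are defined on all
  functions, which allows to apply them to columns of different degrees at once.
\<close>

definition local_operator :: "('i \<Rightarrow> int) \<Rightarrow> int \<Rightarrow> (('i \<Rightarrow> 'a) \<Rightarrow> 'i \<Rightarrow> 'a) \<Rightarrow> bool" where
  "local_operator deg s F \<longleftrightarrow> (\<forall>x. local_functional {e. deg e = deg x + s} (\<lambda>u. F u x))"

lemma local_operatorD: "local_operator deg s F \<Longrightarrow> local_functional {e. deg e = deg x + s} (\<lambda>u. F u x)"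
  by (simp add: local_operator_def)

lemma local_operator_id: "local_operator deg 0 (\<lambda>u. u)"
  by (auto simp: local_operator_def intro: local_functional_eval)

lemma local_operator_minus:
  "local_operator deg s F \<Longrightarrow> local_operator deg s G \<Longrightarrow> local_operator deg s (\<lambda>u x. F u x \<ominus> G u x)"
  by (simp add: local_operator_def local_functional_minus)

context
  fixes deg :: "'i \<Rightarrow> int" and s F
  assumes F: "local_operator deg s F"
begin

lemma operator_scalar: "scalar_valued u \<Longrightarrow> scalar_valued (F u)"
  by (rule scalar_valuedI, rule functional_closed[OF local_operatorD[OF F]])

lemma operator_closed: "scalar_valued u \<Longrightarrow> F u x \<in> carrier R"
  by (intro functional_closed[OF local_operatorD[OF F]])

lemma operator_add:
  "scalar_valued u \<Longrightarrow> scalar_valued v \<Longrightarrow> F (\<lambda>i. u i \<oplus> v i) = (\<lambda>i. F u i \<oplus> F v i)"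
  by (intro ext functional_add[OF local_operatorD[OF F]])

lemma operator_minus:
  "scalar_valued u \<Longrightarrow> scalar_valued v \<Longrightarrow> F (\<lambda>i. u i \<ominus> v i) = (\<lambda>i. F u i \<ominus> F v i)"
  by (intro ext functional_minus[OF local_operatorD[OF F]])

lemma operator_smult:
  "a \<in> carrier R \<Longrightarrow> scalar_valued u \<Longrightarrow> F (\<lambda>i. a \<otimes> u i) = (\<lambda>i. a \<otimes> F u i)"
  by (intro ext functional_smult[OF local_operatorD[OF F]])

lemma operator_zero: "F (\<lambda>i. \<zero>) = (\<lambda>i. \<zero>)"
  by (intro ext functional_zero[OF local_operatorD[OF F]])

lemma operator_lincomb:
  assumes "finite A" "\<And>a. a \<in> A \<Longrightarrow> scalar_valued (f a)" "\<And>a. a \<in> A \<Longrightarrow> c a \<in> carrier R"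
  shows "F (\<lambda>i. \<Oplus>a\<in>A. c a \<otimes> f a i) = (\<lambda>i. \<Oplus>a\<in>A. c a \<otimes> F (f a) i)"
proof
  fix i
  have "F (\<lambda>i. \<Oplus>a\<in>A. c a \<otimes> f a i) i = (\<Oplus>a\<in>A. F (\<lambda>i. c a \<otimes> f a i) i)"
    using assms by (intro functional_finsum[OF local_operatorD[OF F]]) (auto intro!: scalar_valuedI)
  also have "\<dots> = (\<Oplus>a\<in>A. c a \<otimes> F (f a) i)"
    using assms by (intro add.finprod_cong') (auto simp: operator_smult operator_closed)
  finally show "F (\<lambda>i. \<Oplus>a\<in>A. c a \<otimes> f a i) i = (\<Oplus>a\<in>A. c a \<otimes> F (f a) i)" .
qed

end

lemma local_operator_comp:
  assumes F: "local_operator deg s F" and G: "local_operator deg s' G"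
  shows "local_operator deg (s + s') (\<lambda>u. F (G u))"
  unfolding local_operator_def
proof
  fix x
  show "local_functional {e. deg e = deg x + (s + s')} (\<lambda>u. F (G u) x)"
  proof (rule local_functional_comp[OF local_operatorD[OF F]])
    fix e assume "e \<in> {e. deg e = deg x + s}"
    then show "local_functional {e. deg e = deg x + (s + s')} (\<lambda>u. G u e)"
      using local_operatorD[OF G, of e] by (simp add: add.assoc)
  qed (rule operator_scalar[OF G])
qed

end

section \<open>Contracting a complex onto its homology\<close>

text \<open>
  The boundary operator does not depend on the degree, because it will be applied to all columns of a
  matrix at once, and these have different degrees.
\<close>

locale function_complex = field R for R (structure) +
  fixes deg :: "'i \<Rightarrow> int" and U :: "int \<Rightarrow> ('i \<Rightarrow> 'a) set" and d :: "('i \<Rightarrow> 'a) \<Rightarrow> 'i \<Rightarrow> 'a"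
  assumes U: "function_subspace (U n)"
    and degree: "u \<in> U n \<Longrightarrow> u x \<noteq> \<zero> \<Longrightarrow> deg x = n"
    and finite_support: "\<exists>S. finite S \<and> (\<forall>u\<in>U n. \<forall>x. u x \<noteq> \<zero> \<longrightarrow> x \<in> S)"
    and d_local: "local_operator deg 1 d"
    and d_in: "u \<in> U n \<Longrightarrow> d u \<in> U (n - 1)"
    and d_d: "u \<in> U n \<Longrightarrow> d (d u) = (\<lambda>x. \<zero>)"
begin

lemma scalar: "u \<in> U n \<Longrightarrow> scalar_valued u"
  by (rule subspace_scalar[OF U])

lemma d_in': "u \<in> U (n + 1) \<Longrightarrow> d u \<in> U n"
  using d_in[of u "n + 1"] by simp

text \<open>
  A section of the boundary operator: each element of an echelon basis of the boundaries is lifted to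
  a chain, and \<open>s\<close> extends this choice linearly.  The coefficients are values at pivots,
  so that the same formula defines \<open>s\<close> as a local operator on all functions.
\<close>

lemma section_exists:
  "\<exists>s. local_operator deg (- 1) s \<and> (\<forall>n. \<forall>u\<in>U n. s u \<in> U (n + 1)) \<and> (\<forall>n. \<forall>u\<in>U n. d (s (d u)) = d u)"
proof -
  define B where "B n = d ` U (n + 1)" for n
  have B: "function_subspace (B n)" for n
  proof (rule function_subspaceI)
    show "(\<lambda>i. \<zero>) \<in> B n"
      unfolding B_def using operator_zero[OF d_local] subspace_zero[OF U] by (metis image_eqI)
    fix f assume "f \<in> B n"
    then obtain u where u: "u \<in> U (n + 1)" "f = d u" by (auto simp: B_def)
    then show "f i \<in> carrier R" for i by (simp add: operator_closed[OF d_local] scalar)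
    show "(\<lambda>i. c \<otimes> f i) \<in> B n" if "c \<in> carrier R" for c
      unfolding B_def u(2) operator_smult[OF d_local that scalar[OF u(1)], symmetric]
      by (intro imageI subspace_smult[OF U] that u)
    fix g assume "g \<in> B n"
    then obtain v where v: "v \<in> U (n + 1)" "g = d v" by (auto simp: B_def)
    show "(\<lambda>i. f i \<oplus> g i) \<in> B n"
      unfolding B_def u(2) v(2) operator_add[OF d_local scalar[OF u(1)] scalar[OF v(1)], symmetric]
      by (intro imageI subspace_add[OF U] u v)
  qed
  have BU: "u \<in> B n \<Longrightarrow> u \<in> U n" for u n by (auto simp: B_def d_in')
  have "\<exists>D b. echelon_basis (B n) D b" for n
  proof -
    obtain S where "finite S" "\<forall>u\<in>U n. \<forall>x. u x \<noteq> \<zero> \<longrightarrow> x \<in> S" using finite_support by blast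
    then show ?thesis using echelon_basis_exists[of S "B n"] B BU by blast
  qed
  then obtain D b where b: "\<And>n. echelon_basis (B n) (D n) (b n)" by metis
  have finD: "finite (D n)" and bB: "e \<in> D n \<Longrightarrow> b n e \<in> B n"
    and one: "e \<in> D n \<Longrightarrow> b n e e = \<one>"
    and expand: "u \<in> B n \<Longrightarrow> u i = (\<Oplus>e\<in>D n. u e \<otimes> b n e i)" for n e u i
    using b[of n] unfolding echelon_basis_def by simp_all
  \<comment> \<open>A member of \<open>B n\<close> with a non-zero value at \<open>e\<close> forces \<open>e\<close> to have degree \<open>n\<close>.\<close>
  have deg_D: "deg e = n" if "e \<in> D n" for e n
    using degree[OF BU[OF bB[OF that]]] one[OF that] by simp
  have "\<forall>n. \<forall>e. \<exists>c. e \<in> D n \<longrightarrow> c \<in> U (n + 1) \<and> d c = b n e"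
    using bB unfolding B_def image_iff by metis
  then obtain c where c: "\<And>n e. e \<in> D n \<Longrightarrow> c n e \<in> U (n + 1)" "\<And>n e. e \<in> D n \<Longrightarrow> d (c n e) = b n e"
    by metis
  have c_cl [simp]: "e \<in> D n \<Longrightarrow> c n e x \<in> carrier R" for n e x
    using c(1) subspace_closed[OF U] by blast
  \<comment> \<open>The index \<open>deg x - 1\<close> is the degree of the boundaries that are lifted to chains not vanishing at \<open>x\<close>.\<close>
  define s where "s u x = (\<Oplus>e\<in>D (deg x - 1). c (deg x - 1) e x \<otimes> u e)" for u x
  have s_local: "local_operator deg (- 1) s"
    unfolding local_operator_def s_def
    by (intro allI local_functionalI[OF finD]) (auto dest: deg_D)
  have s_eq: "s u = (\<lambda>x. \<Oplus>e\<in>D n. u e \<otimes> c n e x)" if u: "u \<in> U n" for u n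
  proof
    fix x
    note [simp] = subspace_closed[OF U u]
    show "s u x = (\<Oplus>e\<in>D n. u e \<otimes> c n e x)"
    proof (cases "deg x = n + 1")
      case True
      then show ?thesis unfolding s_def by (intro add.finprod_cong') (auto simp: m_comm)
    next
      case False
      have "u e = \<zero>" if "e \<in> D (deg x - 1)" for e
        using degree[OF u, of e] deg_D[OF that] False by auto
      then have "s u x = \<zero>" unfolding s_def by (intro add.finprod_one_eqI) auto
      moreover have "c n e x = \<zero>" if "e \<in> D n" for e
        using degree[OF c(1)[OF that], of x] False by auto
      then have "(\<Oplus>e\<in>D n. u e \<otimes> c n e x) = \<zero>" by (intro add.finprod_one_eqI) auto
      ultimately show ?thesis by simp
    qed
  qed
  have s_in: "s u \<in> U (n + 1)" if "u \<in> U n" for u n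
    unfolding s_eq[OF that] using finD c(1) subspace_closed[OF U that]
    by (intro subspace_lincomb[OF U]) auto
  have "d (s (d u)) = d u" if u: "u \<in> U n" for u n
  proof -
    have dB: "d u \<in> B (n - 1)" using u by (simp add: B_def)
    have "d (s (d u)) = (\<lambda>x. \<Oplus>e\<in>D (n - 1). d u e \<otimes> d (c (n - 1) e) x)"
      unfolding s_eq[OF d_in[OF u]]
      using scalar[OF c(1)] scalar[OF d_in[OF u]] by (intro operator_lincomb[OF d_local finD]) auto
    also have "\<dots> = (\<lambda>x. \<Oplus>e\<in>D (n - 1). d u e \<otimes> b (n - 1) e x)"
      using c(2) subspace_closed[OF U BU[OF bB]] subspace_closed[OF U d_in[OF u]]
      by (intro ext add.finprod_cong') auto
    also have "\<dots> = d u" by (intro ext expand[OF dB, symmetric])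
    finally show ?thesis .
  qed
  with s_local s_in show ?thesis by blast
qed

text \<open>
  With only \<open>d h d = d\<close>, the operator \<open>1 - d h - h d\<close> is annihilated by \<open>d\<close> on both sides, but it need
  not be idempotent; this requires \<open>d h h d = 0\<close> in addition.  Replacing a section \<open>s\<close> by
  \<open>h = s - d s s\<close> achieves it: \<open>d h = d s\<close>, and so \<open>d h h d = d s (s - d s s) d = d s s d - d s s d\<close>.
\<close>

lemma contraction_exists:
  "\<exists>h. local_operator deg (- 1) h \<and> (\<forall>n. \<forall>u\<in>U n. h u \<in> U (n + 1)) \<and>
     (\<forall>n. \<forall>u\<in>U n. d (h (d u)) = d u) \<and> (\<forall>n. \<forall>u\<in>U n. d (h (h (d u))) = (\<lambda>x. \<zero>))"
proof -
  obtain s where s_local: "local_operator deg (- 1) s" and s_in: "\<And>n u. u \<in> U n \<Longrightarrow> s u \<in> U (n + 1)"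
    and dsd: "\<And>n u. u \<in> U n \<Longrightarrow> d (s (d u)) = d u"
    using section_exists by blast
  define h where "h u = (\<lambda>x. s u x \<ominus> d (s (s u)) x)" for u
  have "local_operator deg (1 + (- 1 + - 1)) (\<lambda>u. d (s (s u)))"
    by (intro local_operator_comp[OF d_local] local_operator_comp[OF s_local s_local])
  then have h_local: "local_operator deg (- 1) h"
    unfolding h_def using local_operator_minus[OF s_local] by simp
  have dss: "d (s (s u)) \<in> U (n + 1)" if "u \<in> U n" for u n
    using that by (intro d_in' s_in)
  have h_in: "h u \<in> U (n + 1)" if "u \<in> U n" for u n
    unfolding h_def using that by (intro subspace_minus[OF U] s_in dss)
  have dh: "d (h u) = d (s u)" if u: "u \<in> U n" for u n
  proof -
    have "d (h u) = (\<lambda>x. d (s u) x \<ominus> d (d (s (s u))) x)"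
      unfolding h_def using u by (intro operator_minus[OF d_local] scalar[OF s_in] scalar[OF dss])
    then show ?thesis
      using d_d[OF s_in[OF s_in[OF u]]] subspace_closed[OF U d_in[OF s_in[OF u]]] by simp
  qed
  have "d (h (h (d u))) = (\<lambda>x. \<zero>)" if u: "u \<in> U n" for u n
  proof -
    note w = d_in[OF u]
    let ?w = "d u"
    note ds_local = local_operator_comp[OF d_local s_local]
    have "d (h (h ?w)) = d (s (h ?w))" by (rule dh[OF h_in[OF w]])
    also have "\<dots> = (\<lambda>x. d (s (s ?w)) x \<ominus> d (s (d (s (s ?w)))) x)"
      unfolding h_def by (intro operator_minus[OF ds_local] scalar[OF s_in[OF w]] scalar[OF dss[OF w]])
    also have "d (s (d (s (s ?w)))) = d (s (s ?w))" by (rule dsd[OF s_in[OF s_in[OF w]]])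
    finally show ?thesis using subspace_closed[OF U dss[OF w]] by simp
  qed
  with h_local h_in dh dsd d_in show ?thesis by (metis (no_types, lifting))
qed

end

locale contracted_complex = function_complex R deg U d
  for R :: "('a, 'b) ring_scheme" (structure) and deg :: "'i \<Rightarrow> int" and U d +
  fixes h :: "('i \<Rightarrow> 'a) \<Rightarrow> 'i \<Rightarrow> 'a"
  assumes h_local: "local_operator deg (- 1) h"
    and h_in: "u \<in> U n \<Longrightarrow> h u \<in> U (n + 1)"
    and dhd: "u \<in> U n \<Longrightarrow> d (h (d u)) = d u"
    and dhhd: "u \<in> U n \<Longrightarrow> d (h (h (d u))) = (\<lambda>x. \<zero>)"
begin

definition proj :: "('i \<Rightarrow> 'a) \<Rightarrow> 'i \<Rightarrow> 'a" where
  "proj u = (\<lambda>x. u x \<ominus> d (h u) x \<ominus> h (d u) x)"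

definition harmonic :: "int \<Rightarrow> ('i \<Rightarrow> 'a) set" where
  "harmonic n = {u \<in> U n. proj u = u}"

lemma dh_local: "local_operator deg 0 (\<lambda>u. d (h u))" and hd_local: "local_operator deg 0 (\<lambda>u. h (d u))"
  using local_operator_comp[OF d_local h_local] local_operator_comp[OF h_local d_local] by simp_all

lemma proj_local: "local_operator deg 0 proj"
  unfolding proj_def
  by (intro local_operator_minus local_operator_id dh_local hd_local)

lemma dh_in: "u \<in> U n \<Longrightarrow> d (h u) \<in> U n" and hd_in: "u \<in> U n \<Longrightarrow> h (d u) \<in> U n"
  using d_in'[OF h_in, of u n] h_in[OF d_in, of u n] by simp_all

lemma closed [simp]: "u \<in> U n \<Longrightarrow> u x \<in> carrier R"
  by (rule subspace_closed[OF U])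

lemma proj_in: "u \<in> U n \<Longrightarrow> proj u \<in> U n"
  unfolding proj_def by (intro subspace_minus[OF U] dh_in hd_in)

lemma d_proj:
  assumes u: "u \<in> U n"
  shows "d (proj u) = (\<lambda>x. \<zero>)"
proof -
  have "d (proj u) = (\<lambda>x. d (\<lambda>x. u x \<ominus> d (h u) x) x \<ominus> d (h (d u)) x)"
    unfolding proj_def
    by (intro operator_minus[OF d_local] scalar[OF subspace_minus[OF U u dh_in[OF u]]] scalar[OF hd_in[OF u]])
  also have "d (\<lambda>x. u x \<ominus> d (h u) x) = (\<lambda>x. d u x \<ominus> d (d (h u)) x)"
    by (intro operator_minus[OF d_local] scalar[OF u] scalar[OF dh_in[OF u]])
  finally show ?thesis
    using dhd[OF u] d_d[OF h_in[OF u]] closed[OF d_in[OF u]] by simp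
qed

lemma proj_d:
  assumes u: "u \<in> U n"
  shows "proj (d u) = (\<lambda>x. \<zero>)"
  unfolding proj_def dhd[OF u] d_d[OF u] operator_zero[OF h_local]
  using closed[OF d_in[OF u]] by simp

lemma dh_proj:
  assumes u: "u \<in> U n"
  shows "d (h (proj u)) = (\<lambda>x. \<zero>)"
proof -
  have "d (h (proj u)) = (\<lambda>x. d (h (\<lambda>x. u x \<ominus> d (h u) x)) x \<ominus> d (h (h (d u))) x)"
    unfolding proj_def
    by (intro operator_minus[OF dh_local] scalar[OF subspace_minus[OF U u dh_in[OF u]]] scalar[OF hd_in[OF u]])
  also have "d (h (\<lambda>x. u x \<ominus> d (h u) x)) = (\<lambda>x. d (h u) x \<ominus> d (h (d (h u))) x)"
    by (intro operator_minus[OF dh_local] scalar[OF u] scalar[OF dh_in[OF u]])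
  finally show ?thesis
    using dhd[OF h_in[OF u]] dhhd[OF u] closed[OF dh_in[OF u]] by simp
qed

lemma proj_proj:
  assumes u: "u \<in> U n"
  shows "proj (proj u) = proj u"
proof -
  have "proj (proj u) = (\<lambda>x. proj u x \<ominus> d (h (proj u)) x \<ominus> h (d (proj u)) x)"
    by (subst (1) proj_def) simp
  then show ?thesis
    using closed[OF proj_in[OF u]] by (simp add: dh_proj[OF u] d_proj[OF u] operator_zero[OF h_local])
qed

lemma proj_harmonic: "u \<in> U n \<Longrightarrow> proj u \<in> harmonic n"
  by (simp add: harmonic_def proj_in proj_proj)

lemma harmonic_subspace: "function_subspace (harmonic n)"
  using subspace_zero[OF U] subspace_add[OF U] subspace_smult[OF U]
  by (intro function_subspaceI)
    (auto simp: harmonic_def operator_zero[OF proj_local] operator_add[OF proj_local]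
      operator_smult[OF proj_local] scalar)

lemma harmonic_U: "u \<in> harmonic n \<Longrightarrow> u \<in> U n"
  by (simp add: harmonic_def)

lemma d_harmonic: "u \<in> harmonic n \<Longrightarrow> d u = (\<lambda>x. \<zero>)"
  using d_proj[of u n] by (simp add: harmonic_def)

lemma split: "u \<in> U n \<Longrightarrow> u x = d (h u) x \<oplus> h (d u) x \<oplus> proj u x"
proof -
  assume u: "u \<in> U n"
  then have "u x \<in> carrier R" "d (h u) x \<in> carrier R" "h (d u) x \<in> carrier R"
    using closed[OF u] closed[OF dh_in[OF u]] closed[OF hd_in[OF u]] by auto
  then show ?thesis unfolding proj_def by (rule minus_minus_cancel)
qed

text \<open>
  On a cycle \<open>z\<close> the projection is \<open>z - d (h z)\<close>, a homologous cycle; it vanishes iff \<open>z\<close> is a boundary.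
\<close>

lemma homology_model:
  "\<exists>\<alpha>. linear_iso R (quotient_space (function_space {z \<in> U n. d z = (\<lambda>x. \<zero>)}) (d ` U (n + 1)))
     (function_space (harmonic n)) \<alpha>"
proof -
  let ?Z = "{z \<in> U n. d z = (\<lambda>x. \<zero>)}"
  have Z: "function_subspace ?Z"
    using subspace_zero[OF U] subspace_add[OF U] subspace_smult[OF U]
    by (intro function_subspaceI)
      (auto simp: operator_zero[OF d_local] operator_add[OF d_local] operator_smult[OF d_local] scalar)
  have surj: "proj ` ?Z = harmonic n"
  proof (intro equalityI subsetI)
    fix u assume "u \<in> harmonic n"
    then show "u \<in> proj ` ?Z"
      using d_harmonic by (intro image_eqI[of _ _ u]) (auto simp: harmonic_def)
  qed (auto simp: proj_harmonic)
  have ker: "d ` U (n + 1) = {z \<in> ?Z. proj z = (\<lambda>x. \<zero>)}"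
  proof (intro equalityI subsetI)
    fix z assume "z \<in> {z \<in> ?Z. proj z = (\<lambda>x. \<zero>)}"
    then have z: "z \<in> U n" "d z = (\<lambda>x. \<zero>)" "proj z = (\<lambda>x. \<zero>)" by auto
    have "z = d (h z)"
    proof
      fix x show "z x = d (h z) x"
        using split[OF z(1), of x] closed[OF dh_in[OF z(1)]]
        by (simp add: z(2,3) operator_zero[OF h_local])
    qed
    then show "z \<in> d ` U (n + 1)" using h_in[OF z(1)] by (rule image_eqI)
  qed (auto simp: d_in' d_d proj_d)
  show ?thesis
    using quotient_by_kernel(1)[OF Z harmonic_subspace surj _ _ ker]
      operator_add[OF proj_local] operator_smult[OF proj_local] scalar by blast
qed

end

lemma (in function_complex) contracted_complex_exists: "\<exists>h. contracted_complex R deg U d h"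
proof -
  obtain h where "local_operator deg (- 1) h" "\<And>n u. u \<in> U n \<Longrightarrow> h u \<in> U (n + 1)"
    "\<And>n u. u \<in> U n \<Longrightarrow> d (h (d u)) = d u" "\<And>n u. u \<in> U n \<Longrightarrow> d (h (h (d u))) = (\<lambda>x. \<zero>)"
    using contraction_exists by blast
  then have "contracted_complex R deg U d h" by unfold_locales
  then show ?thesis by blast
qed

section \<open>The contraction of a product complex\<close>

definition on_left :: "(('i \<Rightarrow> 'k) \<Rightarrow> 'i \<Rightarrow> 'k) \<Rightarrow> ('i \<times> 'j \<Rightarrow> 'k) \<Rightarrow> 'i \<times> 'j \<Rightarrow> 'k" where
  "on_left F w = (\<lambda>(x, y). F (\<lambda>x'. w (x', y)) x)"

definition on_right :: "(('j \<Rightarrow> 'k) \<Rightarrow> 'j \<Rightarrow> 'k) \<Rightarrow> ('i \<times> 'j \<Rightarrow> 'k) \<Rightarrow> 'i \<times> 'j \<Rightarrow> 'k" where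
  "on_right G w = (\<lambda>(x, y). G (\<lambda>y'. w (x, y')) y)"

context field
begin

lemma slice_scalar:
  "scalar_valued w \<Longrightarrow> scalar_valued (\<lambda>x. w (x, y))" "scalar_valued w \<Longrightarrow> scalar_valued (\<lambda>y. w (x, y))"
  by (auto intro!: scalar_valuedI)

lemma on_left_add:
  "local_operator deg s F \<Longrightarrow> scalar_valued v \<Longrightarrow> scalar_valued w \<Longrightarrow>
    on_left F (\<lambda>i. v i \<oplus> w i) = (\<lambda>i. on_left F v i \<oplus> on_left F w i)"
  by (simp add: on_left_def fun_eq_iff operator_add[of deg s F] slice_scalar)

lemma on_right_add:
  "local_operator deg s F \<Longrightarrow> scalar_valued v \<Longrightarrow> scalar_valued w \<Longrightarrow>
    on_right F (\<lambda>i. v i \<oplus> w i) = (\<lambda>i. on_right F v i \<oplus> on_right F w i)"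
  by (simp add: on_right_def fun_eq_iff operator_add[of deg s F] slice_scalar)

lemma on_left_smult:
  "local_operator deg s F \<Longrightarrow> a \<in> carrier R \<Longrightarrow> scalar_valued w \<Longrightarrow>
    on_left F (\<lambda>i. a \<otimes> w i) = (\<lambda>i. a \<otimes> on_left F w i)"
  by (simp add: on_left_def fun_eq_iff operator_smult[of deg s F] slice_scalar)

lemma on_right_smult:
  "local_operator deg s F \<Longrightarrow> a \<in> carrier R \<Longrightarrow> scalar_valued w \<Longrightarrow>
    on_right F (\<lambda>i. a \<otimes> w i) = (\<lambda>i. a \<otimes> on_right F w i)"
  by (simp add: on_right_def fun_eq_iff operator_smult[of deg s F] slice_scalar)

lemma on_left_zero: "local_operator deg s F \<Longrightarrow> on_left F (\<lambda>i. \<zero>) = (\<lambda>i. \<zero>)"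
  by (auto simp: on_left_def operator_zero)

lemma on_right_zero: "local_operator deg s F \<Longrightarrow> on_right F (\<lambda>i. \<zero>) = (\<lambda>i. \<zero>)"
  by (auto simp: on_right_def operator_zero)

lemma on_left_on_right:
  assumes "local_operator deg s F" "local_operator deg' s' G" "scalar_valued w"
  shows "on_left F (on_right G w) = on_right G (on_left F w)"
  using functionals_commute[OF local_operatorD[OF assms(1)] local_operatorD[OF assms(2)] assms(3)]
  by (simp add: on_left_def on_right_def)

definition twist :: "('i \<Rightarrow> int) \<Rightarrow> ('i \<times> 'j \<Rightarrow> 'a) \<Rightarrow> 'i \<times> 'j \<Rightarrow> 'a" where
  "twist deg w = (\<lambda>(x, y). ring_sign R (deg x) \<otimes> w (x, y))"

text \<open>
  The operator looks at points of degree \<open>deg x + s\<close> only, where the sign of the twist is constant.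
\<close>

lemma on_left_twist:
  assumes F: "local_operator deg s F" and w: "scalar_valued w"
  shows "on_left F (twist deg w) (x, y) = ring_sign R (deg x + s) \<otimes> on_left F w (x, y)"
proof -
  have "F (\<lambda>x'. ring_sign R (deg x') \<otimes> w (x', y)) x = F (\<lambda>x'. ring_sign R (deg x + s) \<otimes> w (x', y)) x"
    using w by (intro functional_cong[OF local_operatorD[OF F]]) (auto intro!: scalar_valuedI)
  also have "\<dots> = ring_sign R (deg x + s) \<otimes> F (\<lambda>x'. w (x', y)) x"
    using w by (simp add: operator_smult[OF F] slice_scalar)
  finally show ?thesis by (simp add: on_left_def twist_def)
qed

lemma on_right_twist:
  assumes G: "local_operator deg' s G" and w: "scalar_valued w"
  shows "on_right G (twist deg w) = twist deg (on_right G w)"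
  using operator_smult[OF G _ slice_scalar(2)[OF w]]
  by (auto simp: on_right_def twist_def)

text \<open>
  Matrices of total degree \<open>r\<close>: the column at \<open>y\<close> has degree \<open>r - dY y\<close>.
\<close>

definition total :: "('i \<Rightarrow> int) \<Rightarrow> ('j \<Rightarrow> int) \<Rightarrow> (int \<Rightarrow> ('i \<Rightarrow> 'a) set) \<Rightarrow> (int \<Rightarrow> ('j \<Rightarrow> 'a) set)
    \<Rightarrow> int \<Rightarrow> ('i \<times> 'j \<Rightarrow> 'a) set" where
  "total dX dY A B r = {w. (\<forall>y. (\<lambda>x. w (x, y)) \<in> A (r - dY y)) \<and> (\<forall>x. (\<lambda>y. w (x, y)) \<in> B (r - dX x))}"

lemma total_subspace:
  fixes A :: "int \<Rightarrow> ('i \<Rightarrow> 'a) set" and B :: "int \<Rightarrow> ('j \<Rightarrow> 'a) set"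
  assumes "\<And>n. function_subspace (A n)" "\<And>n. function_subspace (B n)"
  shows "function_subspace (total dX dY A B r)"
proof (rule function_subspaceI)
  fix f and i :: "'i \<times> 'j" assume f: "f \<in> total dX dY A B r"
  obtain x y where i: "i = (x, y)" by force
  have "(\<lambda>y. f (x, y)) \<in> B (r - dX x)" using f by (auto simp: total_def)
  from subspace_closed[OF assms(2) this, of y] show "f i \<in> carrier R" by (simp add: i)
qed (auto simp: total_def subspace_zero[OF assms(1)] subspace_zero[OF assms(2)]
      intro: subspace_add[OF assms(1)] subspace_add[OF assms(2)]
      subspace_smult[OF assms(1)] subspace_smult[OF assms(2)])

text \<open>
  Columns of the result are values of \<open>F\<close>, and its rows are linear combinations of rows of \<open>w\<close>, all
  of the same degree.
\<close>

lemma on_left_total: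
  assumes F: "local_operator dX s F" and A: "\<And>n u. u \<in> A n \<Longrightarrow> F u \<in> A' (n - s)"
    and B: "\<And>n. function_subspace (B n)" and sc: "\<And>n. function_subspace (A n)"
    and w: "w \<in> total dX dY A B r"
  shows "on_left F w \<in> total dX dY A' B (r - s)"
  unfolding total_def
proof (intro CollectI conjI allI)
  fix y
  have "(\<lambda>x. w (x, y)) \<in> A (r - dY y)" using w by (auto simp: total_def)
  from A[OF this] show "(\<lambda>x. on_left F w (x, y)) \<in> A' (r - s - dY y)"
    by (simp add: on_left_def algebra_simps)
next
  fix x
  show "(\<lambda>y. on_left F w (x, y)) \<in> B (r - s - dX x)"
    unfolding on_left_def prod.case
  proof (rule functional_slices[OF local_operatorD[OF F] B])
    fix e assume "e \<in> {e. dX e = dX x + s}"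
    then have eq: "r - s - dX x = r - dX e" by simp
    show "(\<lambda>y. w (e, y)) \<in> B (r - s - dX x)" unfolding eq using w by (auto simp: total_def)
  next
    fix y show "scalar_valued (\<lambda>x. w (x, y))"
      using w subspace_scalar[OF sc] by (auto simp: total_def)
  qed
qed

lemma on_right_total:
  assumes G: "local_operator dY s G" and B: "\<And>n u. u \<in> B n \<Longrightarrow> G u \<in> B' (n - s)"
    and A: "\<And>n. function_subspace (A n)" and sc: "\<And>n. function_subspace (B n)"
    and w: "w \<in> total dX dY A B r"
  shows "on_right G w \<in> total dX dY A B' (r - s)"
  unfolding total_def
proof (intro CollectI conjI allI)
  fix x
  have "(\<lambda>y. w (x, y)) \<in> B (r - dX x)" using w by (auto simp: total_def)
  from B[OF this] show "(\<lambda>y. on_right G w (x, y)) \<in> B' (r - s - dX x)"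
    by (simp add: on_right_def algebra_simps)
next
  fix y
  let ?w = "\<lambda>(y, x). w (x, y)"
  have "(\<lambda>x. G (\<lambda>y'. ?w (y', x)) y) \<in> A (r - s - dY y)"
  proof (rule functional_slices[OF local_operatorD[OF G] A])
    fix e assume "e \<in> {e. dY e = dY y + s}"
    then have eq: "r - s - dY y = r - dY e" by simp
    show "(\<lambda>x. ?w (e, x)) \<in> A (r - s - dY y)" unfolding eq using w by (auto simp: total_def)
  next
    fix x show "scalar_valued (\<lambda>y. ?w (y, x))"
      using w subspace_scalar[OF sc] by (auto simp: total_def)
  qed
  then show "(\<lambda>x. on_right G w (x, y)) \<in> A (r - s - dY y)" by (simp add: on_right_def)
qed

lemma twist_total:
  assumes A: "\<And>n. function_subspace (A n)" and B: "\<And>n. function_subspace (B n)"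
    and degree: "\<And>n u x. u \<in> A n \<Longrightarrow> u x \<noteq> \<zero> \<Longrightarrow> dX x = n"
    and w: "w \<in> total dX dY A B r"
  shows "twist dX w \<in> total dX dY A B r"
  unfolding total_def
proof (intro CollectI conjI allI)
  fix x show "(\<lambda>y. twist dX w (x, y)) \<in> B (r - dX x)"
    unfolding twist_def prod.case using w by (intro subspace_smult[OF B]) (auto simp: total_def)
next
  fix y
  have wy: "(\<lambda>x. w (x, y)) \<in> A (r - dY y)" using w by (auto simp: total_def)
  have "(\<lambda>x. twist dX w (x, y)) = (\<lambda>x. ring_sign R (r - dY y) \<otimes> w (x, y))"
  proof
    fix x show "twist dX w (x, y) = ring_sign R (r - dY y) \<otimes> w (x, y)"
      using degree[OF wy, of x] by (cases "w (x, y) = \<zero>") (auto simp: twist_def)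
  qed
  also have "\<dots> \<in> A (r - dY y)" by (intro subspace_smult[OF A] wy) auto
  finally show "(\<lambda>x. twist dX w (x, y)) \<in> A (r - dY y)" .
qed

end

locale product_complex =
  X: contracted_complex R degX UX dX hX + Y: contracted_complex R degY UY dY hY
  for R :: "('a, 'b) ring_scheme" (structure) and degX :: "'i \<Rightarrow> int" and UX dX hX and degY :: "'j \<Rightarrow> int" and UY dY hY
begin

abbreviation "W \<equiv> X.total degX degY UX UY"
abbreviation "L \<equiv> on_left"
abbreviation "Rt \<equiv> on_right"
abbreviation "\<sigma> \<equiv> X.twist degX"

definition bd :: "('i \<times> 'j \<Rightarrow> 'a) \<Rightarrow> 'i \<times> 'j \<Rightarrow> 'a" where
  "bd w = (\<lambda>p. L dX w p \<oplus> \<sigma> (Rt dY w) p)"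

text \<open>
  The usual homotopy \<open>h \<otimes> 1 + \<pi> \<otimes> h\<close> for the composite of the contractions of the two factors, with
  the Koszul sign.
\<close>

definition contraction :: "('i \<times> 'j \<Rightarrow> 'a) \<Rightarrow> 'i \<times> 'j \<Rightarrow> 'a" where
  "contraction w = (\<lambda>p. L hX w p \<oplus> \<sigma> (L X.proj (Rt hY w)) p)"

definition Proj :: "('i \<times> 'j \<Rightarrow> 'a) \<Rightarrow> 'i \<times> 'j \<Rightarrow> 'a" where
  "Proj w = L X.proj (Rt Y.proj w)"

lemma W_subspace: "X.function_subspace (W r)"
  by (intro X.total_subspace X.U Y.U)

lemma W_scalar: "w \<in> W r \<Longrightarrow> X.scalar_valued w"
  by (rule X.subspace_scalar[OF W_subspace])

lemma W_slices:
  assumes "w \<in> W r"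
  shows "(\<lambda>x. w (x, y)) \<in> UX (r - degY y)" "(\<lambda>y. w (x, y)) \<in> UY (r - degX x)"
  using assms by (auto simp: X.total_def)

lemma L_d: "w \<in> W r \<Longrightarrow> L dX w \<in> W (r - 1)"
  and L_h: "w \<in> W r \<Longrightarrow> L hX w \<in> W (r + 1)"
  and L_proj: "w \<in> W r \<Longrightarrow> L X.proj w \<in> W r"
  and R_d: "w \<in> W r \<Longrightarrow> Rt dY w \<in> W (r - 1)"
  and R_h: "w \<in> W r \<Longrightarrow> Rt hY w \<in> W (r + 1)"
  and R_proj: "w \<in> W r \<Longrightarrow> Rt Y.proj w \<in> W r"
  and \<sigma>_in: "w \<in> W r \<Longrightarrow> \<sigma> w \<in> W r"
proof -
  note left = X.on_left_total[where dX = degX and A = UX and A' = UX and B = UY and dY = degY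
      and w = w and r = r, OF _ _ Y.U X.U]
  note right = X.on_right_total[where dY = degY and B = UY and B' = UY and A = UX and dX = degX
      and w = w and r = r, OF _ _ X.U Y.U]
  show "w \<in> W r \<Longrightarrow> L dX w \<in> W (r - 1)" by (rule left[OF X.d_local X.d_in])
  show "w \<in> W r \<Longrightarrow> L hX w \<in> W (r + 1)" using left[OF X.h_local] X.h_in by simp
  show "w \<in> W r \<Longrightarrow> L X.proj w \<in> W r" using left[OF X.proj_local] X.proj_in by simp
  show "w \<in> W r \<Longrightarrow> Rt dY w \<in> W (r - 1)" by (rule right[OF Y.d_local Y.d_in])
  show "w \<in> W r \<Longrightarrow> Rt hY w \<in> W (r + 1)" using right[OF Y.h_local] Y.h_in by simp
  show "w \<in> W r \<Longrightarrow> Rt Y.proj w \<in> W r" using right[OF Y.proj_local] Y.proj_in by simp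
  show "w \<in> W r \<Longrightarrow> \<sigma> w \<in> W r" by (rule X.twist_total[OF X.U Y.U X.degree])
qed

lemma bd_in: "w \<in> W r \<Longrightarrow> bd w \<in> W (r - 1)"
  unfolding bd_def by (intro X.subspace_add[OF W_subspace] L_d \<sigma>_in R_d)

lemma contraction_in: "w \<in> W r \<Longrightarrow> contraction w \<in> W (r + 1)"
  unfolding contraction_def by (intro X.subspace_add[OF W_subspace] L_h \<sigma>_in L_proj R_h)

lemma Proj_in:
  assumes w: "w \<in> W r"
  shows "Proj w \<in> X.total degX degY X.harmonic Y.harmonic r"
proof -
  have "Rt Y.proj w \<in> X.total degX degY UX Y.harmonic r"
    using X.on_right_total[where dY = degY and B = UY and B' = Y.harmonic and A = UX and dX = degX
      and w = w and r = r, OF Y.proj_local _ X.U Y.U w] Y.proj_harmonic by simp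
  then show ?thesis
    unfolding Proj_def
    using X.on_left_total[where dX = degX and A = UX and A' = X.harmonic and B = Y.harmonic and dY = degY
      and w = "Rt Y.proj w" and r = r, OF X.proj_local _ Y.harmonic_subspace X.U] X.proj_harmonic by simp
qed

lemma Proj_add:
  assumes v: "v \<in> W r" and w: "w \<in> W r"
  shows "Proj (\<lambda>i. v i \<oplus> w i) = (\<lambda>i. Proj v i \<oplus> Proj w i)"
  unfolding Proj_def X.on_right_add[OF Y.proj_local W_scalar[OF v] W_scalar[OF w]]
  by (rule X.on_left_add[OF X.proj_local W_scalar[OF R_proj[OF v]] W_scalar[OF R_proj[OF w]]])

lemma Proj_smult:
  assumes c: "c \<in> carrier R" and w: "w \<in> W r"
  shows "Proj (\<lambda>i. c \<otimes> w i) = (\<lambda>i. c \<otimes> Proj w i)"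
  unfolding Proj_def X.on_right_smult[OF Y.proj_local c W_scalar[OF w]]
  by (rule X.on_left_smult[OF X.proj_local c W_scalar[OF R_proj[OF w]]])

lemma L_d_proj: "w \<in> W r \<Longrightarrow> L dX (L X.proj w) = (\<lambda>p. \<zero>)"
  and L_proj_d: "w \<in> W r \<Longrightarrow> L X.proj (L dX w) = (\<lambda>p. \<zero>)"
  and R_proj_d: "w \<in> W r \<Longrightarrow> Rt Y.proj (Rt dY w) = (\<lambda>p. \<zero>)"
  using X.d_proj[OF W_slices(1)] X.proj_d[OF W_slices(1)] Y.proj_d[OF W_slices(2)]
  by (simp_all add: on_left_def on_right_def fun_eq_iff)

lemma commute:
  "X.local_operator degX s F \<Longrightarrow> X.local_operator degY s' G \<Longrightarrow> w \<in> W r \<Longrightarrow> L F (Rt G w) = Rt G (L F w)"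
  by (rule X.on_left_on_right) (auto intro: W_scalar)

lemma Proj_bd:
  assumes w: "w \<in> W r"
  shows "Proj (bd w) = (\<lambda>p. \<zero>)"
proof -
  have "Rt Y.proj (bd w) = (\<lambda>p. Rt Y.proj (L dX w) p \<oplus> Rt Y.proj (\<sigma> (Rt dY w)) p)"
    unfolding bd_def
    by (intro X.on_right_add[OF Y.proj_local] W_scalar[OF L_d[OF w]] W_scalar[OF \<sigma>_in[OF R_d[OF w]]])
  also have "Rt Y.proj (\<sigma> (Rt dY w)) = (\<lambda>p. \<zero>)"
    unfolding X.on_right_twist[OF Y.proj_local W_scalar[OF R_d[OF w]]] R_proj_d[OF w]
    by (auto simp: X.twist_def)
  also have "Rt Y.proj (L dX w) = L dX (Rt Y.proj w)"
    by (rule commute[OF X.d_local Y.proj_local w, symmetric])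
  finally have "Rt Y.proj (bd w) = L dX (Rt Y.proj w)"
    using X.subspace_closed[OF W_subspace L_d[OF R_proj[OF w]]] by simp
  then show ?thesis by (simp add: Proj_def L_proj_d[OF R_proj[OF w]])
qed

text \<open>
  The mixed term \<open>d \<pi> \<otimes> h\<close> vanishes, and twice the same sign cancels in \<open>\<pi> \<otimes> d h\<close>.
\<close>

lemma bd_contraction:
  assumes w: "w \<in> W r"
  shows "bd (contraction w) (x, y) =
    L dX (L hX w) (x, y) \<oplus> (ring_sign R (degX x) \<otimes> L hX (Rt dY w) (x, y) \<oplus> L X.proj (Rt dY (Rt hY w)) (x, y))"
proof -
  define v where "v = L X.proj (Rt hY w)"
  have v: "v \<in> W (r + 1)" unfolding v_def by (intro L_proj R_h w)
  note cl = X.subspace_closed[OF W_subspace]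
  have "L dX (contraction w) = (\<lambda>p. L dX (L hX w) p \<oplus> L dX (\<sigma> v) p)"
    unfolding contraction_def v_def[symmetric]
    by (intro X.on_left_add[OF X.d_local] W_scalar[OF L_h[OF w]] W_scalar[OF \<sigma>_in[OF v]])
  moreover have "L dX (\<sigma> v) (x, y) = \<zero>"
    using X.on_left_twist[OF X.d_local W_scalar[OF v], of x y] L_d_proj[OF R_h[OF w]]
    by (simp add: v_def)
  ultimately have 1: "L dX (contraction w) (x, y) = L dX (L hX w) (x, y)"
    using cl[OF L_d[OF L_h[OF w]]] by simp
  have "Rt dY (contraction w) = (\<lambda>p. Rt dY (L hX w) p \<oplus> Rt dY (\<sigma> v) p)"
    unfolding contraction_def v_def[symmetric]
    by (intro X.on_right_add[OF Y.d_local] W_scalar[OF L_h[OF w]] W_scalar[OF \<sigma>_in[OF v]])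
  also have "Rt dY (\<sigma> v) = \<sigma> (Rt dY v)" by (rule X.on_right_twist[OF Y.d_local W_scalar[OF v]])
  also have "Rt dY (L hX w) = L hX (Rt dY w)" by (rule commute[OF X.h_local Y.d_local w, symmetric])
  also have "Rt dY v = L X.proj (Rt dY (Rt hY w))"
    unfolding v_def by (rule commute[OF X.proj_local Y.d_local R_h[OF w], symmetric])
  finally have 2: "\<sigma> (Rt dY (contraction w)) (x, y) =
      ring_sign R (degX x) \<otimes> L hX (Rt dY w) (x, y) \<oplus> L X.proj (Rt dY (Rt hY w)) (x, y)"
    using cl[OF L_h[OF R_d[OF w]]] cl[OF L_proj[OF R_d[OF R_h[OF w]]]]
    by (simp add: X.twist_def X.r_distr X.ring_sign_square)
  show ?thesis by (simp add: bd_def[of "contraction w"] 1 2)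
qed

text \<open>
  The term \<open>\<pi> d \<otimes> h\<close> vanishes.  The term \<open>h \<otimes> d\<close> has the opposite sign of the one in \<open>bd_contraction\<close>,
  because \<open>h\<close> changes the degree of the first factor by one.
\<close>

lemma contraction_bd:
  assumes w: "w \<in> W r"
  shows "contraction (bd w) (x, y) =
    (L hX (L dX w) (x, y) \<ominus> ring_sign R (degX x) \<otimes> L hX (Rt dY w) (x, y)) \<oplus> L X.proj (Rt hY (Rt dY w)) (x, y)"
proof -
  note cl = X.subspace_closed[OF W_subspace]
  have "L hX (bd w) = (\<lambda>p. L hX (L dX w) p \<oplus> L hX (\<sigma> (Rt dY w)) p)"
    unfolding bd_def
    by (intro X.on_left_add[OF X.h_local] W_scalar[OF L_d[OF w]] W_scalar[OF \<sigma>_in[OF R_d[OF w]]])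
  moreover have "L hX (\<sigma> (Rt dY w)) (x, y) = \<ominus> (ring_sign R (degX x) \<otimes> L hX (Rt dY w) (x, y))"
    using X.on_left_twist[OF X.h_local W_scalar[OF R_d[OF w]], of x y] cl[OF L_h[OF R_d[OF w]]]
    by (simp add: X.ring_sign_diff1 X.l_minus)
  ultimately have 1: "L hX (bd w) (x, y) =
      L hX (L dX w) (x, y) \<ominus> ring_sign R (degX x) \<otimes> L hX (Rt dY w) (x, y)"
    by (simp add: a_minus_def)
  have "Rt hY (bd w) = (\<lambda>p. Rt hY (L dX w) p \<oplus> Rt hY (\<sigma> (Rt dY w)) p)"
    unfolding bd_def
    by (intro X.on_right_add[OF Y.h_local] W_scalar[OF L_d[OF w]] W_scalar[OF \<sigma>_in[OF R_d[OF w]]])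
  also have "Rt hY (\<sigma> (Rt dY w)) = \<sigma> (Rt hY (Rt dY w))"
    by (rule X.on_right_twist[OF Y.h_local W_scalar[OF R_d[OF w]]])
  also have "Rt hY (L dX w) = L dX (Rt hY w)" by (rule commute[OF X.d_local Y.h_local w, symmetric])
  finally have "L X.proj (Rt hY (bd w)) =
      (\<lambda>p. L X.proj (L dX (Rt hY w)) p \<oplus> L X.proj (\<sigma> (Rt hY (Rt dY w))) p)"
    by (simp add: X.on_left_add[OF X.proj_local W_scalar[OF L_d[OF R_h[OF w]]]
        W_scalar[OF \<sigma>_in[OF R_h[OF R_d[OF w]]]]])
  moreover have "L X.proj (\<sigma> (Rt hY (Rt dY w))) (x, y) =
      ring_sign R (degX x) \<otimes> L X.proj (Rt hY (Rt dY w)) (x, y)"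
    using X.on_left_twist[OF X.proj_local W_scalar[OF R_h[OF R_d[OF w]]], of x y] by simp
  ultimately have 2: "\<sigma> (L X.proj (Rt hY (bd w))) (x, y) = L X.proj (Rt hY (Rt dY w)) (x, y)"
    using cl[OF L_proj[OF R_h[OF R_d[OF w]]]]
    by (simp add: X.twist_def L_proj_d[OF R_h[OF w]] X.ring_sign_square)
  show ?thesis by (simp add: contraction_def[of "bd w"] 1 2)
qed

text \<open>
  What remains of \<open>d H + H d\<close> is \<open>(d h + h d) \<otimes> 1 + \<pi> \<otimes> (d h + h d)\<close>, that is,
  \<open>(1 - \<pi>) \<otimes> 1 + \<pi> \<otimes> (1 - \<pi>) = 1 - \<pi> \<otimes> \<pi>\<close>.
\<close>

lemma homotopy:
  assumes w: "w \<in> W r"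
  shows "bd (contraction w) p \<oplus> contraction (bd w) p \<oplus> Proj w p = w p"
proof -
  obtain x y where p: "p = (x, y)" by force
  note cl = X.subspace_closed[OF W_subspace]
  let ?q = "ring_sign R (degX x) \<otimes> L hX (Rt dY w) (x, y)"
  let ?a = "L dX (L hX w) (x, y)" and ?b = "L hX (L dX w) (x, y)"
    and ?c = "L X.proj (Rt dY (Rt hY w)) (x, y)" and ?d = "L X.proj (Rt hY (Rt dY w)) (x, y)"
  have in1: "Rt dY (Rt hY w) \<in> W r" "Rt hY (Rt dY w) \<in> W r" "L dX (L hX w) \<in> W r" "L hX (L dX w) \<in> W r"
    using R_d[OF R_h[OF w]] R_h[OF R_d[OF w]] L_d[OF L_h[OF w]] L_h[OF L_d[OF w]] by simp_all
  have c: "?q \<in> carrier R" "?a \<in> carrier R" "?b \<in> carrier R" "?c \<in> carrier R" "?d \<in> carrier R"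
    "Proj w (x, y) \<in> carrier R" "L X.proj w (x, y) \<in> carrier R"
    using in1 cl[OF L_h[OF R_d[OF w]]] cl[OF L_proj] cl[OF in1(3)] cl[OF in1(4)] cl[OF L_proj[OF R_proj[OF w]]] w
    by (auto simp: Proj_def)
  have 1: "?a \<oplus> ?b \<oplus> L X.proj w (x, y) = w (x, y)"
    using X.split[OF W_slices(1)[OF w, of y], of x] by (simp add: on_left_def)
  have weq: "w = (\<lambda>p. (Rt dY (Rt hY w) p \<oplus> Rt hY (Rt dY w) p) \<oplus> Rt Y.proj w p)"
  proof
    fix p :: "'i \<times> 'j" obtain x y where p: "p = (x, y)" by force
    show "w p = (Rt dY (Rt hY w) p \<oplus> Rt hY (Rt dY w) p) \<oplus> Rt Y.proj w p"
      using Y.split[OF W_slices(2)[OF w, of x], of y] by (simp add: on_right_def p)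
  qed
  have "L X.proj w = L X.proj (\<lambda>p. (Rt dY (Rt hY w) p \<oplus> Rt hY (Rt dY w) p) \<oplus> Rt Y.proj w p)"
    by (rule arg_cong[OF weq])
  also have "\<dots> = (\<lambda>p. L X.proj (\<lambda>p. Rt dY (Rt hY w) p \<oplus> Rt hY (Rt dY w) p) p \<oplus> Proj w p)"
    unfolding Proj_def
    by (intro X.on_left_add[OF X.proj_local] W_scalar[OF X.subspace_add[OF W_subspace in1(1,2)]]
        W_scalar[OF R_proj[OF w]])
  also have "L X.proj (\<lambda>p. Rt dY (Rt hY w) p \<oplus> Rt hY (Rt dY w) p) =
      (\<lambda>p. L X.proj (Rt dY (Rt hY w)) p \<oplus> L X.proj (Rt hY (Rt dY w)) p)"
    by (intro X.on_left_add[OF X.proj_local] W_scalar[OF in1(1)] W_scalar[OF in1(2)])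
  finally have 2: "L X.proj w (x, y) = ?c \<oplus> ?d \<oplus> Proj w (x, y)" by simp
  have "bd (contraction w) (x, y) \<oplus> contraction (bd w) (x, y) \<oplus> Proj w (x, y) =
      ?a \<oplus> (?q \<oplus> ?c) \<oplus> ((?b \<ominus> ?q) \<oplus> ?d) \<oplus> Proj w (x, y)"
    by (simp add: bd_contraction[OF w] contraction_bd[OF w])
  also have "\<dots> = ?a \<oplus> ?b \<oplus> (?c \<oplus> ?d \<oplus> Proj w (x, y)) \<oplus> (?q \<ominus> ?q)"
    using c by (simp add: a_minus_def X.a_ac)
  also have "\<dots> = w (x, y)"
    using 1 c X.subspace_closed[OF W_subspace w, of "(x, y)"] by (simp add: 2[symmetric])
  finally show ?thesis by (simp add: p)
qed

text \<open>
  The homotopy formula reduces to \<open>w = d (H w)\<close>.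
\<close>

lemma exact:
  assumes w: "w \<in> W r" and "bd w = (\<lambda>p. \<zero>)" "Proj w = (\<lambda>p. \<zero>)"
  shows "w \<in> bd ` W (r + 1)"
proof (rule image_eqI[OF _ contraction_in[OF w]])
  have "contraction (\<lambda>p. \<zero>) = (\<lambda>p. \<zero>)"
    by (auto simp: contraction_def X.on_left_zero[OF X.h_local] X.on_left_zero[OF X.proj_local]
        X.on_right_zero[OF Y.h_local] X.twist_def)
  then show "w = bd (contraction w)"
    using homotopy[OF w] X.subspace_closed[OF W_subspace bd_in[OF contraction_in[OF w]]] assms(2,3)
    by auto
qed

lemma harmonic_total:
  assumes w: "w \<in> X.total degX degY X.harmonic Y.harmonic r"
  shows "w \<in> W r" "Proj w = w" "bd w = (\<lambda>p. \<zero>)"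
proof -
  have sl: "(\<lambda>x. w (x, y)) \<in> X.harmonic (r - degY y)" "(\<lambda>y. w (x, y)) \<in> Y.harmonic (r - degX x)" for x y
    using w by (auto simp: X.total_def)
  show "w \<in> W r" using sl X.harmonic_U Y.harmonic_U by (auto simp: X.total_def)
  have "Rt Y.proj w = w" "L X.proj w = w"
    using sl by (auto simp: on_right_def on_left_def X.harmonic_def Y.harmonic_def)
  then show "Proj w = w" by (simp add: Proj_def)
  have "L dX w = (\<lambda>p. \<zero>)" "Rt dY w = (\<lambda>p. \<zero>)"
    using X.d_harmonic[OF sl(1)] Y.d_harmonic[OF sl(2)] by (auto simp: on_right_def on_left_def)
  then show "bd w = (\<lambda>p. \<zero>)" by (auto simp: bd_def X.twist_def)
qed

end

section \<open>Sums of tensor products of graded spaces\<close>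

context field
begin

text \<open>
  Linearity of the boundary and \<open>d d = 0\<close> are transported back along the injective maps \<open>\<phi>\<close>.
\<close>

lemma chain_complex_by_iso:
  fixes C :: "('a, 'c) graded_complex" and D :: "('a, 'd) graded_complex"
  assumes D: "chain_complex R D"
    and iso: "\<And>n. linear_iso R (chains C n) (chains D n) (\<phi> n)"
    and cl: "\<And>n x. x \<in> carrier (chains C n) \<Longrightarrow> bdry C n x \<in> carrier (chains C (n - 1))"
    and comm: "\<And>n x. x \<in> carrier (chains C n) \<Longrightarrow> \<phi> (n - 1) (bdry C n x) = bdry D n (\<phi> n x)"
  shows "chain_complex R C"
proof (rule chain_complex.intro)
  have lin: "linear_map R (chains C n) (chains D n) (\<phi> n)" and inj: "inj_on (\<phi> n) (carrier (chains C n))"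
    for n using iso[of n] by (auto simp: linear_iso_def bij_betw_def)
  have bd: "linear_map R (chains D n) (chains D (n - 1)) (bdry D n)"
    and bb: "x \<in> carrier (chains D n) \<Longrightarrow> bdry D (n - 1) (bdry D n x) = \<zero>\<^bsub>chains D (n - 2)\<^esub>" for n x
    using D by (auto simp: chain_complex_def)
  have vsM: "module R (chains C n)" for n
    using linear_map_vs1[OF lin[of n]] by (simp add: vectorspace_def)
  have add_cl: "x \<oplus>\<^bsub>chains C n\<^esub> y \<in> carrier (chains C n)"
    if "x \<in> carrier (chains C n)" "y \<in> carrier (chains C n)" for x y n
    using vsM[of n] that by (auto simp: module_def abelian_group_def intro: abelian_monoid.a_closed)
  have smult_cl: "c \<odot>\<^bsub>chains C n\<^esub> x \<in> carrier (chains C n)"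
    if "c \<in> carrier R" "x \<in> carrier (chains C n)" for c x n
    using module.smult_closed[OF vsM] that .
  have zero_cl: "\<zero>\<^bsub>chains C n\<^esub> \<in> carrier (chains C n)" for n
    using vsM[of n] by (auto simp: module_def abelian_group_def intro: abelian_monoid.zero_closed)
  fix n
  note l1 = linear_map_add[OF lin] linear_map_smult[OF lin] linear_map_closed[OF lin]
    linear_map_add[OF bd] linear_map_smult[OF bd]
  show "linear_map R (chains C n) (chains C (n - 1)) (bdry C n)"
  proof (rule linear_mapI[OF linear_map_vs1[OF lin] linear_map_vs1[OF lin] cl])
    fix x y assume xy: "x \<in> carrier (chains C n)" "y \<in> carrier (chains C n)"
    show "bdry C n (x \<oplus>\<^bsub>chains C n\<^esub> y) = bdry C n x \<oplus>\<^bsub>chains C (n - 1)\<^esub> bdry C n y"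
      using xy by (intro inj_onD[OF inj[of "n - 1"]]) (simp_all add: comm cl add_cl l1)
  next
    fix c x assume cx: "c \<in> carrier R" "x \<in> carrier (chains C n)"
    show "bdry C n (c \<odot>\<^bsub>chains C n\<^esub> x) = c \<odot>\<^bsub>chains C (n - 1)\<^esub> bdry C n x"
      using cx by (intro inj_onD[OF inj[of "n - 1"]]) (simp_all add: comm cl smult_cl l1)
  qed
  fix x assume x: "x \<in> carrier (chains C n)"
  have cl2: "bdry C (n - 1) (bdry C n x) \<in> carrier (chains C (n - 2))"
    using cl[OF cl[OF x]] by simp
  have "\<phi> (n - 2) (bdry C (n - 1) (bdry C n x)) = bdry D (n - 1) (bdry D n (\<phi> n x))"
    using comm[OF cl[OF x]] comm[OF x] by simp
  also have "\<dots> = \<phi> (n - 2) \<zero>\<^bsub>chains C (n - 2)\<^esub>"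
    using bb[OF linear_map_closed[OF lin x]] linear_map_zero[OF lin[of "n - 2"]] by simp
  finally show "bdry C (n - 1) (bdry C n x) = \<zero>\<^bsub>chains C (n - 2)\<^esub>"
    using inj_onD[OF inj _ cl2 zero_cl] by blast
qed

text \<open>
  The matrices of the components of a family of tensors have disjoint supports, given by the degrees
  of rows and columns, and are glued to one matrix.  The offset \<open>a\<close> allows to index the first factor
  by a degree different from \<open>degX\<close>.
\<close>

definition assemble :: "('i \<Rightarrow> int) \<Rightarrow> ('j \<Rightarrow> int) \<Rightarrow> (int \<Rightarrow> 'c \<Rightarrow> 'i \<Rightarrow> 'a) \<Rightarrow> (int \<Rightarrow> 'd \<Rightarrow> 'j \<Rightarrow> 'a) \<Rightarrow>
    (int \<times> int) set \<Rightarrow> int \<Rightarrow> (int \<times> int \<Rightarrow> ('c \<times> 'd \<Rightarrow> 'a) set) \<Rightarrow> 'i \<times> 'j \<Rightarrow> 'a" where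
  "assemble degX degY \<alpha> \<beta> I a = glue I (\<lambda>(p, q). matrix_tensor.to_matrix R (\<alpha> p) (\<beta> q))
     (\<lambda>(x, y). (degX x - a, degY y))"

lemma assemble_eq: "assemble degX degY \<alpha> \<beta> I a t (x, y) = (if (degX x - a, degY y) \<in> I
    then matrix_tensor.to_matrix R (\<alpha> (degX x - a)) (\<beta> (degY y)) (t (degX x - a, degY y)) (x, y) else \<zero>)"
  by (simp add: assemble_def glue_def)

context
  fixes degX :: "'i \<Rightarrow> int" and degY :: "'j \<Rightarrow> int" and A B
    and M :: "int \<Rightarrow> ('a, 'c) module" and N :: "int \<Rightarrow> ('a, 'd) module" and \<alpha> \<beta> I and a r :: int
  assumes A: "\<And>n. function_subspace (A n)" and B: "\<And>n. function_subspace (B n)"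
    and degA: "\<And>n u x. u \<in> A n \<Longrightarrow> u x \<noteq> \<zero> \<Longrightarrow> degX x = n"
    and degB: "\<And>n u y. u \<in> B n \<Longrightarrow> u y \<noteq> \<zero> \<Longrightarrow> degY y = n"
    and lowA: "\<And>n u. n < 0 \<Longrightarrow> u \<in> A n \<Longrightarrow> u = (\<lambda>x. \<zero>)"
    and lowB: "\<And>n u. n < - 1 \<Longrightarrow> u \<in> B n \<Longrightarrow> u = (\<lambda>x. \<zero>)"
    and finA: "\<And>n. \<exists>S. finite S \<and> (\<forall>u\<in>A n. \<forall>x. u x \<noteq> \<zero> \<longrightarrow> x \<in> S)"
    and \<alpha>: "\<And>p q. (p, q) \<in> I \<Longrightarrow> linear_iso R (M p) (function_space (A (p + a))) (\<alpha> p)"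
    and \<beta>: "\<And>p q. (p, q) \<in> I \<Longrightarrow> linear_iso R (N q) (function_space (B q)) (\<beta> q)"
    and I: "\<And>p q. (p, q) \<in> I \<Longrightarrow> p + a + q = r"
    and not_I: "\<And>p q. (p, q) \<notin> I \<Longrightarrow> p + a + q = r \<Longrightarrow>
      (\<forall>u\<in>A (p + a). u = (\<lambda>x. \<zero>)) \<or> (\<forall>v\<in>B q. v = (\<lambda>y. \<zero>))"
begin

lemma matrix_tensor_exists: "(p, q) \<in> I \<Longrightarrow> \<exists>D b. matrix_tensor R (M p) (N q) (\<alpha> p) (\<beta> q) (A (p + a)) (B q) D b"
proof -
  assume pq: "(p, q) \<in> I"
  obtain S where "finite S" "\<forall>u\<in>A (p + a). \<forall>x. u x \<noteq> \<zero> \<longrightarrow> x \<in> S" using finA by blast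
  then obtain D b where "echelon_basis (A (p + a)) D b" using echelon_basis_exists[OF _ A] by blast
  then show ?thesis
    using A B \<alpha>[OF pq] \<beta>[OF pq] field_axioms
    by (auto simp: matrix_tensor_def matrix_tensor_axioms_def)
qed

abbreviation "summand \<equiv> \<lambda>(p, q). tensor_product R (M p) (N q)"
abbreviation "block \<equiv> \<lambda>(p, q). matrices (A (p + a)) (B q)"

text \<open>
  A matrix of total degree \<open>r\<close> is determined by its blocks, and a block at an index outside of \<open>I\<close>
  vanishes because one of its two spaces is zero.
\<close>

lemma
  shows direct_sum_tensor_iso:
      "linear_iso R (direct_sum_space I summand) (function_space (total degX degY A B r)) (assemble degX degY \<alpha> \<beta> I a)"
    and direct_sum_tensor_carrier: "carrier (direct_sum_space I summand) = (\<Pi>\<^sub>E k\<in>I. carrier (summand k))"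
proof -
  let ?\<kappa> = "\<lambda>(x, y). (degX x - a, degY y)"
  let ?g = "\<lambda>(p, q). matrix_tensor.to_matrix R (\<alpha> p) (\<beta> q)"
  let ?J = "{- a..r + 1 - a} \<times> {- 1..r}"
  have block_zero: "w = (\<lambda>c. \<zero>)" if w: "w \<in> matrices (A p) (B q)"
    and z: "(\<forall>u\<in>A p. u = (\<lambda>x. \<zero>)) \<or> (\<forall>v\<in>B q. v = (\<lambda>y. \<zero>))" for w p q
  proof
    fix c :: "'i \<times> 'j" obtain x y where c: "c = (x, y)" by force
    have "(\<lambda>x. w (x, y)) \<in> A p" "(\<lambda>y. w (x, y)) \<in> B q" using w by (auto simp: matrices_def)
    then have "(\<lambda>x. w (x, y)) = (\<lambda>x. \<zero>) \<or> (\<lambda>y. w (x, y)) = (\<lambda>y. \<zero>)" using z by blast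
    then show "w c = \<zero>" unfolding c by (metis (full_types))
  qed
  have 1: "function_subspace (block k)" if "k \<in> I" for k
    using A B by (cases k) (auto intro: matrices_subspace)
  have 2: "linear_iso R (summand k) (function_space (block k)) (?g k)" if k: "k \<in> I" for k
  proof -
    obtain p q where pq: "k = (p, q)" by force
    then obtain D b where "matrix_tensor R (M p) (N q) (\<alpha> p) (\<beta> q) (A (p + a)) (B q) D b"
      using matrix_tensor_exists k by blast
    then show ?thesis using matrix_tensor.to_matrix_iso pq by fastforce
  qed
  have 3: "?\<kappa> c = k" if "k \<in> I" "w \<in> block k" "w c \<noteq> \<zero>" for k w c
  proof -
    obtain p q x y where pq: "k = (p, q)" "c = (x, y)" by (metis surj_pair)
    have "(\<lambda>x. w (x, y)) \<in> A (p + a)" "(\<lambda>y. w (x, y)) \<in> B q" using that pq by (auto simp: matrices_def)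
    then have "degX x = p + a" "degY y = q" using degA degB that(3) pq by blast+
    then show ?thesis using pq by simp
  qed
  have 4: "finite ?J" by simp
  have 5: "w = (\<lambda>c. \<zero>)" if k: "k \<in> I" "k \<notin> ?J" "w \<in> block k" for k w
  proof -
    obtain p q where pq: "k = (p, q)" by force
    then have "p + a < 0 \<or> q < - 1" using I[of p q] k by auto
    then show ?thesis using block_zero[of w "p + a" q] lowA lowB k pq by auto
  qed
  note ctx = 1 2 3 4 5
  show "carrier (direct_sum_space I summand) = (\<Pi>\<^sub>E k\<in>I. carrier (summand k))"
    by (rule direct_sum_carrier[where W = block and g = ?g and \<kappa> = ?\<kappa> and J = ?J]) (fact ctx)+
  have "glued I block ?\<kappa> = total degX degY A B r"
  proof (intro equalityI subsetI)
    fix w assume w: "w \<in> glued I block ?\<kappa>"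
    have w1: "(degX x - a, degY y) \<in> I" if "w (x, y) \<noteq> \<zero>" for x y using w that by (auto simp: glued_def)
    have w2: "(\<lambda>c. if ?\<kappa> c = k then w c else \<zero>) \<in> block k" if "k \<in> I" for k
      using w that by (simp add: glued_def)
    show "w \<in> total degX degY A B r"
      unfolding total_def
    proof (intro CollectI conjI allI)
      fix y
      show "(\<lambda>x. w (x, y)) \<in> A (r - degY y)"
      proof (cases "(r - degY y - a, degY y) \<in> I")
        case True
        have "\<forall>y'. (\<lambda>x. if ?\<kappa> (x, y') = (r - degY y - a, degY y) then w (x, y') else \<zero>) \<in> A (r - degY y)"
          using w2[OF True] by (simp add: matrices_def)
        from this[THEN spec, of y]
        have "(\<lambda>x. if (degX x - a, degY y) = (r - degY y - a, degY y) then w (x, y) else \<zero>) \<in> A (r - degY y)"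
          by simp
        also have "(\<lambda>x. if (degX x - a, degY y) = (r - degY y - a, degY y) then w (x, y) else \<zero>) = (\<lambda>x. w (x, y))"
        proof
          fix x
          have "w (x, y) = \<zero>" if "degX x \<noteq> r - degY y" using w1[of x y] I[of "degX x - a" "degY y"] that by auto
          then show "(if (degX x - a, degY y) = (r - degY y - a, degY y) then w (x, y) else \<zero>) = w (x, y)" by auto
        qed
        finally show ?thesis .
      next
        case False
        have "w (x, y) = \<zero>" for x
        proof (rule ccontr)
          assume "w (x, y) \<noteq> \<zero>"
          from w1[OF this] I[OF w1[OF this]] have "(degX x - a, degY y) \<in> I" "degX x + degY y = r" by auto
          moreover from this(2) have "r - degY y - a = degX x - a" by auto
          ultimately show False using False by simp
        qed
        then show ?thesis using subspace_zero[OF A] by simp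
      qed
    next
      fix x
      show "(\<lambda>y. w (x, y)) \<in> B (r - degX x)"
      proof (cases "(degX x - a, r - degX x) \<in> I")
        case True
        have "\<forall>x'. (\<lambda>y. if ?\<kappa> (x', y) = (degX x - a, r - degX x) then w (x', y) else \<zero>) \<in> B (r - degX x)"
          using w2[OF True] by (simp add: matrices_def)
        from this[THEN spec, of x]
        have "(\<lambda>y. if (degX x - a, degY y) = (degX x - a, r - degX x) then w (x, y) else \<zero>) \<in> B (r - degX x)"
          by simp
        also have "(\<lambda>y. if (degX x - a, degY y) = (degX x - a, r - degX x) then w (x, y) else \<zero>) = (\<lambda>y. w (x, y))"
        proof
          fix y
          have "w (x, y) = \<zero>" if "degY y \<noteq> r - degX x" using w1[of x y] I[of "degX x - a" "degY y"] that by auto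
          then show "(if (degX x - a, degY y) = (degX x - a, r - degX x) then w (x, y) else \<zero>) = w (x, y)" by auto
        qed
        finally show ?thesis .
      next
        case False
        have "w (x, y) = \<zero>" for y
        proof (rule ccontr)
          assume "w (x, y) \<noteq> \<zero>"
          from w1[OF this] I[OF w1[OF this]] have "(degX x - a, degY y) \<in> I" "degX x + degY y = r" by auto
          moreover from this(2) have "r - degX x = degY y" by auto
          ultimately show False using False by simp
        qed
        then show ?thesis using subspace_zero[OF B] by simp
      qed
    qed
  next
    fix w assume w: "w \<in> total degX degY A B r"
    have sl: "(\<lambda>x. w (x, y)) \<in> A (r - degY y)" "(\<lambda>y. w (x, y)) \<in> B (r - degX x)" for x y
      using w by (auto simp: total_def)
    have "(degX x - a, degY y) \<in> I" if nz: "w (x, y) \<noteq> \<zero>" for x y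
    proof (rule ccontr)
      assume "(degX x - a, degY y) \<notin> I"
      moreover have d: "degX x = r - degY y" using degA[OF sl(1) nz] .
      ultimately have "(\<forall>u\<in>A (degX x). u = (\<lambda>x. \<zero>)) \<or> (\<forall>v\<in>B (degY y). v = (\<lambda>y. \<zero>))"
        using not_I[of "degX x - a" "degY y"] by simp
      moreover have "(\<lambda>x. w (x, y)) \<in> A (degX x)" "(\<lambda>y. w (x, y)) \<in> B (degY y)"
        using sl(1)[of y] sl(2)[of x] d by auto
      ultimately show False using nz by (metis (full_types))
    qed
    moreover have "(\<lambda>c. if ?\<kappa> c = k then w c else \<zero>) \<in> block k" if k: "k \<in> I" for k
    proof -
      obtain p q where pq: "k = (p, q)" by force
      have r: "p + a + q = r" using I k pq by blast
      have "(\<lambda>x. if degX x - a = p \<and> degY y = q then w (x, y) else \<zero>) \<in> A (p + a)" for y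
      proof (cases "degY y = q")
        case True
        have "(\<lambda>x. if degX x - a = p \<and> degY y = q then w (x, y) else \<zero>) = (\<lambda>x. w (x, y))"
        proof
          fix x show "(if degX x - a = p \<and> degY y = q then w (x, y) else \<zero>) = w (x, y)"
            using degA[OF sl(1)[of y], of x] True r by (cases "w (x, y) = \<zero>") auto
        qed
        moreover have "r - degY y = p + a" using True r by simp
        ultimately show ?thesis using sl(1)[of y] by simp
      qed (simp add: subspace_zero[OF A])
      moreover have "(\<lambda>y. if degX x - a = p \<and> degY y = q then w (x, y) else \<zero>) \<in> B q" for x
      proof (cases "degX x - a = p")
        case True
        have "(\<lambda>y. if degX x - a = p \<and> degY y = q then w (x, y) else \<zero>) = (\<lambda>y. w (x, y))"
        proof
          fix y show "(if degX x - a = p \<and> degY y = q then w (x, y) else \<zero>) = w (x, y)"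
            using degB[OF sl(2)[of x], of y] True r by (cases "w (x, y) = \<zero>") auto
        qed
        moreover have "r - degX x = q" using True r by simp
        ultimately show ?thesis using sl(2)[of x] by simp
      qed (simp add: subspace_zero[OF B])
      ultimately show ?thesis by (simp add: pq matrices_def)
    qed
    ultimately show "w \<in> glued I block ?\<kappa>" by (auto simp: glued_def)
  qed
  moreover have "linear_iso R (direct_sum_space I summand) (function_space (glued I block ?\<kappa>)) (glue I ?g ?\<kappa>)"
    by (rule glue_iso[where J = ?J]) (fact ctx)+
  ultimately show "linear_iso R (direct_sum_space I summand) (function_space (total degX degY A B r)) (assemble degX degY \<alpha> \<beta> I a)"
    by (simp add: assemble_def)
qed

end

end

section \<open>The boundary of a path\<close>

lemma length_remove_nth: "q < length x \<Longrightarrow> length (remove_nth q x) = length x - 1"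
  by (simp add: remove_nth_def)

lemma set_remove_nth: "set (remove_nth q x) \<subseteq> set x"
  using set_take_subset set_drop_subset by (fastforce simp: remove_nth_def)

lemma remove_nth_Cons [simp]:
  "remove_nth 0 (a # x) = x" "remove_nth (Suc q) (a # x) = a # remove_nth q x"
  by (simp_all add: remove_nth_def)

lemma remove_nth_append:
  "remove_nth q (x @ y) = (if q < length x then remove_nth q x @ y else x @ remove_nth (q - length x) y)"
  by (auto simp: remove_nth_def Suc_diff_le)

lemma disjoint_append_eq:
  assumes "X \<inter> Y = {}" "set x \<subseteq> X" "set x' \<subseteq> X" "set y \<subseteq> Y" "set y' \<subseteq> Y"
  shows "x @ y = x' @ y' \<longleftrightarrow> x = x' \<and> y = y'"
proof
  assume eq: "x @ y = x' @ y'"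
  have "takeWhile (\<lambda>a. a \<in> X) (x @ y) = x" "takeWhile (\<lambda>a. a \<in> X) (x' @ y') = x'"
    "dropWhile (\<lambda>a. a \<in> X) (x @ y) = y" "dropWhile (\<lambda>a. a \<in> X) (x' @ y') = y'"
    using assms by (subst takeWhile_append2 dropWhile_append2; cases y; cases y'; force)+
  then show "x = x' \<and> y = y'" using eq by metis
qed auto

lemma distinct_adj_disjoint_append:
  assumes "X \<inter> Y = {}" "set x \<subseteq> X" "set y \<subseteq> Y"
  shows "distinct_adj (x @ y) \<longleftrightarrow> distinct_adj x \<and> distinct_adj y"
proof -
  have "last x \<noteq> hd y" if "x \<noteq> []" "y \<noteq> []"
    using assms last_in_set[OF that(1)] hd_in_set[OF that(2)] by (metis disjoint_iff subset_iff)
  then show ?thesis by (auto simp: distinct_adj_append_iff)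
qed

definition paths :: "'v set \<Rightarrow> nat \<Rightarrow> 'v list set" where
  "paths V n = {x. set x \<subseteq> V \<and> length x = n}"

lemma finite_paths: "finite V \<Longrightarrow> finite (paths V n)"
  unfolding paths_def by (rule finite_lists_length_eq)

context field
begin

lemma path_boundary_term [simp]:
  "ring_sign R p \<otimes> (if Q then basis_vec R x y else \<zero>) \<in> carrier R"
  by (auto simp: ring_sign_def)

lemma path_boundary_closed [simp]: "path_boundary R x z \<in> carrier R"
  unfolding path_boundary_def by (auto intro!: finsum_closed)

lemma path_boundary_nonzero:
  assumes "path_boundary R x z \<noteq> \<zero>"
  obtains q where "q < length x" "z = remove_nth q x" "distinct_adj z"
proof -
  have "\<exists>q<length x. z = remove_nth q x \<and> distinct_adj z"
  proof (rule ccontr)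
    assume "\<not> ?thesis"
    then have "path_boundary R x z = \<zero>"
      unfolding path_boundary_def by (intro add.finprod_one_eqI) (auto simp: basis_vec_def)
    with assms show False by simp
  qed
  then show thesis using that by blast
qed

lemma path_boundary_nonzeroD:
  assumes "path_boundary R x z \<noteq> \<zero>"
  shows "length x = Suc (length z)" "set z \<subseteq> set x" "distinct_adj z"
proof -
  obtain q where q: "q < length x" "z = remove_nth q x" "distinct_adj z"
    using path_boundary_nonzero[OF assms] .
  show "length x = Suc (length z)" using q(1) length_remove_nth[OF q(1)] by (simp add: q(2))
  show "set z \<subseteq> set x" unfolding q(2) by (rule set_remove_nth)
  show "distinct_adj z" by (rule q(3))
qed

lemma path_boundary_Nil: "path_boundary R [] z = \<zero>"
  by (simp add: path_boundary_def)

text \<open>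
  Deleting the first vertex \<open>a\<close> leaves \<open>x\<close>; deleting any other vertex keeps \<open>a\<close> in front and changes
  the sign.  The resulting path is dropped when it is not regular, which can also happen because a
  vertex equal to \<open>a\<close> moves next to \<open>a\<close>.
\<close>

lemma path_boundary_Cons:
  "path_boundary R (a # x) z = (if distinct_adj x \<and> z = x then \<one> else \<zero>) \<ominus>
     (case z of [] \<Rightarrow> \<zero> | b # z' \<Rightarrow> if b = a \<and> distinct_adj z then path_boundary R x z' else \<zero>)"
proof -
  let ?t = "\<lambda>y z q. ring_sign R (int q) \<otimes>
      (if distinct_adj (remove_nth q y) then basis_vec R (remove_nth q y) z else \<zero>)"
  have "path_boundary R (a # x) z = ?t (a # x) z 0 \<oplus> (\<Oplus>q\<in>Suc ` {..<length x}. ?t (a # x) z q)"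
    unfolding path_boundary_def length_Cons lessThan_Suc_eq_insert_0
    by (rule finsum_insert) auto
  also have "?t (a # x) z 0 = (if distinct_adj x \<and> z = x then \<one> else \<zero>)"
    by (auto simp: ring_sign_def basis_vec_def)
  also have "(\<Oplus>q\<in>Suc ` {..<length x}. ?t (a # x) z q) = (\<Oplus>q\<in>{..<length x}. ?t (a # x) z (Suc q))"
    by (rule add.finprod_reindex) auto
  also have "\<dots> = (\<Oplus>q\<in>{..<length x}. (\<ominus> \<one>) \<otimes> 
      (case z of [] \<Rightarrow> \<zero> | b # z' \<Rightarrow> if b = a \<and> distinct_adj z then ?t x z' q else \<zero>))"
  proof (rule add.finprod_cong')
    fix q
    have "?t (a # x) z (Suc q) = \<ominus> (case z of [] \<Rightarrow> \<zero> | b # z' \<Rightarrow> if b = a \<and> distinct_adj z then ?t x z' q else \<zero>)"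
      by (auto simp: basis_vec_def ring_sign_def split: list.split dest: distinct_adj_ConsD)
    also have "\<dots> = (\<ominus> \<one>) \<otimes> (case z of [] \<Rightarrow> \<zero> | b # z' \<Rightarrow> if b = a \<and> distinct_adj z then ?t x z' q else \<zero>)"
      by (auto simp: l_minus split: list.split)
    finally show "?t (a # x) z (Suc q) = (\<ominus> \<one>) \<otimes>
      (case z of [] \<Rightarrow> \<zero> | b # z' \<Rightarrow> if b = a \<and> distinct_adj z then ?t x z' q else \<zero>)" .
  qed (auto split: list.split)
  also have "\<dots> = (\<ominus> \<one>) \<otimes> (\<Oplus>q\<in>{..<length x}.
      (case z of [] \<Rightarrow> \<zero> | b # z' \<Rightarrow> if b = a \<and> distinct_adj z then ?t x z' q else \<zero>))"
    by (rule finsum_rdistr[symmetric]) (auto split: list.split)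
  also have "(\<Oplus>q\<in>{..<length x}.
      (case z of [] \<Rightarrow> \<zero> | b # z' \<Rightarrow> if b = a \<and> distinct_adj z then ?t x z' q else \<zero>)) =
     (case z of [] \<Rightarrow> \<zero> | b # z' \<Rightarrow> if b = a \<and> distinct_adj z then path_boundary R x z' else \<zero>)"
  proof (cases z)
    case Nil
    then show ?thesis by (simp add: add.finprod_one_eqI)
  next
    case (Cons b z')
    show ?thesis
    proof (cases "b = a \<and> distinct_adj (b # z')")
      case True
      then show ?thesis by (simp add: Cons path_boundary_def)
    next
      case False
      show ?thesis unfolding Cons list.case if_not_P[OF False] by (simp add: add.finprod_one_eqI)
    qed
  qed
  finally show ?thesis by (auto simp: a_minus_def l_minus split: list.split)
qed

text \<open>
  Prepending \<open>a\<close>, with irregular paths dropped, is an operator \<open>A\<close> on chains, and this is the cone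
  formula \<open>d (A f) = f - A (d f)\<close>, read off at \<open>t\<close>.  On paths that already begin with \<open>a\<close>,
  which \<open>A\<close> annihilates, both sides of it vanish.
\<close>

lemma prepend_boundary:
  assumes V: "finite V" and t: "t \<in> paths V n" and f: "\<And>z. f z \<in> carrier R"
    "\<And>z. f z \<noteq> \<zero> \<Longrightarrow> distinct_adj z"
  shows "(\<Oplus>z\<in>paths V n. (if distinct_adj (a # z) then f z else \<zero>) \<otimes> path_boundary R (a # z) t) =
     f t \<ominus> (case t of [] \<Rightarrow> \<zero> | b # t' \<Rightarrow>
       if b = a \<and> distinct_adj t then (\<Oplus>z\<in>paths V n. f z \<otimes> path_boundary R z t') else \<zero>)"
    (is "?lhs = _")
proof -
  note fin = finite_paths[OF V, of n]
  have single: "(\<Oplus>z\<in>paths V n. if z = t then f t else \<zero>) = f t"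
    using f t fin by (intro finsum_if_single) auto
  show ?thesis
  proof (cases "\<exists>t'. t = a # t' \<and> distinct_adj t")
    case False
    have "?lhs = (\<Oplus>z\<in>paths V n. if z = t then f t else \<zero>)"
    proof (rule add.finprod_cong')
      fix z
      have "(case t of [] \<Rightarrow> \<zero> | b # t' \<Rightarrow> if b = a \<and> distinct_adj t then path_boundary R z t' else \<zero>) = \<zero>"
        using False by (auto split: list.split)
      then have pb: "path_boundary R (a # z) t = (if distinct_adj z \<and> t = z then \<one> else \<zero>)"
        by (simp add: path_boundary_Cons)
      have ft: "f t = \<zero>" if "\<not> (distinct_adj (a # t) \<and> distinct_adj t)"
        using False that f(2)[of t] by (cases t) auto
      show "(if distinct_adj (a # z) then f z else \<zero>) \<otimes> path_boundary R (a # z) t =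
          (if z = t then f t else \<zero>)"
      proof (cases "z = t")
        case True
        then show ?thesis
          using ft f(1)[of t] unfolding pb by (cases "distinct_adj (a # t) \<and> distinct_adj t") auto
      next
        case False
        then show ?thesis unfolding pb using f(1)[of z] by simp
      qed
    qed (use f in auto)
    also have "\<dots> = f t" by (rule single)
    finally show ?thesis using f False by (auto split: list.split)
  next
    case True
    then obtain t' where t': "t = a # t'" "distinct_adj (a # t')" by auto
    have no: "path_boundary R (a # s) t' = (if distinct_adj s \<and> t' = s then \<one> else \<zero>)" for s
    proof -
      have "(case t' of [] \<Rightarrow> \<zero> | b # z' \<Rightarrow> if b = a \<and> distinct_adj t' then path_boundary R s z' else \<zero>) = \<zero>"
        using t'(2) by (cases t') auto
      then show ?thesis unfolding path_boundary_Cons by simp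
    qed
    \<comment> \<open>Among the \<open>z\<close> that begin with \<open>a\<close> only \<open>t\<close> itself has \<open>t'\<close> in its boundary, by \<open>no\<close>.\<close>
    have "?lhs = (\<Oplus>z\<in>paths V n. (if z = t then f t else \<zero>) \<oplus> (\<ominus> \<one>) \<otimes> (f z \<otimes> path_boundary R z t'))"
    proof (rule add.finprod_cong')
      fix z
      have pb: "path_boundary R (a # z) t = \<ominus> path_boundary R z t'" if "distinct_adj (a # z)"
        using t' that by (auto simp: path_boundary_Cons a_minus_def)
      show "(if distinct_adj (a # z) then f z else \<zero>) \<otimes> path_boundary R (a # z) t =
          (if z = t then f t else \<zero>) \<oplus> (\<ominus> \<one>) \<otimes> (f z \<otimes> path_boundary R z t')"
      proof (cases "distinct_adj (a # z)")
        case True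
        then have "z \<noteq> t" using t' by auto
        then show ?thesis using True pb f by (simp add: l_minus r_minus)
      next
        case False
        show ?thesis
        proof (cases "f z = \<zero>")
          case True
          then show ?thesis using False by auto
        next
          case nz: False
          then obtain s where s: "z = a # s" "distinct_adj s"
            using False f(2)[of z] by (cases z) (auto dest: distinct_adj_ConsD)
          show ?thesis using False f s t'(1) by (auto simp: no l_minus r_neg)
        qed
      qed
    qed (use f in auto)
    also have "\<dots> = f t \<ominus> (\<Oplus>z\<in>paths V n. f z \<otimes> path_boundary R z t')"
      using f fin single by (simp add: finsum_addf flip: finsum_rdistr) (simp add: a_minus_def l_minus)
    finally show ?thesis using t' by simp
  qed
qed

text \<open>
  By the recursion \<open>d (a x) = x - A (d x)\<close> and the cone formula, \<open>d d (a x) = d x - (d x - A (d d x))\<close>,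
  and \<open>d d x = 0\<close> by induction.
\<close>

lemma path_boundary_boundary:
  assumes V: "finite V"
  shows "x \<in> paths V (Suc (Suc n)) \<Longrightarrow> distinct_adj x \<Longrightarrow> t \<in> paths V n \<Longrightarrow>
    (\<Oplus>z\<in>paths V (Suc n). path_boundary R x z \<otimes> path_boundary R z t) = \<zero>"
proof (induction x arbitrary: n t)
  case Nil
  then show ?case by (simp add: paths_def)
next
  case (Cons a x)
  note fin = finite_paths[OF V]
  have x: "x \<in> paths V (Suc n)" "distinct_adj x" and a: "a \<in> V"
    using Cons.prems by (auto simp: paths_def dest: distinct_adj_ConsD)
  let ?pre = "\<lambda>z. case z of [] \<Rightarrow> \<zero> | b # z' \<Rightarrow> if b = a \<and> distinct_adj z then path_boundary R x z' else \<zero>"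
  have pre [simp]: "?pre z \<in> carrier R" for z by (auto split: list.split)
  have "(\<Oplus>z\<in>paths V (Suc n). path_boundary R (a # x) z \<otimes> path_boundary R z t) =
      (\<Oplus>z\<in>paths V (Suc n). (if z = x then path_boundary R x t else \<zero>) \<oplus>
        (\<ominus> \<one>) \<otimes> (?pre z \<otimes> path_boundary R z t))"
    using x by (intro add.finprod_cong') (auto simp: path_boundary_Cons a_minus_def l_distr l_minus)
  also have "\<dots> = path_boundary R x t \<ominus> (\<Oplus>z\<in>paths V (Suc n). ?pre z \<otimes> path_boundary R z t)"
    using fin x finsum_if_single[OF fin path_boundary_closed x(1)]
    by (simp add: finsum_addf flip: finsum_rdistr) (simp add: a_minus_def l_minus)
  also have "(\<Oplus>z\<in>paths V (Suc n). ?pre z \<otimes> path_boundary R z t) =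
      (\<Oplus>z\<in>(#) a ` paths V n. ?pre z \<otimes> path_boundary R z t)"
    using a by (intro add.finprod_mono_neutral_cong_right fin)
      (auto simp: paths_def length_Suc_conv split: list.split)
  also have "\<dots> = (\<Oplus>z\<in>paths V n. ?pre (a # z) \<otimes> path_boundary R (a # z) t)"
    by (rule add.finprod_reindex) auto
  also have "\<dots> = (\<Oplus>z\<in>paths V n. (if distinct_adj (a # z) then path_boundary R x z else \<zero>) \<otimes>
      path_boundary R (a # z) t)"
    by (intro add.finprod_cong') auto
  also have "\<dots> = path_boundary R x t \<ominus> (case t of [] \<Rightarrow> \<zero> | b # t' \<Rightarrow>
       if b = a \<and> distinct_adj t
       then (\<Oplus>z\<in>paths V n. path_boundary R x z \<otimes> path_boundary R z t') else \<zero>)"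
    using Cons.prems by (intro prepend_boundary V) (auto dest: path_boundary_nonzeroD)
  also have "\<dots> = path_boundary R x t"
  proof -
    have "(\<Oplus>z\<in>paths V n. path_boundary R x z \<otimes> path_boundary R z t') = \<zero>" if t': "t = b # t'" for b t'
    proof -
      obtain m where "n = Suc m" "t' \<in> paths V m" using Cons.prems(3) t' by (auto simp: paths_def)
      then show ?thesis using Cons.IH[of m t'] x by simp
    qed
    then show ?thesis by (auto split: list.split)
  qed
  finally show ?case by simp
qed

text \<open>
  The product rule for the join.  Disjointness of \<open>X\<close> and \<open>Y\<close> ensures that no irregularity arises at
  the seam, and that the factors of a join are determined by it.
\<close>

lemma path_boundary_append:
  assumes "X \<inter> Y = {}" "set x \<subseteq> X" "set x' \<subseteq> X" "set y \<subseteq> Y" "set y' \<subseteq> Y"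
    "distinct_adj x" "distinct_adj y"
  shows "path_boundary R (x @ y) (x' @ y') = (if y' = y then path_boundary R x x' else \<zero>) \<oplus>
     ring_sign R (int (length x)) \<otimes> (if x' = x then path_boundary R y y' else \<zero>)"
  using assms
proof (induction x arbitrary: x')
  case Nil
  have "path_boundary R y (x' @ y') = \<zero>" if "x' \<noteq> []"
  proof (rule ccontr)
    assume "path_boundary R y (x' @ y') \<noteq> \<zero>"
    from path_boundary_nonzeroD(2)[OF this] have "set x' \<subseteq> X \<inter> Y"
      using Nil.prems unfolding set_append by blast
    then show False using that Nil.prems(1) by (metis set_empty subset_empty)
  qed
  then show ?case by (auto simp: path_boundary_Nil ring_sign_def)
next
  case (Cons a x)
  have x: "set x \<subseteq> X" "distinct_adj x" "a \<in> X" "a \<notin> Y"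
    using Cons.prems by (auto dest: distinct_adj_ConsD)
  have eq: "distinct_adj (x @ y) \<and> x' @ y' = x @ y \<longleftrightarrow> x' = x \<and> y' = y"
    using disjoint_append_eq[of X Y x' x y' y] distinct_adj_disjoint_append[of X Y x y] Cons.prems x by auto
  have sg: "ring_sign R (int (length (a # x))) = \<ominus> ring_sign R (int (length x))"
    by (simp add: ring_sign_add1)
  show ?case
  proof (cases x')
    case Nil
    have "(case y' of [] \<Rightarrow> \<zero> | b # z' \<Rightarrow> if b = a \<and> distinct_adj y' then path_boundary R (x @ y) z' else \<zero>) = \<zero>"
      using Cons.prems x by (auto split: list.split)
    then have "path_boundary R (a # (x @ y)) y' = (if [] = x \<and> y' = y then \<one> else \<zero>)"
      using path_boundary_Cons[of a "x @ y" y'] eq by (simp add: Nil)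
    moreover have "path_boundary R (a # x) [] = (if [] = x then \<one> else \<zero>)"
      using x by (simp add: path_boundary_Cons)
    ultimately show ?thesis by (auto simp: Nil)
  next
    case (Cons b x1)
    have x1: "set x1 \<subseteq> X" "b \<in> X" using Cons.prems Cons \<open>set x' \<subseteq> X\<close> by auto
    have da: "distinct_adj (b # x1 @ y') \<longleftrightarrow> distinct_adj (b # x1) \<and> distinct_adj y'"
      using distinct_adj_disjoint_append[of X Y "b # x1" y'] assms x1 by auto
    have IH: "path_boundary R (x @ y) (x1 @ y') = (if y' = y then path_boundary R x x1 else \<zero>) \<oplus>
        ring_sign R (int (length x)) \<otimes> (if x1 = x then path_boundary R y y' else \<zero>)"
      using Cons.IH[of x1] Cons.prems x x1 by auto
    have day: "path_boundary R y y' = \<zero>" if "\<not> distinct_adj y'"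
      using that path_boundary_nonzeroD(3) by blast
    have lhs: "path_boundary R ((a # x) @ y) (x' @ y') = (if b # x1 = x \<and> y' = y then \<one> else \<zero>) \<ominus>
        (if b = a \<and> distinct_adj (b # x1) \<and> distinct_adj y' then path_boundary R (x @ y) (x1 @ y') else \<zero>)"
      using path_boundary_Cons[of a "x @ y" "b # x1 @ y'"] eq by (simp add: Cons da)
    have rhs: "path_boundary R (a # x) x' = (if b # x1 = x then \<one> else \<zero>) \<ominus>
        (if b = a \<and> distinct_adj (b # x1) then path_boundary R x x1 else \<zero>)"
      using path_boundary_Cons[of a x "b # x1"] x by (auto simp: Cons)
    have dax: "distinct_adj (b # x1)" if "b = a" "x1 = x" using that Cons.prems by simp
    have sgx: "ring_sign R (int (length x)) \<otimes> path_boundary R y y' \<in> carrier R" by simp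
    show ?thesis
      unfolding lhs rhs IH sg
      using Cons.prems(7) day dax sgx
      by (cases "b = a"; cases "x1 = x"; cases "y' = y"; cases "distinct_adj (b # x1)"; cases "distinct_adj y'")
        (simp_all add: Cons a_minus_def minus_add l_minus a_assoc)
  qed
qed

text \<open>
  The boundary operator as a local operator.  It sums over all lists of the right length, so that it is
  meaningful also for functions of infinite support; on chains it agrees with \<^const>\<open>boundary\<close>.
\<close>

definition list_boundary :: "'v set \<Rightarrow> ('v list \<Rightarrow> 'a) \<Rightarrow> 'v list \<Rightarrow> 'a" where
  "list_boundary V u z = (\<Oplus>x\<in>paths V (Suc (length z)). path_boundary R x z \<otimes> u x)"

lemma list_boundary_local:
  "finite V \<Longrightarrow> local_operator (\<lambda>x. int (length x) - k) 1 (list_boundary V)"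
  unfolding local_operator_def list_boundary_def
  by (intro allI local_functionalI[OF finite_paths]) (auto simp: paths_def)

lemma boundary_eq_list_boundary:
  assumes V: "finite V" and u: "scalar_valued u" "\<And>x. u x \<noteq> \<zero> \<Longrightarrow> x \<in> paths V m"
  shows "boundary R u = list_boundary V u"
proof
  fix z
  show "boundary R u z = list_boundary V u z"
  proof (cases "m = Suc (length z)")
    case True
    have "boundary R u z = (\<Oplus>x\<in>paths V m. u x \<otimes> path_boundary R x z)"
      unfolding boundary_def using u finite_paths[OF V] by (intro lin_ext_eq) auto
    also have "\<dots> = list_boundary V u z"
      unfolding list_boundary_def True using u(1) by (intro add.finprod_cong') (auto simp: m_comm)
    finally show ?thesis .
  next
    case False
    have z: "path_boundary R x z = \<zero>" if "u x \<noteq> \<zero>" for x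
      using path_boundary_nonzeroD(1)[of x z] u(2)[OF that] False by (auto simp: paths_def)
    have "boundary R u z = \<zero>"
      unfolding boundary_def lin_ext_def using u(1) z by (intro add.finprod_one_eqI) auto
    moreover have "list_boundary V u z = \<zero>"
      unfolding list_boundary_def using u(1) z
      by (intro add.finprod_one_eqI) (metis path_boundary_closed r_null l_null scalar_valuedD)
    ultimately show ?thesis by simp
  qed
qed

lemma list_boundary_nonzeroD:
  assumes "scalar_valued u" "list_boundary V u z \<noteq> \<zero>"
  obtains x where "x \<in> paths V (Suc (length z))" "u x \<noteq> \<zero>" "path_boundary R x z \<noteq> \<zero>"
proof -
  have "\<exists>x\<in>paths V (Suc (length z)). u x \<noteq> \<zero> \<and> path_boundary R x z \<noteq> \<zero>"
  proof (rule ccontr)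
    assume *: "\<not> ?thesis"
    have "path_boundary R x z \<otimes> u x = \<zero>" if "x \<in> paths V (Suc (length z))" for x
      using * that assms(1) by (cases "u x = \<zero>") auto
    then have "list_boundary V u z = \<zero>"
      unfolding list_boundary_def by (intro add.finprod_one_eqI) auto
    with assms show False by simp
  qed
  then show thesis using that by blast
qed

lemma list_boundary_list_boundary:
  assumes V: "finite V" and u: "scalar_valued u" "\<And>x. u x \<noteq> \<zero> \<Longrightarrow> distinct_adj x"
  shows "list_boundary V (list_boundary V u) t = \<zero>"
proof -
  let ?n = "length t"
  let ?A = "paths V (Suc (Suc ?n))" and ?B = "paths V (Suc ?n)"
  note fin = finite_paths[OF V]
  have B: "length z = Suc ?n" if "z \<in> ?B" for z using that by (simp add: paths_def)
  have "list_boundary V (list_boundary V u) t =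
      (\<Oplus>z\<in>?B. \<Oplus>x\<in>?A. path_boundary R z t \<otimes> (path_boundary R x z \<otimes> u x))"
    unfolding list_boundary_def using u(1) fin
    by (intro add.finprod_cong') (auto simp: B finsum_rdistr intro!: finsum_closed)
  also have "\<dots> = (\<Oplus>x\<in>?A. \<Oplus>z\<in>?B. path_boundary R z t \<otimes> (path_boundary R x z \<otimes> u x))"
    using u(1) by (intro finsum_swap fin) auto
  also have "\<dots> = (\<Oplus>x\<in>?A. \<zero>)"
  proof (rule add.finprod_cong')
    fix x assume x: "x \<in> ?A"
    have "(\<Oplus>z\<in>?B. path_boundary R z t \<otimes> (path_boundary R x z \<otimes> u x)) =
        (\<Oplus>z\<in>?B. u x \<otimes> (path_boundary R x z \<otimes> path_boundary R z t))"
      using u(1) by (intro add.finprod_cong') (auto simp: m_ac)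
    also have "\<dots> = u x \<otimes> (\<Oplus>z\<in>?B. path_boundary R x z \<otimes> path_boundary R z t)"
      using u(1) fin by (intro finsum_rdistr[symmetric]) auto
    also have "\<dots> = \<zero>"
    proof (cases "u x = \<zero>")
      case True
      then show ?thesis by (auto intro!: l_null finsum_closed)
    next
      case False
      have "(\<Oplus>z\<in>?B. path_boundary R x z \<otimes> path_boundary R z t) = \<zero>"
      proof (cases "set t \<subseteq> V")
        case True
        then show ?thesis
          using path_boundary_boundary[OF V x u(2)[OF False]] by (simp add: paths_def)
      next
        case False
        have "path_boundary R z t = \<zero>" if "z \<in> ?B" for z
          using path_boundary_nonzeroD(2)[of z t] that False by (auto simp: paths_def)
        then show ?thesis by (intro add.finprod_one_eqI) auto
      qed
      then show ?thesis using u(1) by simp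
    qed
    finally show "(\<Oplus>z\<in>?B. path_boundary R z t \<otimes> (path_boundary R x z \<otimes> u x)) = \<zero>" .
  qed auto
  finally show ?thesis by (simp add: add.finprod_one_eqI)
qed

lemma boundary_scalar: "scalar_valued u \<Longrightarrow> scalar_valued (boundary R u)"
  unfolding boundary_def lin_ext_def by (intro scalar_valuedI finsum_closed) auto

end

section \<open>Chains on a regular path complex\<close>

locale path_chains = field R + regular_path_complex V P
  for R (structure) and V :: "'v set" and P +
  assumes finite_V: "finite V"
begin

lemma take_in: "x \<in> P \<Longrightarrow> take k x \<in> P"
proof (induction "length x - k" arbitrary: k)
  case (Suc n)
  then have "take (Suc k) x \<in> P" "k < length x" by auto
  then show ?case
    using butlast_closed[of "take (Suc k) x"] by (auto simp: take_Suc_conv_app_nth)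
qed auto

lemma Nil_in: "[] \<in> P"
  using nonempty take_in[of _ 0] by auto

lemma path_distinct_adj: "x \<in> P \<Longrightarrow> distinct_adj x"
proof (induction x rule: induct_list012)
  case (3 a b x)
  have "[a, b] \<in> P" using take_in[OF 3(3), of 2] by simp
  moreover have "b # x \<in> P" using tl_closed[OF 3(3)] by simp
  ultimately show ?case using 3 no_loops by auto
qed auto

lemma allowed_iff:
  "u \<in> allowed_chains R V P n \<longleftrightarrow>
     scalar_valued u \<and> (\<forall>x. u x \<noteq> \<zero> \<longrightarrow> x \<in> P \<and> int (length x) = n + 1)"
proof -
  let ?T = "{x \<in> P. int (length x) = n + 1}"
  have "?T \<subseteq> {x. set x \<subseteq> V \<and> int (length x) = n + 1 \<and> distinct_adj x}"
    using vertices path_distinct_adj by auto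
  then have eq: "allowed_chains R V P n = carrier (free_space R ?T)"
    unfolding allowed_chains_def regular_chains_def by (rule span_basis_vecs)
  have "?T \<subseteq> paths V (nat (n + 1))" using vertices by (auto simp: paths_def)
  then have "finite ?T" using finite_paths[OF finite_V] by (rule finite_subset)
  then show ?thesis
    unfolding eq free_space_carrier by (auto intro: finite_subset[of _ ?T])
qed

abbreviation "\<Omega> n \<equiv> carrier (Omega R V P n)"

lemma Omega_iff:
  "u \<in> \<Omega> n \<longleftrightarrow> scalar_valued u \<and> (\<forall>x. u x \<noteq> \<zero> \<longrightarrow> x \<in> P \<and> int (length x) = n + 1) \<and>
     (\<forall>z. boundary R u z \<noteq> \<zero> \<longrightarrow> z \<in> P \<and> int (length z) = n)"
  using boundary_scalar[of u] by (auto simp: Omega_def allowed_iff)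

lemma Omega_eq: "Omega R V P n = function_space (\<Omega> n)"
  by (simp add: Omega_def regular_chains_def free_space_def function_space_def)

lemma boundary_eq:
  assumes "scalar_valued u" "\<And>x. u x \<noteq> \<zero> \<Longrightarrow> x \<in> P \<and> int (length x) = n"
  shows "boundary R u = list_boundary V u"
proof (rule boundary_eq_list_boundary[OF finite_V assms(1)])
  fix x assume "u x \<noteq> \<zero>"
  then have "x \<in> P" "int (length x) = n" using assms(2) by blast+
  then show "x \<in> paths V (nat n)" using vertices by (auto simp: paths_def)
qed

lemma Omega_boundary_eq: "u \<in> \<Omega> n \<Longrightarrow> boundary R u = list_boundary V u"
  using boundary_eq[of u "n + 1"] by (auto simp: Omega_iff)

lemma bd_local: "local_operator (\<lambda>x. int (length x)) 1 (list_boundary V)"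
  using list_boundary_local[OF finite_V, of 0] by simp

lemma Omega_subspace: "function_subspace (\<Omega> n)"
proof (rule function_subspaceI)
  note [simp] = operator_add[OF bd_local] operator_smult[OF bd_local]
  show z: "(\<lambda>i. \<zero>) \<in> \<Omega> n" 
    by (auto simp: Omega_iff boundary_def lin_ext_def intro: scalar_valuedI)
  fix f assume f: "f \<in> \<Omega> n"
  then show fc: "f i \<in> carrier R" for i by (auto simp: Omega_iff)
  have nz: "f x = \<zero>" if "\<not> (x \<in> P \<and> int (length x) = n + 1)" for x
    using f that unfolding Omega_iff by blast
  have bz: "list_boundary V f z = \<zero>" if "\<not> (z \<in> P \<and> int (length z) = n)" for z
    using f that unfolding Omega_boundary_eq[OF f, symmetric] Omega_iff by blast
  have sf: "scalar_valued f" using f by (simp add: Omega_iff)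
  { fix g assume g: "g \<in> \<Omega> n"
    have nzg: "g x = \<zero>" if "\<not> (x \<in> P \<and> int (length x) = n + 1)" for x
      using g that unfolding Omega_iff by blast
    have bzg: "list_boundary V g z = \<zero>" if "\<not> (z \<in> P \<and> int (length z) = n)" for z
      using g that unfolding Omega_boundary_eq[OF g, symmetric] Omega_iff by blast
    have sg: "scalar_valued g" using g by (simp add: Omega_iff)
    have s: "scalar_valued (\<lambda>i. f i \<oplus> g i)" using sf sg by (auto intro!: scalar_valuedI)
    have supp: "x \<in> P \<and> int (length x) = n + 1" if "f x \<oplus> g x \<noteq> \<zero>" for x
      using that by (cases "x \<in> P \<and> int (length x) = n + 1") (simp_all add: nz nzg)
    have "boundary R (\<lambda>i. f i \<oplus> g i) = (\<lambda>z. list_boundary V f z \<oplus> list_boundary V g z)"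
      using boundary_eq[OF s supp] sf sg by simp
    moreover have "z \<in> P \<and> int (length z) = n" if "list_boundary V f z \<oplus> list_boundary V g z \<noteq> \<zero>" for z
      using that by (cases "z \<in> P \<and> int (length z) = n") (simp_all add: bz bzg)
    ultimately show "(\<lambda>i. f i \<oplus> g i) \<in> \<Omega> n"
      unfolding Omega_iff using s supp by auto }
  { fix c assume c: "c \<in> carrier R"
    have s: "scalar_valued (\<lambda>i. c \<otimes> f i)" using sf c by (auto intro!: scalar_valuedI)
    have supp: "x \<in> P \<and> int (length x) = n + 1" if "c \<otimes> f x \<noteq> \<zero>" for x
      using that c by (cases "x \<in> P \<and> int (length x) = n + 1") (simp_all add: nz)
    have "boundary R (\<lambda>i. c \<otimes> f i) = (\<lambda>z. c \<otimes> list_boundary V f z)"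
      using boundary_eq[OF s supp] sf c by simp
    moreover have "z \<in> P \<and> int (length z) = n" if "c \<otimes> list_boundary V f z \<noteq> \<zero>" for z
      using that c by (cases "z \<in> P \<and> int (length z) = n") (simp_all add: bz)
    ultimately show "(\<lambda>i. c \<otimes> f i) \<in> \<Omega> n"
      unfolding Omega_iff using s supp by auto }
qed

lemma Omega_iso: "linear_iso R (Omega R V P n) (function_space (\<Omega> n)) id"
proof -
  have "linear_iso R (function_space (\<Omega> n)) (function_space (\<Omega> n)) id"
    by (rule linear_iso_id[OF Omega_subspace])
  then show ?thesis by (subst (1) Omega_eq)
qed

lemma boundary_boundary:
  assumes u: "u \<in> \<Omega> n" shows "boundary R (boundary R u) = (\<lambda>x. \<zero>)"
proof -
  have "boundary R (boundary R u) = list_boundary V (boundary R u)"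
    using u boundary_scalar by (intro boundary_eq[of _ n]) (auto simp: Omega_iff)
  then show ?thesis
    using u list_boundary_list_boundary[OF finite_V, of u] path_distinct_adj
    by (auto simp: Omega_boundary_eq[OF u] Omega_iff)
qed

lemma boundary_in: "u \<in> \<Omega> n \<Longrightarrow> boundary R u \<in> \<Omega> (n - 1)"
  using boundary_boundary[of u n] boundary_scalar[of u] by (auto simp: Omega_iff)

text \<open>
  The degree of a path is its length for the shifted complex (\<open>k = 0\<close>) and its length minus one for
  the complex itself (\<open>k = 1\<close>).
\<close>

lemma Omega_function_complex:
  "function_complex R (\<lambda>x. int (length x) - k) (\<lambda>n. \<Omega> (n - 1 + k)) (list_boundary V)"
proof unfold_locales
  fix n u x
  show "function_subspace (\<Omega> (n - 1 + k))" by (rule Omega_subspace)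
  show "u \<in> \<Omega> (n - 1 + k) \<Longrightarrow> u x \<noteq> \<zero> \<Longrightarrow> int (length x) - k = n" by (auto simp: Omega_iff)
  show "\<exists>S. finite S \<and> (\<forall>u\<in>\<Omega> (n - 1 + k). \<forall>x. u x \<noteq> \<zero> \<longrightarrow> x \<in> S)"
  proof (intro exI[of _ "paths V (nat (n + k))"] conjI ballI allI impI)
    fix u x assume "u \<in> \<Omega> (n - 1 + k)" "u x \<noteq> \<zero>"
    then have "x \<in> P" "int (length x) = n + k" by (auto simp: Omega_iff)
    then show "x \<in> paths V (nat (n + k))" using vertices by (simp add: paths_def flip: nat_eq_iff)
  qed (rule finite_paths[OF finite_V])
  show "local_operator (\<lambda>x. int (length x) - k) 1 (list_boundary V)"
    by (rule list_boundary_local[OF finite_V])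
  assume u: "u \<in> \<Omega> (n - 1 + k)"
  show "list_boundary V u \<in> \<Omega> (n - 1 - 1 + k)"
    using boundary_in[OF u] by (simp add: Omega_boundary_eq[OF u] algebra_simps)
  show "list_boundary V (list_boundary V u) = (\<lambda>x. \<zero>)"
    using boundary_boundary[OF u] Omega_boundary_eq[OF boundary_in[OF u]]
    by (simp add: Omega_boundary_eq[OF u])
qed

lemma Omega_below: "u \<in> \<Omega> n \<Longrightarrow> n < - 1 \<Longrightarrow> u = (\<lambda>x. \<zero>)"
  by (rule ext, rule ccontr) (auto simp: Omega_iff)

lemma Omega_chain_complex: "chain_complex R (Omega_complex R V P)"
proof (rule chain_complex.intro)
  fix n
  have vs: "vectorspace R (Omega R V P n)" for n
    by (subst Omega_eq) (intro vectorspace_function_space Omega_subspace)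
  have ops: "f \<oplus>\<^bsub>Omega R V P n\<^esub> g = (\<lambda>i. f i \<oplus> g i)" "c \<odot>\<^bsub>Omega R V P n\<^esub> f = (\<lambda>i. c \<otimes> f i)"
    for f g c n by (subst Omega_eq, simp)+
  note lb = Omega_boundary_eq
  have "linear_map R (Omega R V P n) (Omega R V P (n - 1)) (boundary R)"
  proof (rule linear_mapI[OF vs vs])
    fix u v assume u: "u \<in> \<Omega> n" and v: "v \<in> \<Omega> n"
    then show "boundary R (u \<oplus>\<^bsub>Omega R V P n\<^esub> v) = boundary R u \<oplus>\<^bsub>Omega R V P (n - 1)\<^esub> boundary R v"
      unfolding ops lb[OF subspace_add[OF Omega_subspace u v]] lb[OF u] lb[OF v]
      by (intro operator_add[OF bd_local]) (auto simp: Omega_iff)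
  next
    fix c u assume c: "c \<in> carrier R" and u: "u \<in> \<Omega> n"
    then show "boundary R (c \<odot>\<^bsub>Omega R V P n\<^esub> u) = c \<odot>\<^bsub>Omega R V P (n - 1)\<^esub> boundary R u"
      unfolding ops lb[OF subspace_smult[OF Omega_subspace c u]] lb[OF u]
      by (intro operator_smult[OF bd_local]) (auto simp: Omega_iff)
  qed (rule boundary_in)
  then show "linear_map R (chains (Omega_complex R V P) n) (chains (Omega_complex R V P) (n - 1))
      (bdry (Omega_complex R V P) n)"
    by (simp add: Omega_complex_def)
next
  fix n u assume "u \<in> carrier (chains (Omega_complex R V P) n)"
  moreover have "\<zero>\<^bsub>Omega R V P (n - 2)\<^esub> = (\<lambda>i. \<zero>)" by (subst Omega_eq) simp
  ultimately show "bdry (Omega_complex R V P) (n - 1) (bdry (Omega_complex R V P) n u) =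
      \<zero>\<^bsub>chains (Omega_complex R V P) (n - 2)\<^esub>"
    by (simp add: Omega_complex_def boundary_boundary)
qed

lemma reduced_homology_eq:
  "reduced_homology R V P n = quotient_space
     (function_space {z \<in> \<Omega> n. list_boundary V z = (\<lambda>x. \<zero>)}) (list_boundary V ` \<Omega> (n + 1))"
proof -
  have "\<zero>\<^bsub>Omega R V P (n - 1)\<^esub> = (\<lambda>i. \<zero>)" by (subst Omega_eq) simp
  moreover have "Omega R V P n \<lparr>carrier := C\<rparr> = function_space C" for C
    by (subst Omega_eq) (simp add: function_space_def)
  moreover have "boundary R ` \<Omega> (n + 1) = list_boundary V ` \<Omega> (n + 1)"
    by (intro image_cong refl Omega_boundary_eq)
  moreover have "{z \<in> \<Omega> n. boundary R z = (\<lambda>x. \<zero>)} = {z \<in> \<Omega> n. list_boundary V z = (\<lambda>x. \<zero>)}"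
    by (intro Collect_cong conj_cong refl) (simp add: Omega_boundary_eq)
  ultimately show ?thesis by (simp add: reduced_homology_def homology_def Omega_complex_def)
qed

text \<open>
  A multiple of the empty path is the boundary of the same multiple of any vertex.
\<close>

lemma augmentation_surj:
  assumes "V \<noteq> {}" and u: "u \<in> \<Omega> (- 1)"
  shows "u \<in> list_boundary V ` \<Omega> 0"
proof -
  obtain i where i: "i \<in> V" using assms by blast
  define v where "v = (\<lambda>x. if x = [i] then u [] else \<zero>)"
  have uc: "u x \<in> carrier R" for x using u by (auto simp: Omega_iff)
  have v: "scalar_valued v" "\<And>x. v x \<noteq> \<zero> \<Longrightarrow> x \<in> P \<and> int (length x) = 1"
    using uc vertex_paths[OF i] by (auto simp: v_def intro!: scalar_valuedI split: if_splits)
  have bv: "boundary R v = list_boundary V v" by (rule boundary_eq[OF v])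
  have "list_boundary V v z = u z" for z
  proof (cases z)
    case Nil
    have "list_boundary V v z = (\<Oplus>x\<in>paths V 1. if x = [i] then u [] else \<zero>)"
      unfolding list_boundary_def Nil using uc
      by (intro add.finprod_cong') (auto simp: v_def path_boundary_Cons path_boundary_Nil)
    also have "\<dots> = u []"
      using i uc by (intro finsum_if_single finite_paths finite_V) (auto simp: paths_def)
    finally show ?thesis by (simp add: Nil)
  next
    case (Cons a y)
    then have "u z = \<zero>" using u by (auto simp: Omega_iff)
    moreover have "list_boundary V v z = \<zero>"
      unfolding list_boundary_def using uc
      by (intro add.finprod_one_eqI) (auto simp: v_def paths_def Cons)
    ultimately show ?thesis by simp
  qed
  then have eq: "list_boundary V v = u" by blast
  then have "v \<in> \<Omega> 0" using v bv u by (auto simp: Omega_iff)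
  then show ?thesis using eq by blast
qed

end

section \<open>Chains on the join as matrices\<close>

locale disjoint_path_chains = X: path_chains R X PX + Y: path_chains R Y PY
  for R :: "('a, 'b) ring_scheme" (structure) and X :: "'v set" and PX and Y :: "'v set" and PY +
  assumes disjoint: "X \<inter> Y = {}"
begin

abbreviation "PZ \<equiv> join_paths PX PY"

lemma join_regular: "regular_path_complex (X \<union> Y) PZ"
proof unfold_locales
  show "PZ \<noteq> {}" using X.nonempty Y.nonempty by (auto simp: join_paths_def)
  show "set x \<subseteq> X \<union> Y" if "x \<in> PZ" for x
    using that X.vertices Y.vertices by (fastforce simp: join_paths_def)
  show "[i] \<in> PZ" if "i \<in> X \<union> Y" for i
    using that X.vertex_paths Y.vertex_paths X.Nil_in Y.Nil_in
    by (auto simp: join_paths_def Cons_eq_append_conv)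
  show "butlast x \<in> PZ" if x: "x \<in> PZ" "x \<noteq> []" for x
  proof -
    obtain u v where uv: "x = u @ v" "u \<in> PX" "v \<in> PY" using x(1) by (auto simp: join_paths_def)
    show ?thesis
    proof (cases "v = []")
      case True
      then have "butlast x = butlast u @ []" "u \<noteq> []" using uv x by auto
      then show ?thesis using uv X.butlast_closed Y.Nil_in unfolding join_paths_def by blast
    next
      case False
      then have "butlast x = u @ butlast v" using uv by (simp add: butlast_append)
      then show ?thesis using uv Y.butlast_closed False unfolding join_paths_def by blast
    qed
  qed
  show "tl x \<in> PZ" if x: "x \<in> PZ" "x \<noteq> []" for x
  proof -
    obtain u v where uv: "x = u @ v" "u \<in> PX" "v \<in> PY" using x(1) by (auto simp: join_paths_def)
    show ?thesis
    proof (cases "u = []")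
      case True
      then have "tl x = [] @ tl v" "v \<noteq> []" using uv x by auto
      then show ?thesis using uv Y.tl_closed X.Nil_in unfolding join_paths_def by blast
    next
      case False
      then have "tl x = tl u @ v" using uv by simp
      then show ?thesis using uv X.tl_closed False unfolding join_paths_def by blast
    qed
  qed
  show "[i, i] \<notin> PZ" for i
  proof
    assume "[i, i] \<in> PZ"
    then obtain u v where uv: "[i, i] = u @ v" "u \<in> PX" "v \<in> PY" by (auto simp: join_paths_def)
    consider "u = []" "v = [i, i]" | "u = [i]" "v = [i]" | "u = [i, i]" "v = []"
      using uv(1)[symmetric] by (auto simp: append_eq_Cons_conv)
    then show False
      using uv(2,3) X.vertices[OF uv(2)] Y.vertices[OF uv(3)] X.no_loops Y.no_loops disjoint
      by cases auto
  qed
qed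

sublocale Z: path_chains R "X \<union> Y" PZ
  using join_regular X.finite_V Y.finite_V X.field_axioms
  by (simp add: path_chains_def path_chains_axioms_def)

abbreviation "degX \<equiv> \<lambda>x :: 'v list. int (length x)"
abbreviation "degY \<equiv> \<lambda>y :: 'v list. int (length y) - 1"
abbreviation "W \<equiv> X.total degX degY (\<lambda>n. X.\<Omega> (n - 1)) Y.\<Omega>"

definition pair_boundary :: "('v list \<times> 'v list \<Rightarrow> 'a) \<Rightarrow> 'v list \<times> 'v list \<Rightarrow> 'a" where
  "pair_boundary w = (\<lambda>p. on_left (X.list_boundary X) w p \<oplus>
     X.twist degX (on_right (X.list_boundary Y) w) p)"

definition unjoin :: "('v list \<Rightarrow> 'a) \<Rightarrow> 'v list \<times> 'v list \<Rightarrow> 'a" where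
  "unjoin z = (\<lambda>(x, y). if set x \<subseteq> X \<and> set y \<subseteq> Y then z (x @ y) else \<zero>)"

text \<open>
  On a list that is not of the form \<open>x @ y\<close>, the second part contains a vertex outside of \<open>Y\<close>.  The
  matrices that occur vanish at such pairs, so \<open>join w\<close> is supported on the join.
\<close>

definition join :: "('v list \<times> 'v list \<Rightarrow> 'a) \<Rightarrow> 'v list \<Rightarrow> 'a" where
  "join w = (\<lambda>z. w (takeWhile (\<lambda>a. a \<in> X) z, dropWhile (\<lambda>a. a \<in> X) z))"

lemma join_append:
  assumes "set x \<subseteq> X" "set y \<subseteq> Y"
  shows "join w (x @ y) = w (x, y)"
proof -
  have "takeWhile (\<lambda>a. a \<in> X) (x @ y) = x @ takeWhile (\<lambda>a. a \<in> X) y"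
    "dropWhile (\<lambda>a. a \<in> X) (x @ y) = dropWhile (\<lambda>a. a \<in> X) y"
    using assms by (auto intro!: takeWhile_append2 dropWhile_append2)
  moreover have "takeWhile (\<lambda>a. a \<in> X) y = [] \<and> dropWhile (\<lambda>a. a \<in> X) y = y"
    using assms disjoint by (cases y) auto
  ultimately show ?thesis by (simp add: join_def)
qed

text \<open>
  The decomposition of a list into a part in \<open>X\<close> and a part in \<open>Y\<close> is unique.
\<close>

lemma append_in_PZ:
  assumes "set x \<subseteq> X" "set y \<subseteq> Y"
  shows "x @ y \<in> PZ \<longleftrightarrow> x \<in> PX \<and> y \<in> PY"
proof
  assume "x @ y \<in> PZ"
  then obtain u v where uv: "x @ y = u @ v" "u \<in> PX" "v \<in> PY" unfolding join_paths_def by blast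
  then show "x \<in> PX \<and> y \<in> PY"
    using disjoint_append_eq[OF disjoint assms(1) X.vertices[OF uv(2)] assms(2) Y.vertices[OF uv(3)]] by simp
qed (auto simp: join_paths_def)

lemma joinE:
  assumes "t \<in> PZ"
  obtains x y where "t = x @ y" "x \<in> PX" "y \<in> PY" "set x \<subseteq> X" "set y \<subseteq> Y"
  using assms X.vertices Y.vertices by (auto simp: join_paths_def)

lemma join_nonzeroD:
  assumes "\<And>x y. w (x, y) \<noteq> \<zero> \<Longrightarrow> x \<in> PX \<and> y \<in> PY" "join w t \<noteq> \<zero>"
  obtains x y where "t = x @ y" "w (x, y) \<noteq> \<zero>" "set x \<subseteq> X" "set y \<subseteq> Y"
proof (rule that)
  let ?x = "takeWhile (\<lambda>a. a \<in> X) t" and ?y = "dropWhile (\<lambda>a. a \<in> X) t"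
  show "t = ?x @ ?y" by simp
  show "w (?x, ?y) \<noteq> \<zero>" using assms(2) by (simp add: join_def)
  then show "set ?x \<subseteq> X" "set ?y \<subseteq> Y" using assms(1) X.vertices Y.vertices by blast+
qed

lemma unjoin_join:
  assumes "\<And>x y. w (x, y) \<noteq> \<zero> \<Longrightarrow> x \<in> PX \<and> y \<in> PY"
  shows "unjoin (join w) = w"
proof
  fix p :: "'v list \<times> 'v list" obtain x y where p: "p = (x, y)" by force
  have "w (x, y) = \<zero>" if "\<not> (set x \<subseteq> X \<and> set y \<subseteq> Y)"
    using assms[of x y] X.vertices Y.vertices that by blast
  then show "unjoin (join w) p = w p" by (auto simp: p unjoin_def join_append)
qed

lemma join_unjoin:
  assumes "\<And>t. z t \<noteq> \<zero> \<Longrightarrow> \<exists>x y. t = x @ y \<and> set x \<subseteq> X \<and> set y \<subseteq> Y"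
  shows "join (unjoin z) = z"
proof
  fix t
  show "join (unjoin z) t = z t"
  proof (cases "\<exists>x y. t = x @ y \<and> set x \<subseteq> X \<and> set y \<subseteq> Y")
    case True
    then show ?thesis by (auto simp: join_append unjoin_def)
  next
    case False
    then have "z t = \<zero>" using assms by blast
    moreover have "join (unjoin z) t = \<zero>"
      using False takeWhile_dropWhile_id[of "\<lambda>a. a \<in> X" t, symmetric] unfolding join_def unjoin_def by auto
    ultimately show ?thesis by simp
  qed
qed

text \<open>
  The sum over the paths of the join is a sum over pairs \<open>(x1, y1)\<close>.  By the product rule each
  term is a sum of one that requires \<open>y1 = y\<close> and one that requires \<open>x1 = x\<close>.
\<close>

lemma unjoin_boundary:
  assumes z: "X.scalar_valued z" "\<And>t. z t \<noteq> \<zero> \<Longrightarrow> t \<in> PZ \<and> int (length t) = n"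
  shows "unjoin (boundary R z) = pair_boundary (unjoin z)"
proof
  fix p :: "'v list \<times> 'v list" obtain x y where p: "p = (x, y)" by force
  define w where "w = unjoin z"
  have w: "X.scalar_valued w" using z(1) by (auto simp: w_def unjoin_def intro!: X.scalar_valuedI)
  note fX = finite_paths[OF X.finite_V] and fY = finite_paths[OF Y.finite_V]
  have wP: "x1 \<in> PX \<and> y1 \<in> PY" if "w (x1, y1) \<noteq> \<zero>" for x1 y1
    using that z(2)[of "x1 @ y1"] append_in_PZ by (auto simp: w_def unjoin_def split: if_splits)
  show "unjoin (boundary R z) p = pair_boundary (unjoin z) p"
  proof (cases "set x \<subseteq> X \<and> set y \<subseteq> Y")
    case False
    have sl: "X.scalar_valued (\<lambda>x'. w (x', y))" "X.scalar_valued (\<lambda>y'. w (x, y'))"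
      using w by (auto intro!: X.scalar_valuedI)
    have "X.list_boundary X (\<lambda>x'. w (x', y)) x = \<zero>"
    proof (rule ccontr)
      assume "X.list_boundary X (\<lambda>x'. w (x', y)) x \<noteq> \<zero>"
      then obtain x1 where "w (x1, y) \<noteq> \<zero>" "path_boundary R x1 x \<noteq> \<zero>"
        using X.list_boundary_nonzeroD[OF sl(1)] by blast
      then show False
        using wP[of x1 y] X.path_boundary_nonzeroD(2)[of x1 x] X.vertices Y.vertices False by blast
    qed
    moreover have "X.list_boundary Y (\<lambda>y'. w (x, y')) y = \<zero>"
    proof (rule ccontr)
      assume "X.list_boundary Y (\<lambda>y'. w (x, y')) y \<noteq> \<zero>"
      then obtain y1 where "w (x, y1) \<noteq> \<zero>" "path_boundary R y1 y \<noteq> \<zero>"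
        using X.list_boundary_nonzeroD[OF sl(2)] by blast
      then show False
        using wP[of x y1] X.path_boundary_nonzeroD(2)[of y1 y] X.vertices Y.vertices False by blast
    qed
    moreover have "unjoin (boundary R z) (x, y) = \<zero>" using False by (auto simp: unjoin_def)
    ultimately show ?thesis
      by (simp add: p pair_boundary_def on_left_def on_right_def X.twist_def flip: w_def)
  next
    case True
    let ?N = "Suc (length x + length y)"
    define T where "T = {(x1, y1). set x1 \<subseteq> X \<and> set y1 \<subseteq> Y \<and> length x1 + length y1 = ?N}"
    have "T \<subseteq> (\<Union>i\<in>{..?N}. paths X i) \<times> (\<Union>i\<in>{..?N}. paths Y i)"
      by (auto simp: T_def paths_def)
    then have finT: "finite T" by (rule finite_subset) (auto simp: fX fY)
    have injT: "inj_on (\<lambda>(x1, y1). x1 @ y1) T"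
      using disjoint_append_eq[OF disjoint] by (auto simp: inj_on_def T_def)
    have wz: "w (x1, y1) = z (x1 @ y1)" if "(x1, y1) \<in> T" for x1 y1
      using that by (auto simp: T_def w_def unjoin_def)
    let ?A = "\<lambda>(x1, y1). (if y = y1 then path_boundary R x1 x else \<zero>) \<otimes> w (x1, y1)"
    let ?B = "\<lambda>(x1, y1). (if x = x1 then ring_sign R (degX x) \<otimes> path_boundary R y1 y else \<zero>) \<otimes> w (x1, y1)"
    have cl: "?A q \<in> carrier R" "?B q \<in> carrier R" for q using w by (auto split: prod.split)
    have "boundary R z (x @ y) =
        (\<Oplus>t\<in>paths (X \<union> Y) ?N. path_boundary R t (x @ y) \<otimes> z t)"
      using Z.boundary_eq[OF z] by (simp add: X.list_boundary_def)
    also have "\<dots> = (\<Oplus>t\<in>(\<lambda>(x1, y1). x1 @ y1) ` T. path_boundary R t (x @ y) \<otimes> z t)"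
    proof (rule X.add.finprod_mono_neutral_cong_right)
      show "finite (paths (X \<union> Y) ?N)" using finite_paths[OF Z.finite_V] .
      show "(\<lambda>(x1, y1). x1 @ y1) ` T \<subseteq> paths (X \<union> Y) ?N" by (auto simp: T_def paths_def)
      show "path_boundary R t (x @ y) \<otimes> z t = \<zero>"
        if t: "t \<in> paths (X \<union> Y) ?N - (\<lambda>(x1, y1). x1 @ y1) ` T" for t
      proof -
        have "z t = \<zero>"
        proof (rule ccontr)
          assume "z t \<noteq> \<zero>"
          then have "t \<in> PZ" using z(2) by blast
          then obtain x1 y1 where "t = x1 @ y1" "set x1 \<subseteq> X" "set y1 \<subseteq> Y" using joinE by metis
          moreover from this have "(x1, y1) \<in> T" using t by (simp add: T_def paths_def)
          ultimately show False using t by force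
        qed
        then show ?thesis by simp
      qed
    qed (use z(1) in auto)
    also have "\<dots> = (\<Oplus>q\<in>T. path_boundary R (case q of (x1, y1) \<Rightarrow> x1 @ y1) (x @ y) \<otimes> z (case q of (x1, y1) \<Rightarrow> x1 @ y1))"
      using injT z(1) by (intro X.add.finprod_reindex) auto
    also have "\<dots> = (\<Oplus>q\<in>T. ?A q \<oplus> ?B q)"
    proof (rule X.add.finprod_cong')
      fix q assume q: "q \<in> T"
      obtain x1 y1 where q1: "q = (x1, y1)" by force
      show "path_boundary R (case q of (x1, y1) \<Rightarrow> x1 @ y1) (x @ y) \<otimes> z (case q of (x1, y1) \<Rightarrow> x1 @ y1) = ?A q \<oplus> ?B q"
      proof (cases "w (x1, y1) = \<zero>")
        case True
        then show ?thesis using q wz by (simp add: q1)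
      next
        case nz: False
        then have P: "x1 \<in> PX" "y1 \<in> PY" using wP by blast+
        have s: "set x1 \<subseteq> X" "set y1 \<subseteq> Y" using P X.vertices Y.vertices by blast+
        have pb: "path_boundary R (x1 @ y1) (x @ y) = (if y = y1 then path_boundary R x1 x else \<zero>) \<oplus>
            (if x = x1 then ring_sign R (degX x) \<otimes> path_boundary R y1 y else \<zero>)"
          using X.path_boundary_append[OF disjoint s(1) _ s(2) _ X.path_distinct_adj[OF P(1)]
              Y.path_distinct_adj[OF P(2)], of x y] True by simp
        have "z (x1 @ y1) = w (x1, y1)" using wz q by (simp add: q1)
        then show ?thesis using w by (simp add: q1 pb X.l_distr)
      qed
    qed (use cl in auto)
    also have "\<dots> = (\<Oplus>q\<in>T. ?A q) \<oplus> (\<Oplus>q\<in>T. ?B q)"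
      using cl by (intro X.finsum_addf) auto
    also have "(\<Oplus>q\<in>T. ?A q) = (\<Oplus>q\<in>(\<lambda>x1. (x1, y)) ` paths X (Suc (length x)). ?A q)"
      using cl True w by (intro X.add.finprod_mono_neutral_cong_right finT)
        (auto simp: T_def paths_def image_iff)
    also have "\<dots> = (\<Oplus>x1\<in>paths X (Suc (length x)). ?A (x1, y))"
      using cl by (intro X.add.finprod_reindex) (auto simp: inj_on_def)
    also have "\<dots> = on_left (X.list_boundary X) w (x, y)"
      by (simp add: on_left_def X.list_boundary_def)
    also have "(\<Oplus>q\<in>T. ?B q) = (\<Oplus>q\<in>(\<lambda>y1. (x, y1)) ` paths Y (Suc (length y)). ?B q)"
    proof (rule X.add.finprod_mono_neutral_cong_right[OF finT])
      fix q assume q: "q \<in> T - (\<lambda>y1. (x, y1)) ` paths Y (Suc (length y))"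
      obtain x1 y1 where q1: "q = (x1, y1)" by force
      have "x \<noteq> x1" using q by (auto simp: q1 T_def paths_def)
      then show "?B q = \<zero>" using w by (simp add: q1)
    qed (use cl True in \<open>auto simp: T_def paths_def\<close>)
    also have "\<dots> = (\<Oplus>y1\<in>paths Y (Suc (length y)). ?B (x, y1))"
      using cl by (intro X.add.finprod_reindex) (auto simp: inj_on_def)
    also have "\<dots> = (\<Oplus>y1\<in>paths Y (Suc (length y)). ring_sign R (degX x) \<otimes> (path_boundary R y1 y \<otimes> w (x, y1)))"
      using w by (intro X.add.finprod_cong') (auto simp: X.m_assoc)
    also have "\<dots> = X.twist degX (on_right (X.list_boundary Y) w) (x, y)"
      using w fY by (simp add: X.twist_def on_right_def X.list_boundary_def X.finsum_rdistr)
    finally have "boundary R z (x @ y) = pair_boundary w (x, y)" by (simp add: pair_boundary_def)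
    moreover have "unjoin (boundary R z) (x, y) = boundary R z (x @ y)"
      using True by (simp add: unjoin_def)
    ultimately show ?thesis by (simp add: p flip: w_def)
  qed
qed

lemma W_subspace: "X.function_subspace (W r)"
  by (intro X.total_subspace X.Omega_subspace Y.Omega_subspace)

lemma W_slices:
  assumes "w \<in> W r"
  shows "(\<lambda>x. w (x, y)) \<in> X.\<Omega> (r - degY y - 1)" "(\<lambda>y. w (x, y)) \<in> Y.\<Omega> (r - degX x)"
  using assms by (simp_all add: X.total_def)

lemma W_nonzeroD:
  assumes "w \<in> W r" "w (x, y) \<noteq> \<zero>"
  shows "x \<in> PX" "y \<in> PY" "int (length x) + int (length y) = r + 1"
proof -
  have "x \<in> PX \<and> int (length x) = r - degY y - 1 + 1"
    using W_slices(1)[OF assms(1), of y] assms(2) unfolding X.Omega_iff by blast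
  then show "x \<in> PX" "int (length x) + int (length y) = r + 1" by auto
  show "y \<in> PY"
    using W_slices(2)[OF assms(1), of x] assms(2) unfolding Y.Omega_iff by blast
qed

text \<open>
  The main step.  Suppose that the boundary of the column at \<open>y\<close> is not zero at \<open>x\<close>.  If \<open>x\<close> were not
  allowed then the row at \<open>x\<close> would be zero, and the boundary of \<open>z\<close> would have the same non-zero value
  at \<open>x @ y\<close>, which is not an allowed path either.  Rows are treated alike.
\<close>

lemma unjoin_in:
  assumes z: "z \<in> Z.\<Omega> r"
  shows "unjoin z \<in> W r"
proof -
  define w where "w = unjoin z"
  have zs: "X.scalar_valued z" "\<And>t. z t \<noteq> \<zero> \<Longrightarrow> t \<in> PZ \<and> int (length t) = r + 1"
    and bz: "\<And>t. boundary R z t \<noteq> \<zero> \<Longrightarrow> t \<in> PZ"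
    using z by (auto simp: Z.Omega_iff)
  have w: "X.scalar_valued w" using zs(1) by (auto simp: w_def unjoin_def intro!: X.scalar_valuedI)
  have sl: "X.scalar_valued (\<lambda>x. w (x, y))" "X.scalar_valued (\<lambda>y. w (x, y))" for x y
    by (rule X.slice_scalar[OF w])+
  have wP: "x \<in> PX" "y \<in> PY" "int (length x) + int (length y) = r + 1" if "w (x, y) \<noteq> \<zero>" for x y
    using that zs(2)[of "x @ y"] append_in_PZ by (auto simp: w_def unjoin_def split: if_splits)
  have pb: "x \<in> PX \<and> y \<in> PY" if "pair_boundary w (x, y) \<noteq> \<zero>" for x y
  proof -
    have "unjoin (boundary R z) (x, y) \<noteq> \<zero>"
      using that unjoin_boundary[OF zs] by (simp add: w_def)
    then have "set x \<subseteq> X" "set y \<subseteq> Y" "boundary R z (x @ y) \<noteq> \<zero>"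
      by (auto simp: unjoin_def split: if_splits)
    then show ?thesis using bz append_in_PZ by blast
  qed
  have pair: "pair_boundary w (x, y) = X.list_boundary X (\<lambda>x'. w (x', y)) x \<oplus>
      ring_sign R (degX x) \<otimes> X.list_boundary Y (\<lambda>y'. w (x, y')) y" for x y
    by (simp add: pair_boundary_def on_left_def on_right_def X.twist_def)
  have "(\<lambda>x. w (x, y)) \<in> X.\<Omega> (r - degY y - 1)" for y
  proof -
    let ?u = "\<lambda>x. w (x, y)"
    have bd: "boundary R ?u = X.list_boundary X ?u"
      using wP(1,3)[of _ y] sl by (intro X.boundary_eq[of _ "r + 1 - int (length y)"]) force+
    have "x \<in> PX \<and> int (length x) = r - degY y - 1" if nz: "X.list_boundary X ?u x \<noteq> \<zero>" for x
    proof -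
      obtain x1 where x1: "w (x1, y) \<noteq> \<zero>" "path_boundary R x1 x \<noteq> \<zero>"
        using X.list_boundary_nonzeroD[OF sl(1) nz] by blast
      have "x \<in> PX"
      proof (rule ccontr)
        assume x: "x \<notin> PX"
        then have "(\<lambda>y'. w (x, y')) = (\<lambda>y. \<zero>)" using wP(1) by blast
        then have "pair_boundary w (x, y) = X.list_boundary X ?u x"
          using X.operator_closed[OF X.bd_local sl(1)[of y]]
          by (simp add: pair X.operator_zero[OF Y.bd_local])
        then show False using pb[of x y] nz x by simp
      qed
      then show ?thesis using X.path_boundary_nonzeroD(1)[OF x1(2)] wP(3)[OF x1(1)] by simp
    qed
    then show ?thesis using wP(1,3)[of _ y] sl unfolding X.Omega_iff bd by force
  qed
  moreover have "(\<lambda>y. w (x, y)) \<in> Y.\<Omega> (r - degX x)" for x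
  proof -
    let ?u = "\<lambda>y. w (x, y)"
    have bd: "boundary R ?u = X.list_boundary Y ?u"
      using wP(2,3)[of x] sl by (intro Y.boundary_eq[of _ "r + 1 - int (length x)"]) force+
    have "y \<in> PY \<and> int (length y) = r - degX x" if nz: "X.list_boundary Y ?u y \<noteq> \<zero>" for y
    proof -
      obtain y1 where y1: "w (x, y1) \<noteq> \<zero>" "path_boundary R y1 y \<noteq> \<zero>"
        using X.list_boundary_nonzeroD[OF sl(2) nz] by blast
      have "y \<in> PY"
      proof (rule ccontr)
        assume y: "y \<notin> PY"
        then have "(\<lambda>x'. w (x', y)) = (\<lambda>y. \<zero>)" using wP(2) by blast
        then have "pair_boundary w (x, y) = ring_sign R (degX x) \<otimes> X.list_boundary Y ?u y"
          using X.operator_closed[OF Y.bd_local sl(2)[of x]]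
          by (simp add: pair X.operator_zero[OF X.bd_local])
        then have "pair_boundary w (x, y) \<noteq> \<zero>"
          using nz X.operator_closed[OF Y.bd_local sl(2)[of x], of y]
          by (auto simp: ring_sign_def X.l_minus)
        then show False using pb[of x y] y by simp
      qed
      then show ?thesis using X.path_boundary_nonzeroD(1)[OF y1(2)] wP(3)[OF y1(1)] by simp
    qed
    then show ?thesis using wP(2,3)[of x] sl unfolding Y.Omega_iff bd by force
  qed
  ultimately show ?thesis by (simp add: X.total_def w_def)
qed

lemma
  assumes w: "w \<in> W r"
  shows join_in: "join w \<in> Z.\<Omega> r"
    and boundary_join: "boundary R (join w) = join (pair_boundary w)"
    and unjoin_join_W: "unjoin (join w) = w"
proof -
  have wP: "x \<in> PX \<and> y \<in> PY" if "w (x, y) \<noteq> \<zero>" for x y using W_nonzeroD[OF w that] by blast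
  show uj: "unjoin (join w) = w" by (rule unjoin_join[OF wP])
  have ws: "X.scalar_valued w" by (rule X.subspace_scalar[OF W_subspace w])
  then have zs: "X.scalar_valued (join w)" by (auto simp: join_def intro!: X.scalar_valuedI)
  have zP: "t \<in> PZ \<and> int (length t) = r + 1" if nz: "join w t \<noteq> \<zero>" for t
  proof -
    obtain x y where xy: "t = x @ y" "w (x, y) \<noteq> \<zero>" "set x \<subseteq> X" "set y \<subseteq> Y"
      using join_nonzeroD[OF wP nz] by metis
    then show ?thesis using W_nonzeroD[OF w xy(2)] append_in_PZ by auto
  qed
  have bP: "\<exists>x y. t = x @ y \<and> set x \<subseteq> X \<and> set y \<subseteq> Y" if nz: "boundary R (join w) t \<noteq> \<zero>" for t
  proof -
    have "X.list_boundary (X \<union> Y) (join w) t \<noteq> \<zero>" using nz Z.boundary_eq[OF zs zP] by simp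
    then obtain s where s: "join w s \<noteq> \<zero>" "path_boundary R s t \<noteq> \<zero>"
      using X.list_boundary_nonzeroD[OF zs] by blast
    obtain q where q: "t = remove_nth q s" using X.path_boundary_nonzero[OF s(2)] by blast
    obtain x y where "s = x @ y" "set x \<subseteq> X" "set y \<subseteq> Y"
      using join_nonzeroD[OF wP s(1)] by metis
    then have "t = (if q < length x then remove_nth q x @ y else x @ remove_nth (q - length x) y)"
      and "set (remove_nth q x) \<subseteq> X" "set (remove_nth (q - length x) y) \<subseteq> Y" "set x \<subseteq> X" "set y \<subseteq> Y"
      using set_remove_nth[of q x] set_remove_nth[of "q - length x" y] by (auto simp: q remove_nth_append)
    then show ?thesis by (cases "q < length x") auto
  qed
  have ub: "unjoin (boundary R (join w)) = pair_boundary w"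
    using unjoin_boundary[OF zs zP] by (simp add: uj)
  show "boundary R (join w) = join (pair_boundary w)"
    using join_unjoin[of "boundary R (join w)"] bP by (simp add: ub)
  have "t \<in> PZ \<and> int (length t) = r" if nz: "boundary R (join w) t \<noteq> \<zero>" for t
  proof -
    obtain x y where t: "t = x @ y" and xy: "set x \<subseteq> X" "set y \<subseteq> Y" using bP[OF nz] by blast
    then have "unjoin (boundary R (join w)) (x, y) \<noteq> \<zero>" using nz by (simp add: unjoin_def)
    then have "pair_boundary w (x, y) \<noteq> \<zero>" by (simp add: ub)
    then have "\<not> (X.list_boundary X (\<lambda>x'. w (x', y)) x = \<zero> \<and> X.list_boundary Y (\<lambda>y'. w (x, y')) y = \<zero>)"
      by (auto simp: pair_boundary_def on_left_def on_right_def X.twist_def)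
    then consider "X.list_boundary X (\<lambda>x'. w (x', y)) x \<noteq> \<zero>" | "X.list_boundary Y (\<lambda>y'. w (x, y')) y \<noteq> \<zero>"
      by blast
    then have "x \<in> PX \<and> y \<in> PY \<and> int (length x) + int (length y) = r"
    proof cases
      case 1
      note sl = W_slices(1)[OF w, of y]
      have "x \<in> PX" "int (length x) = r - degY y - 1"
        using sl 1 unfolding X.Omega_boundary_eq[OF sl, symmetric] X.Omega_iff by blast+
      moreover obtain x1 where "w (x1, y) \<noteq> \<zero>"
        using X.list_boundary_nonzeroD[OF X.subspace_scalar[OF X.Omega_subspace sl] 1] by blast
      ultimately show ?thesis using wP by auto
    next
      case 2
      note sl = W_slices(2)[OF w, of x]
      have "y \<in> PY" "int (length y) = r - degX x"
        using sl 2 unfolding Y.Omega_boundary_eq[OF sl, symmetric] Y.Omega_iff by blast+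
      moreover obtain y1 where "w (x, y1) \<noteq> \<zero>"
        using X.list_boundary_nonzeroD[OF X.subspace_scalar[OF Y.Omega_subspace sl] 2] by blast
      ultimately show ?thesis using wP by auto
    qed
    then show ?thesis using t xy append_in_PZ by auto
  qed
  then show "join w \<in> Z.\<Omega> r" using zs zP by (auto simp: Z.Omega_iff)
qed

lemma join_unjoin_Omega: "z \<in> Z.\<Omega> r \<Longrightarrow> join (unjoin z) = z"
  by (rule join_unjoin) (metis joinE Z.Omega_iff)

lemma join_iso: "linear_iso R (X.function_space (W r)) (Omega R (X \<union> Y) PZ r) join"
proof -
  have "linear_map R (X.function_space (W r)) (X.function_space (Z.\<Omega> r)) join"
    by (rule X.linear_mapI) (auto simp: W_subspace Z.Omega_subspace join_in, auto simp: join_def)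
  moreover have "bij_betw join (W r) (Z.\<Omega> r)"
    by (rule bij_betw_byWitness[where f' = unjoin])
      (auto simp: unjoin_join_W join_unjoin_Omega join_in unjoin_in)
  ultimately have "linear_iso R (X.function_space (W r)) (X.function_space (Z.\<Omega> r)) join"
    by (simp add: linear_iso_def)
  then show ?thesis by (subst Z.Omega_eq)
qed

lemma join_chains_eq:
  assumes u: "u \<in> X.\<Omega> p" and v: "v \<in> Y.\<Omega> q"
  shows "join_chains R u v = join (\<lambda>(x, y). u x \<otimes> v y)"
proof
  fix z
  have uX: "X.scalar_valued u" "\<And>x. u x \<noteq> \<zero> \<Longrightarrow> set x \<subseteq> X" "\<And>x. u x \<noteq> \<zero> \<Longrightarrow> int (length x) = p + 1"
    and vY: "X.scalar_valued v" "\<And>y. v y \<noteq> \<zero> \<Longrightarrow> set y \<subseteq> Y" "\<And>y. v y \<noteq> \<zero> \<Longrightarrow> int (length y) = q + 1"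
    using u v X.vertices Y.vertices by (auto simp: X.Omega_iff Y.Omega_iff)
  have finu: "finite {x. u x \<noteq> \<zero>}"
    using finite_paths[OF X.finite_V, of "nat (p + 1)"]
    by (rule rev_finite_subset) (auto simp: paths_def uX(3)[symmetric] dest: uX(2))
  have finv: "finite {y. v y \<noteq> \<zero>}"
    using finite_paths[OF Y.finite_V, of "nat (q + 1)"]
    by (rule rev_finite_subset) (auto simp: paths_def vY(3)[symmetric] dest: vY(2))
  have eq: "join_chains R u v z = (\<Oplus>x\<in>{x. u x \<noteq> \<zero>}. u x \<otimes>
      (\<Oplus>y\<in>{y. v y \<noteq> \<zero>}. v y \<otimes> basis_vec R (x @ y) z))"
    by (simp add: join_chains_def lin_ext_def)
  show "join_chains R u v z = join (\<lambda>(x, y). u x \<otimes> v y) z"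
  proof (cases "\<exists>x y. z = x @ y \<and> set x \<subseteq> X \<and> set y \<subseteq> Y")
    case True
    then obtain x0 y0 where z: "z = x0 @ y0" and s: "set x0 \<subseteq> X" "set y0 \<subseteq> Y" by blast
    have bv: "basis_vec R (x @ y) z = (if x = x0 \<and> y = y0 then \<one> else \<zero>)"
      if "u x \<noteq> \<zero>" "v y \<noteq> \<zero>" for x y
      using disjoint_append_eq[OF disjoint s(1) uX(2)[OF that(1)] s(2) vY(2)[OF that(2)]]
      by (auto simp: basis_vec_def z)
    have inner: "(\<Oplus>y\<in>{y. v y \<noteq> \<zero>}. v y \<otimes> basis_vec R (x @ y) z) = (if x = x0 then v y0 else \<zero>)"
      if x: "u x \<noteq> \<zero>" for x
    proof -
      have "(\<Oplus>y\<in>{y. v y \<noteq> \<zero>}. v y \<otimes> basis_vec R (x @ y) z) =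
          (\<Oplus>y\<in>{y. v y \<noteq> \<zero>}. if y = y0 then (if x = x0 then v y0 else \<zero>) else \<zero>)"
        using vY(1) by (intro X.add.finprod_cong') (auto simp: bv[OF x])
      also have "\<dots> = (if x = x0 then v y0 else \<zero>)"
      proof (cases "v y0 = \<zero>")
        case True
        then show ?thesis by (simp add: X.add.finprod_one_eqI)
      next
        case False
        then show ?thesis using vY(1) finv by (intro X.finsum_if_single) auto
      qed
      finally show ?thesis .
    qed
    have "join_chains R u v z = (\<Oplus>x\<in>{x. u x \<noteq> \<zero>}. if x = x0 then u x0 \<otimes> v y0 else \<zero>)"
      unfolding eq using uX(1) vY(1) by (intro X.add.finprod_cong') (auto simp: inner)
    also have "\<dots> = u x0 \<otimes> v y0"
    proof (cases "u x0 = \<zero>")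
      case True
      then show ?thesis using vY(1) by (simp add: X.add.finprod_one_eqI)
    next
      case False
      then show ?thesis using uX(1) vY(1) finu by (intro X.finsum_if_single) auto
    qed
    finally show ?thesis using join_append[OF s] by (simp add: z)
  next
    case False
    have "basis_vec R (x @ y) z = \<zero>" if "u x \<noteq> \<zero>" "v y \<noteq> \<zero>" for x y
      using False uX(2)[OF that(1)] vY(2)[OF that(2)] by (auto simp: basis_vec_def)
    then have "(\<Oplus>y\<in>{y. v y \<noteq> \<zero>}. v y \<otimes> basis_vec R (x @ y) z) = \<zero>" if "u x \<noteq> \<zero>" for x
      using that vY(1) by (intro X.add.finprod_one_eqI) auto
    then have "join_chains R u v z = \<zero>"
      unfolding eq using uX(1) by (intro X.add.finprod_one_eqI) auto
    moreover have "join (\<lambda>(x, y). u x \<otimes> v y) z = \<zero>"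
    proof (rule ccontr)
      let ?x = "takeWhile (\<lambda>a. a \<in> X) z" and ?y = "dropWhile (\<lambda>a. a \<in> X) z"
      assume "join (\<lambda>(x, y). u x \<otimes> v y) z \<noteq> \<zero>"
      then have "u ?x \<noteq> \<zero>" "v ?y \<noteq> \<zero>" using uX(1) vY(1) by (auto simp: join_def)
      then have "set ?x \<subseteq> X" "set ?y \<subseteq> Y" using uX(2) vY(2) by auto
      moreover have "z = ?x @ ?y" by simp
      ultimately show False using False by blast
    qed
    ultimately show ?thesis by simp
  qed
qed

section \<open>The chain isomorphism\<close>

abbreviation "TC \<equiv> tensor_complex R (shift_complex (Omega_complex R X PX)) (Omega_complex R Y PY)"
abbreviation "summands \<equiv> \<lambda>(p, q). tensor_product R (Omega R X PX (p - 1)) (Omega R Y PY q)"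

text \<open>
  All spaces \<open>\<Omega>\<close> are function spaces themselves, so one map serves all bidegrees.
\<close>

definition to_mat :: "(('v list \<Rightarrow> 'a) \<times> ('v list \<Rightarrow> 'a) \<Rightarrow> 'a) set \<Rightarrow> 'v list \<times> 'v list \<Rightarrow> 'a" where
  "to_mat = matrix_tensor.to_matrix R id id"

lemma Omega_matrix_tensor:
  "\<exists>D b. matrix_tensor R (Omega R X PX p) (Omega R Y PY q) id id (X.\<Omega> p) (Y.\<Omega> q) D b"
proof -
  have "u x \<noteq> \<zero> \<Longrightarrow> x \<in> paths X (nat (p + 1))" if "u \<in> X.\<Omega> p" for u x
  proof -
    assume "u x \<noteq> \<zero>"
    then have "x \<in> PX" "int (length x) = p + 1" using that by (auto simp: X.Omega_iff)
    then show "x \<in> paths X (nat (p + 1))" using X.vertices by (simp add: paths_def flip: nat_eq_iff)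
  qed
  then obtain D b where "X.echelon_basis (X.\<Omega> p) D b"
    using X.echelon_basis_exists[OF finite_paths[OF X.finite_V] X.Omega_subspace] by blast
  then show ?thesis
    using X.Omega_subspace Y.Omega_subspace X.Omega_iso Y.Omega_iso X.field_axioms
    by (auto simp: matrix_tensor_def matrix_tensor_axioms_def)
qed

lemma
  shows to_mat_iso: "linear_iso R (tensor_product R (Omega R X PX p) (Omega R Y PY q))
      (X.function_space (matrices (X.\<Omega> p) (Y.\<Omega> q))) to_mat"
    and to_mat_pure: "u \<in> X.\<Omega> p \<Longrightarrow> v \<in> Y.\<Omega> q \<Longrightarrow>
      to_mat (pure_tensor R (Omega R X PX p) (Omega R Y PY q) u v) = (\<lambda>(x, y). u x \<otimes> v y)"
proof -
  obtain D b where "matrix_tensor R (Omega R X PX p) (Omega R Y PY q) id id (X.\<Omega> p) (Y.\<Omega> q) D b"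
    using Omega_matrix_tensor by blast
  then interpret m: matrix_tensor R "Omega R X PX p" "Omega R Y PY q" id id "X.\<Omega> p" "Y.\<Omega> q" D b .
  show "linear_iso R (tensor_product R (Omega R X PX p) (Omega R Y PY q))
      (X.function_space (matrices (X.\<Omega> p) (Y.\<Omega> q))) to_mat"
    using m.to_matrix_iso by (simp add: to_mat_def)
  show "u \<in> X.\<Omega> p \<Longrightarrow> v \<in> Y.\<Omega> q \<Longrightarrow>
      to_mat (pure_tensor R (Omega R X PX p) (Omega R Y PY q) u v) = (\<lambda>(x, y). u x \<otimes> v y)"
    unfolding to_mat_def by (simp add: m.to_matrix_pure m.rank_one_def)
qed

text \<open>
  The component of \<open>t\<close> that matters at \<open>(x, y)\<close> is the one in the bidegree of \<open>(x, y)\<close>.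
\<close>

definition tensor_to_pairs :: "int \<Rightarrow> (int \<times> int \<Rightarrow> (('v list \<Rightarrow> 'a) \<times> ('v list \<Rightarrow> 'a) \<Rightarrow> 'a) set) \<Rightarrow> 'v list \<times> 'v list \<Rightarrow> 'a" where
  "tensor_to_pairs r t = (\<lambda>(x, y). if degX x + degY y = r then to_mat (t (degX x, degY y)) (x, y) else \<zero>)"

lemma Omega_direct_sum:
  fixes a r :: int and I
  assumes I: "\<And>p q. (p, q) \<in> I \<Longrightarrow> p + a + q = r"
    "\<And>p q. (p, q) \<notin> I \<Longrightarrow> p + a + q = r \<Longrightarrow> p + a < 0 \<or> q < - 1"
  shows "linear_iso R (direct_sum_space I (\<lambda>(p, q). tensor_product R (Omega R X PX (p + a - 1)) (Omega R Y PY q)))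
      (X.function_space (W r)) (\<lambda>t (x, y). if (degX x - a, degY y) \<in> I then to_mat (t (degX x - a, degY y)) (x, y) else \<zero>)"
    (is "linear_iso R ?S _ ?f")
    and "carrier (direct_sum_space I (\<lambda>(p, q). tensor_product R (Omega R X PX (p + a - 1)) (Omega R Y PY q))) =
      (\<Pi>\<^sub>E k\<in>I. carrier (case k of (p, q) \<Rightarrow> tensor_product R (Omega R X PX (p + a - 1)) (Omega R Y PY q)))"
proof -
  interpret CX: function_complex R degX "\<lambda>n. X.\<Omega> (n - 1)" "X.list_boundary X"
    using X.Omega_function_complex[of 0] by simp
  interpret CY: function_complex R degY Y.\<Omega> "X.list_boundary Y"
    using Y.Omega_function_complex[of 1] by simp
  have 3: "(\<forall>u\<in>X.\<Omega> (p + a - 1). u = (\<lambda>x. \<zero>)) \<or> (\<forall>v\<in>Y.\<Omega> q. v = (\<lambda>y. \<zero>))"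
    if "(p, q) \<notin> I" "p + a + q = r" for p q
    using I(2)[OF that] X.Omega_below[of _ "p + a - 1"] Y.Omega_below[of _ q] by force
  have lX: "\<And>n u. n < 0 \<Longrightarrow> u \<in> X.\<Omega> (n - 1) \<Longrightarrow> u = (\<lambda>x. \<zero>)" using X.Omega_below by force
  have 1: "(p, q) \<in> I \<Longrightarrow> linear_iso R (Omega R X PX (p + a - 1)) (X.function_space (X.\<Omega> (p + a - 1))) id"
    and 2: "(p, q) \<in> I \<Longrightarrow> linear_iso R (Omega R Y PY q) (X.function_space (Y.\<Omega> q)) id" for p q
    by (rule X.Omega_iso Y.Omega_iso)+
  have lY: "\<And>n u. n < - 1 \<Longrightarrow> u \<in> Y.\<Omega> n \<Longrightarrow> u = (\<lambda>x. \<zero>)" using Y.Omega_below by blast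
  note P = CX.U CY.U CX.degree CY.degree lX lY CX.finite_support 1 2 I(1) 3
  have f: "?f = X.assemble degX degY (\<lambda>_. id) (\<lambda>_. id) I a"
    by (auto simp: to_mat_def fun_eq_iff X.assemble_eq)
  show "linear_iso R ?S (X.function_space (W r)) ?f"
    unfolding f by (rule X.direct_sum_tensor_iso) (fact P)+
  show "carrier ?S = (\<Pi>\<^sub>E k\<in>I. carrier (case k of (p, q) \<Rightarrow> tensor_product R (Omega R X PX (p + a - 1)) (Omega R Y PY q)))"
    by (rule X.direct_sum_tensor_carrier) (fact P)+
qed

lemma TC_chains: "chains TC r = direct_sum_space {(p, q). p + q = r} summands"
  by (simp add: tensor_complex_def tensor_summand_def shift_complex_def Omega_complex_def)

lemma
  shows tensor_to_pairs_iso: "linear_iso R (chains TC r) (X.function_space (W r)) (tensor_to_pairs r)"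
    and TC_carrier: "carrier (chains TC r) = (\<Pi>\<^sub>E k\<in>{(p, q). p + q = r}. carrier (summands k))"
proof -
  have "tensor_to_pairs r = (\<lambda>t (x, y). if (degX x - 0, degY y) \<in> {(p, q). p + q = r}
      then to_mat (t (degX x - 0, degY y)) (x, y) else \<zero>)"
    by (auto simp: tensor_to_pairs_def fun_eq_iff)
  then show "linear_iso R (chains TC r) (X.function_space (W r)) (tensor_to_pairs r)"
    using Omega_direct_sum(1)[of "{(p, q). p + q = r}" 0 r] by (simp add: TC_chains)
  show "carrier (chains TC r) = (\<Pi>\<^sub>E k\<in>{(p, q). p + q = r}. carrier (summands k))"
    using Omega_direct_sum(2)[of "{(p, q). p + q = r}" 0 r] by (simp add: TC_chains)
qed

lemma left_boundary_tensor_map: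
  assumes "C \<in> carrier (tensor_product R (Omega R X PX p) (Omega R Y PY q))"
  defines "C' \<equiv> tensor_map R (Omega R X PX (p - 1)) (Omega R Y PY q) (boundary R) id C"
  shows "C' \<in> carrier (tensor_product R (Omega R X PX (p - 1)) (Omega R Y PY q))"
    and "to_mat C' = on_left (X.list_boundary X) (to_mat C)"
proof -
  obtain D b where A: "matrix_tensor R (Omega R X PX p) (Omega R Y PY q) id id (X.\<Omega> p) (Y.\<Omega> q) D b"
    using Omega_matrix_tensor by blast
  obtain D' b' where B: "matrix_tensor R (Omega R X PX (p - 1)) (Omega R Y PY q) id id (X.\<Omega> (p - 1)) (Y.\<Omega> q) D' b'"
    using Omega_matrix_tensor by blast
  note sc = X.subspace_scalar[OF X.matrices_subspace[OF X.Omega_subspace Y.Omega_subspace]]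
  have rank: "on_left (X.list_boundary X) (\<lambda>(x, y). id m x \<otimes> id n y) =
      (\<lambda>(x, y). id (boundary R m) x \<otimes> id (id n) y)" if m: "m \<in> X.\<Omega> p" and n: "n \<in> Y.\<Omega> q" for m n
  proof -
    have ms: "X.scalar_valued m" and nc: "n y \<in> carrier R" for y
      using m n by (auto simp: X.Omega_iff Y.Omega_iff)
    have "X.list_boundary X (\<lambda>x. m x \<otimes> n y) x = X.list_boundary X m x \<otimes> n y" for x y
    proof -
      have "(\<lambda>x. m x \<otimes> n y) = (\<lambda>x. n y \<otimes> m x)" using ms nc by (auto simp: X.m_comm)
      then show ?thesis
        using X.operator_smult[OF X.bd_local nc ms, of y] X.operator_closed[OF X.bd_local ms] nc
        by (simp add: X.m_comm)
    qed
    then show ?thesis by (simp add: on_left_def X.Omega_boundary_eq[OF m])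
  qed
  note P = A B X.boundary_in _ X.on_left_zero[OF X.bd_local] X.on_left_add[OF X.bd_local sc sc]
    X.on_left_smult[OF X.bd_local _ sc] rank assms(1)
  note inst = X.tensor_map_closed[where f = "boundary R" and g = id and \<Theta> = "on_left (X.list_boundary X)"]
    X.to_matrix_tensor_map[where f = "boundary R" and g = id and \<Theta> = "on_left (X.list_boundary X)"]
  show "C' \<in> carrier (tensor_product R (Omega R X PX (p - 1)) (Omega R Y PY q))"
    unfolding C'_def by (rule inst(1)[OF P]) auto
  show "to_mat C' = on_left (X.list_boundary X) (to_mat C)"
    unfolding C'_def to_mat_def by (rule inst(2)[OF P]) auto
qed

lemma right_boundary_tensor_map:
  assumes "C \<in> carrier (tensor_product R (Omega R X PX p) (Omega R Y PY q))"
  defines "C' \<equiv> tensor_map R (Omega R X PX p) (Omega R Y PY (q - 1)) id (boundary R) C"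
  shows "C' \<in> carrier (tensor_product R (Omega R X PX p) (Omega R Y PY (q - 1)))"
    and "to_mat C' = on_right (X.list_boundary Y) (to_mat C)"
proof -
  obtain D b where A: "matrix_tensor R (Omega R X PX p) (Omega R Y PY q) id id (X.\<Omega> p) (Y.\<Omega> q) D b"
    using Omega_matrix_tensor by blast
  obtain D' b' where B: "matrix_tensor R (Omega R X PX p) (Omega R Y PY (q - 1)) id id (X.\<Omega> p) (Y.\<Omega> (q - 1)) D' b'"
    using Omega_matrix_tensor by blast
  note sc = X.subspace_scalar[OF X.matrices_subspace[OF X.Omega_subspace Y.Omega_subspace]]
  have rank: "on_right (X.list_boundary Y) (\<lambda>(x, y). id m x \<otimes> id n y) =
      (\<lambda>(x, y). id (id m) x \<otimes> id (boundary R n) y)" if m: "m \<in> X.\<Omega> p" and n: "n \<in> Y.\<Omega> q" for m n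
  proof -
    have ns: "X.scalar_valued n" and mc: "m x \<in> carrier R" for x
      using m n by (auto simp: X.Omega_iff Y.Omega_iff)
    show ?thesis
      using X.operator_smult[OF Y.bd_local mc ns]
      by (simp add: on_right_def Y.Omega_boundary_eq[OF n])
  qed
  note P = A B _ Y.boundary_in X.on_right_zero[OF Y.bd_local] X.on_right_add[OF Y.bd_local sc sc]
    X.on_right_smult[OF Y.bd_local _ sc] rank assms(1)
  note inst = X.tensor_map_closed[where f = id and g = "boundary R" and \<Theta> = "on_right (X.list_boundary Y)"]
    X.to_matrix_tensor_map[where f = id and g = "boundary R" and \<Theta> = "on_right (X.list_boundary Y)"]
  show "C' \<in> carrier (tensor_product R (Omega R X PX p) (Omega R Y PY (q - 1)))"
    unfolding C'_def by (rule inst(1)[OF P]) auto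
  show "to_mat C' = on_right (X.list_boundary Y) (to_mat C)"
    unfolding C'_def to_mat_def by (rule inst(2)[OF P]) auto
qed

lemma TC_bdry:
  assumes "p + q = r - 1"
  shows "bdry TC r t (p, q) = tensor_map R (Omega R X PX (p - 1)) (Omega R Y PY q) (boundary R) id (t (p + 1, q))
    \<oplus>\<^bsub>summands (p, q)\<^esub> (ring_sign R p \<odot>\<^bsub>summands (p, q)\<^esub>
      tensor_map R (Omega R X PX (p - 1)) (Omega R Y PY q) id (boundary R) (t (p, q + 1)))"
  using assms by (simp add: tensor_complex_def tensor_summand_def shift_complex_def Omega_complex_def)

lemma
  assumes t: "t \<in> carrier (chains TC r)" and pq: "p + q = r - 1"
  shows bdry_component_in: "bdry TC r t (p, q) \<in> carrier (summands (p, q))"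
    and to_mat_bdry: "to_mat (bdry TC r t (p, q)) = (\<lambda>c. on_left (X.list_boundary X) (to_mat (t (p + 1, q))) c \<oplus>
      ring_sign R p \<otimes> on_right (X.list_boundary Y) (to_mat (t (p, q + 1))) c)"
proof -
  have t1: "t (p + 1, q) \<in> carrier (tensor_product R (Omega R X PX p) (Omega R Y PY q))"
    and t2: "t (p, q + 1) \<in> carrier (tensor_product R (Omega R X PX (p - 1)) (Omega R Y PY (q + 1)))"
    using t pq PiE_mem[of t "{(p, q). p + q = r}" "\<lambda>k. carrier (summands k)" "(p + 1, q)"]
      PiE_mem[of t "{(p, q). p + q = r}" "\<lambda>k. carrier (summands k)" "(p, q + 1)"]
    unfolding TC_carrier by simp_all
  let ?V = "tensor_product R (Omega R X PX (p - 1)) (Omega R Y PY q)"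
  note l = left_boundary_tensor_map[OF t1]
  note r = right_boundary_tensor_map[OF t2, simplified]
  have lin: "linear_map R ?V (X.function_space (matrices (X.\<Omega> (p - 1)) (Y.\<Omega> q))) to_mat"
    by (rule X.linear_iso_linear[OF to_mat_iso])
  interpret V: vectorspace R ?V by (rule X.linear_map_vs1[OF lin])
  show "bdry TC r t (p, q) \<in> carrier (summands (p, q))"
    unfolding TC_bdry[OF pq] using l(1) r(1) by simp
  show "to_mat (bdry TC r t (p, q)) = (\<lambda>c. on_left (X.list_boundary X) (to_mat (t (p + 1, q))) c \<oplus>
      ring_sign R p \<otimes> on_right (X.list_boundary Y) (to_mat (t (p, q + 1))) c)"
    unfolding TC_bdry[OF pq] using l r
    by (simp add: X.linear_map_add[OF lin] X.linear_map_smult[OF lin])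
qed

lemma bdry_TC_in:
  assumes t: "t \<in> carrier (chains TC r)"
  shows "bdry TC r t \<in> carrier (chains TC (r - 1))"
  unfolding TC_carrier
proof (rule PiE_I)
  fix k assume "k \<in> {(p, q). p + q = r - 1}"
  then show "bdry TC r t k \<in> carrier (summands k)"
    using bdry_component_in[OF t] by (cases k) auto
next
  fix k assume "k \<notin> {(p, q). p + q = r - 1}"
  then show "bdry TC r t k = undefined" by (cases k) (auto simp: tensor_complex_def)
qed

text \<open>
  The boundary of a column \<open>\<lambda>x. w (x, y)\<close> at \<open>x\<close> involves only points of degree \<open>degX x + 1\<close>, at which
  \<open>w\<close> is given by a single component of \<open>t\<close>.
\<close>

lemma tensor_to_pairs_bdry:
  assumes t: "t \<in> carrier (chains TC r)"
  shows "tensor_to_pairs (r - 1) (bdry TC r t) = pair_boundary (tensor_to_pairs r t)"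
proof
  fix c :: "'v list \<times> 'v list" obtain x y where c: "c = (x, y)" by force
  let ?w = "tensor_to_pairs r t"
  have "?w \<in> W r"
    using X.linear_map_closed[OF X.linear_iso_linear[OF tensor_to_pairs_iso] t] by simp
  then have w: "X.scalar_valued ?w" by (rule X.subspace_scalar[OF W_subspace])
  note sw = X.slice_scalar[OF w]
  have pair: "pair_boundary ?w (x, y) = X.list_boundary X (\<lambda>x'. ?w (x', y)) x \<oplus>
      ring_sign R (degX x) \<otimes> X.list_boundary Y (\<lambda>y'. ?w (x, y')) y"
    by (simp add: pair_boundary_def on_left_def on_right_def X.twist_def)
  note congX = X.functional_cong[OF X.local_operatorD[OF X.bd_local, of x] sw(1)]
  note congY = X.functional_cong[OF X.local_operatorD[OF Y.bd_local, of y] sw(2)]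
  show "tensor_to_pairs (r - 1) (bdry TC r t) c = pair_boundary (tensor_to_pairs r t) c"
  proof (cases "degX x + degY y = r - 1")
    case True
    have sc: "X.scalar_valued (to_mat (t (p, q)))" if "p + q = r" for p q
    proof -
      have "t (p, q) \<in> carrier (tensor_product R (Omega R X PX (p - 1)) (Omega R Y PY q))"
        using t that PiE_mem[of t "{(p, q). p + q = r}" "\<lambda>k. carrier (summands k)" "(p, q)"]
        unfolding TC_carrier by simp
      from X.linear_map_closed[OF X.linear_iso_linear[OF to_mat_iso] this]
      have "to_mat (t (p, q)) \<in> matrices (X.\<Omega> (p - 1)) (Y.\<Omega> q)" by simp
      then show ?thesis
        by (rule X.subspace_scalar[OF X.matrices_subspace[OF X.Omega_subspace Y.Omega_subspace]])
    qed
    have "X.list_boundary X (\<lambda>x'. ?w (x', y)) x = X.list_boundary X (\<lambda>x'. to_mat (t (degX x + 1, degY y)) (x', y)) x"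
      using True by (intro congX X.slice_scalar sc) (auto simp: tensor_to_pairs_def)
    moreover have "X.list_boundary Y (\<lambda>y'. ?w (x, y')) y = X.list_boundary Y (\<lambda>y'. to_mat (t (degX x, degY y + 1)) (x, y')) y"
      using True by (intro congY X.slice_scalar sc) (auto simp: tensor_to_pairs_def)
    moreover have "tensor_to_pairs (r - 1) (bdry TC r t) (x, y) = to_mat (bdry TC r t (degX x, degY y)) (x, y)"
      using True by (simp add: tensor_to_pairs_def)
    ultimately show ?thesis
      by (simp only: c pair to_mat_bdry[OF t True] on_left_def on_right_def prod.case)
  next
    case False
    have "X.list_boundary X (\<lambda>x'. ?w (x', y)) x = X.list_boundary X (\<lambda>x'. \<zero>) x"
      using False by (intro congX X.scalar_valuedI) (auto simp: tensor_to_pairs_def)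
    moreover have "X.list_boundary Y (\<lambda>y'. ?w (x, y')) y = X.list_boundary Y (\<lambda>y'. \<zero>) y"
      using False by (intro congY X.scalar_valuedI) (auto simp: tensor_to_pairs_def)
    ultimately show ?thesis
      using False by (simp add: c pair X.operator_zero[OF X.bd_local] X.operator_zero[OF Y.bd_local])
        (simp add: tensor_to_pairs_def)
  qed
qed

lemma join_chain_iso:
  "chain_iso R TC (Omega_complex R (X \<union> Y) PZ) (\<lambda>r. join \<circ> tensor_to_pairs r)"
proof -
  have iso: "linear_iso R (chains TC r) (chains (Omega_complex R (X \<union> Y) PZ) r) (join \<circ> tensor_to_pairs r)" for r
    using X.linear_iso_comp[OF tensor_to_pairs_iso[of r] join_iso[of r]] by (simp add: Omega_complex_def)
  have comm: "(join \<circ> tensor_to_pairs (r - 1)) (bdry TC r t) = bdry (Omega_complex R (X \<union> Y) PZ) r ((join \<circ> tensor_to_pairs r) t)"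
    if t: "t \<in> carrier (chains TC r)" for r t
  proof -
    have "tensor_to_pairs r t \<in> W r"
      using X.linear_map_closed[OF X.linear_iso_linear[OF tensor_to_pairs_iso] t] by simp
    moreover have "bdry (Omega_complex R (X \<union> Y) PZ) r z = boundary R z" for z
      by (simp add: Omega_complex_def)
    ultimately show ?thesis by (simp add: tensor_to_pairs_bdry[OF t] boundary_join)
  qed
  have "chain_complex R TC"
    by (rule X.chain_complex_by_iso[where C = TC and \<phi> = "\<lambda>r. join \<circ> tensor_to_pairs r", OF Z.Omega_chain_complex iso bdry_TC_in comm])
  then show ?thesis
    unfolding chain_iso_def using Z.Omega_chain_complex iso comm by blast
qed

lemma join_chain_iso_tensor:
  assumes u: "u \<in> X.\<Omega> (p - 1)" and v: "v \<in> Y.\<Omega> q"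
  shows "(join \<circ> tensor_to_pairs (p + q)) (complex_tensor R (shift_complex (Omega_complex R X PX)) (Omega_complex R Y PY) p q u v)
    = join_chains R u v"
proof -
  let ?t = "complex_tensor R (shift_complex (Omega_complex R X PX)) (Omega_complex R Y PY) p q u v"
  have t: "?t (p', q') = (if p' = p \<and> q' = q then pure_tensor R (Omega R X PX (p - 1)) (Omega R Y PY q) u v
      else \<zero>\<^bsub>summands (p', q')\<^esub>)" if "p' + q' = p + q" for p' q'
    using that by (simp add: complex_tensor_def direct_sum_inj_def tensor_summand_def shift_complex_def Omega_complex_def)
  have "tensor_to_pairs (p + q) ?t (x, y) = u x \<otimes> v y" for x y
  proof (cases "degX x = p \<and> degY y = q")
    case True
    then show ?thesis using u v by (simp add: tensor_to_pairs_def t to_mat_pure)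
  next
    case False
    have "u x = \<zero> \<or> v y = \<zero>" using u v False by (auto simp: X.Omega_iff Y.Omega_iff)
    then have "u x \<otimes> v y = \<zero>"
      using X.subspace_closed[OF X.Omega_subspace u] X.subspace_closed[OF Y.Omega_subspace v] by auto
    moreover have "to_mat \<zero>\<^bsub>summands (p', q')\<^esub> = (\<lambda>c. \<zero>)" for p' q'
      using X.linear_map_zero[OF X.linear_iso_linear[OF to_mat_iso]] by simp
    ultimately show ?thesis using False by (auto simp: tensor_to_pairs_def t)
  qed
  then have "tensor_to_pairs (p + q) ?t = (\<lambda>(x, y). u x \<otimes> v y)" by auto
  then show ?thesis by (simp add: join_chains_eq[OF u v])
qed

lemma Omega_join_iso:
  "isomorphic_spaces R (Omega R (X \<union> Y) PZ r)
     (direct_sum_space {(p, q). p \<ge> -1 \<and> q \<ge> -1 \<and> p + q = r - 1}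
       (\<lambda>(p, q). tensor_product R (Omega R X PX p) (Omega R Y PY q)))"
proof -
  let ?I = "{(p, q). p \<ge> -1 \<and> q \<ge> -1 \<and> p + q = r - 1}"
  have "\<exists>f. linear_iso R (direct_sum_space ?I (\<lambda>(p, q). tensor_product R (Omega R X PX (p + 1 - 1)) (Omega R Y PY q)))
      (X.function_space (W r)) f"
    by (rule exI, rule Omega_direct_sum(1)) auto
  then obtain f where "linear_iso R (direct_sum_space ?I (\<lambda>(p, q). tensor_product R (Omega R X PX p) (Omega R Y PY q)))
      (X.function_space (W r)) f" by auto
  from X.linear_iso_inv[OF X.linear_iso_comp[OF this join_iso]] show ?thesis
    unfolding isomorphic_spaces_def by blast
qed

section \<open>Homology of the join\<close>

text \<open>
  Projecting a cycle of the join to harmonic columns and rows has the boundaries as its kernel, by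
  the homotopy of the product complex.  The image is a total space of matrices, hence a sum of tensor
  products of spaces of harmonic chains, and these are the homologies of the factors.
\<close>

lemma homology_join_iso:
  assumes ne: "X \<noteq> {}" "Y \<noteq> {}"
  shows "isomorphic_spaces R (reduced_homology R (X \<union> Y) PZ r)
     (direct_sum_space {(p, q). p \<ge> 0 \<and> q \<ge> 0 \<and> p + q = r - 1}
       (\<lambda>(p, q). tensor_product R (reduced_homology R X PX p) (reduced_homology R Y PY q)))"
proof -
  let ?I = "{(p, q). p \<ge> 0 \<and> q \<ge> 0 \<and> p + q = r - 1}"
  let ?UX = "\<lambda>n. X.\<Omega> (n - 1)"
  interpret CX: function_complex R degX ?UX "X.list_boundary X"
    using X.Omega_function_complex[of 0] by simp
  interpret CY: function_complex R degY Y.\<Omega> "X.list_boundary Y"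
    using Y.Omega_function_complex[of 1] by simp
  obtain hX where "contracted_complex R degX ?UX (X.list_boundary X) hX"
    using CX.contracted_complex_exists by blast
  moreover obtain hY where "contracted_complex R degY Y.\<Omega> (X.list_boundary Y) hY"
    using CY.contracted_complex_exists by blast
  ultimately interpret P: product_complex R degX ?UX "X.list_boundary X" hX degY Y.\<Omega> "X.list_boundary Y" hY
    by (rule product_complex.intro)
  have bd: "P.bd = pair_boundary" by (simp add: fun_eq_iff P.bd_def pair_boundary_def)
  let ?H = "X.total degX degY P.X.harmonic P.Y.harmonic r"
  have "\<exists>\<alpha>. linear_iso R (reduced_homology R X PX p) (X.function_space (P.X.harmonic (p + 1))) \<alpha>" for p
    using P.X.homology_model[of "p + 1"] by (simp add: X.reduced_homology_eq add.commute)
  then obtain \<alpha> where \<alpha>: "\<And>p. linear_iso R (reduced_homology R X PX p) (X.function_space (P.X.harmonic (p + 1))) (\<alpha> p)"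
    by metis
  have "\<exists>\<beta>. linear_iso R (reduced_homology R Y PY q) (X.function_space (P.Y.harmonic q)) \<beta>" for q
    using P.Y.homology_model[of q] by (simp add: Y.reduced_homology_eq add.commute)
  then obtain \<beta> where \<beta>: "\<And>q. linear_iso R (reduced_homology R Y PY q) (X.function_space (P.Y.harmonic q)) (\<beta> q)"
    by metis
  have hX0: "u = (\<lambda>x. \<zero>)" if u: "u \<in> P.X.harmonic n" "n \<le> 0" for u n
  proof (cases "n = 0")
    case True
    have "u \<in> X.\<Omega> (- 1)" using P.X.harmonic_U[OF u(1)] True by simp
    then obtain v where "v \<in> X.\<Omega> 0" "u = X.list_boundary X v" using X.augmentation_surj[OF ne(1)] by blast
    then have "P.X.proj u = (\<lambda>x. \<zero>)" using P.X.proj_d[of v 1] by simp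
    then show ?thesis using u(1) by (simp add: P.X.harmonic_def)
  next
    case False
    then show ?thesis using P.X.harmonic_U[OF u(1)] u(2) X.Omega_below[of u "n - 1"] by simp
  qed
  have hY0: "u = (\<lambda>x. \<zero>)" if u: "u \<in> P.Y.harmonic n" "n < 0" for u n
  proof (cases "n = - 1")
    case True
    have "u \<in> Y.\<Omega> (- 1)" using P.Y.harmonic_U[OF u(1)] True by simp
    then obtain v where "v \<in> Y.\<Omega> 0" "u = X.list_boundary Y v" using Y.augmentation_surj[OF ne(2)] by blast
    then have "P.Y.proj u = (\<lambda>x. \<zero>)" using P.Y.proj_d[of v 0] by simp
    then show ?thesis using u(1) by (simp add: P.Y.harmonic_def)
  next
    case False
    then show ?thesis using P.Y.harmonic_U[OF u(1)] u(2) Y.Omega_below[of u n] by simp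
  qed
  have dX: "\<And>n u x. u \<in> P.X.harmonic n \<Longrightarrow> u x \<noteq> \<zero> \<Longrightarrow> degX x = n"
    and dY: "\<And>n u y. u \<in> P.Y.harmonic n \<Longrightarrow> u y \<noteq> \<zero> \<Longrightarrow> degY y = n"
    using CX.degree[OF P.X.harmonic_U] CY.degree[OF P.Y.harmonic_U] by blast+
  have finX: "\<exists>S. finite S \<and> (\<forall>u\<in>P.X.harmonic n. \<forall>x. u x \<noteq> \<zero> \<longrightarrow> x \<in> S)" for n
    using CX.finite_support[of n] P.X.harmonic_U by blast
  have "\<exists>f. linear_iso R (direct_sum_space ?I (\<lambda>(p, q). tensor_product R (reduced_homology R X PX p) (reduced_homology R Y PY q)))
      (X.function_space ?H) f"
  proof (rule exI, rule X.direct_sum_tensor_iso[where \<alpha> = \<alpha> and \<beta> = \<beta> and a = 1])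
    show "(\<forall>u\<in>P.X.harmonic (p + 1). u = (\<lambda>x. \<zero>)) \<or> (\<forall>v\<in>P.Y.harmonic q. v = (\<lambda>y. \<zero>))"
      if "(p, q) \<notin> ?I" "p + 1 + q = r" for p q
    proof -
      have "p + 1 \<le> 0 \<or> q < 0" using that by auto
      then show ?thesis using hX0 hY0 by blast
    qed
  qed (use P.X.harmonic_subspace P.Y.harmonic_subspace dX dY hX0 hY0 finX \<alpha> \<beta> in auto)
  then obtain g where g: "linear_iso R (direct_sum_space ?I (\<lambda>(p, q). tensor_product R (reduced_homology R X PX p) (reduced_homology R Y PY q)))
      (X.function_space ?H) g" by blast
  let ?Z = "{z \<in> Z.\<Omega> r. X.list_boundary (X \<union> Y) z = (\<lambda>x. \<zero>)}"
  let ?f = "\<lambda>z. P.Proj (unjoin z)"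
  have zero: "(\<lambda>x. \<zero>) \<in> Z.\<Omega> r" by (rule X.subspace_zero[OF Z.Omega_subspace])
  have Zsub: "X.function_subspace ?Z"
  proof (rule X.function_subspaceI)
    note sc = X.subspace_scalar[OF Z.Omega_subspace]
    show "(\<lambda>x. \<zero>) \<in> ?Z" using zero by (simp add: X.operator_zero[OF Z.bd_local])
    fix f assume f: "f \<in> ?Z"
    then show "f i \<in> carrier R" for i using sc[of f r] by simp
    show "(\<lambda>i. f i \<oplus> g i) \<in> ?Z" if "g \<in> ?Z" for g
      using f that sc[of f r] sc[of g r]
      by (simp add: X.subspace_add[OF Z.Omega_subspace] X.operator_add[OF Z.bd_local])
    show "(\<lambda>i. c \<otimes> f i) \<in> ?Z" if "c \<in> carrier R" for c
      using f that sc[of f r]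
      by (simp add: X.subspace_smult[OF Z.Omega_subspace] X.operator_smult[OF Z.bd_local])
  qed
  have Hsub: "X.function_subspace ?H"
    by (intro X.total_subspace P.X.harmonic_subspace P.Y.harmonic_subspace)
  have ub: "unjoin (X.list_boundary (X \<union> Y) z) = P.bd (unjoin z)" if z: "z \<in> Z.\<Omega> n" for z n
    using unjoin_boundary[of z "n + 1"] z by (auto simp: bd Z.Omega_boundary_eq[OF z, symmetric] Z.Omega_iff)
  have jb: "X.list_boundary (X \<union> Y) (join w) = join (P.bd w)" if w: "w \<in> W n" for w n
    using boundary_join[OF w] Z.Omega_boundary_eq[OF join_in[OF w]] by (simp add: bd)
  have uz: "unjoin (\<lambda>x. \<zero>) = (\<lambda>p. \<zero>)" and jz: "join (\<lambda>p. \<zero>) = (\<lambda>x. \<zero>)"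
    by (auto simp: unjoin_def join_def)
  have surj: "?f ` ?Z = ?H"
  proof (intro equalityI subsetI)
    fix w assume w: "w \<in> ?H"
    note h = P.harmonic_total[OF w]
    have "w = ?f (join w)" using unjoin_join_W[OF h(1)] h(2) by simp
    moreover have "join w \<in> ?Z" using join_in[OF h(1)] jb[OF h(1)] h(3) jz by simp
    ultimately show "w \<in> ?f ` ?Z" by blast
  qed (auto intro: P.Proj_in unjoin_in)
  have ker: "X.list_boundary (X \<union> Y) ` Z.\<Omega> (r + 1) = {z \<in> ?Z. ?f z = (\<lambda>x. \<zero>)}"
  proof (intro equalityI subsetI)
    fix z assume "z \<in> X.list_boundary (X \<union> Y) ` Z.\<Omega> (r + 1)"
    then obtain v where v: "v \<in> Z.\<Omega> (r + 1)" and zv: "z = X.list_boundary (X \<union> Y) v" by blast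
    have z: "z \<in> Z.\<Omega> r" using Z.boundary_in[OF v] by (simp add: zv Z.Omega_boundary_eq[OF v])
    have "X.list_boundary (X \<union> Y) z = (\<lambda>x. \<zero>)"
      using Z.boundary_boundary[OF v] Z.Omega_boundary_eq[OF z] by (simp add: zv Z.Omega_boundary_eq[OF v])
    moreover have "?f z = (\<lambda>x. \<zero>)" by (simp add: zv ub[OF v] P.Proj_bd[OF unjoin_in[OF v]])
    ultimately show "z \<in> {z \<in> ?Z. ?f z = (\<lambda>x. \<zero>)}" using z by simp
  next
    fix z assume "z \<in> {z \<in> ?Z. ?f z = (\<lambda>x. \<zero>)}"
    then have z: "z \<in> Z.\<Omega> r" "X.list_boundary (X \<union> Y) z = (\<lambda>x. \<zero>)" "?f z = (\<lambda>x. \<zero>)" by auto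
    have "P.bd (unjoin z) = (\<lambda>p. \<zero>)" using ub[OF z(1)] z(2) uz by simp
    then obtain v where v: "v \<in> W (r + 1)" "unjoin z = P.bd v"
      using P.exact[OF unjoin_in[OF z(1)] _ z(3)] by blast
    have "z = X.list_boundary (X \<union> Y) (join v)"
      using join_unjoin_Omega[OF z(1)] by (simp add: v(2) jb[OF v(1)])
    then show "z \<in> X.list_boundary (X \<union> Y) ` Z.\<Omega> (r + 1)" using join_in[OF v(1)] by blast
  qed
  have add: "?f (\<lambda>i. x i \<oplus> y i) = (\<lambda>i. ?f x i \<oplus> ?f y i)" if "x \<in> ?Z" "y \<in> ?Z" for x y
  proof -
    have "unjoin (\<lambda>i. x i \<oplus> y i) = (\<lambda>i. unjoin x i \<oplus> unjoin y i)" by (auto simp: unjoin_def)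
    then show ?thesis using that P.Proj_add[OF unjoin_in unjoin_in, of x r y] by simp
  qed
  have smult: "?f (\<lambda>i. c \<otimes> x i) = (\<lambda>i. c \<otimes> ?f x i)" if "c \<in> carrier R" "x \<in> ?Z" for c x
  proof -
    have "unjoin (\<lambda>i. c \<otimes> x i) = (\<lambda>i. c \<otimes> unjoin x i)" using that(1) by (auto simp: unjoin_def)
    then show ?thesis using that P.Proj_smult[OF that(1) unjoin_in, of x r] by simp
  qed
  have "\<exists>f. linear_iso R (reduced_homology R (X \<union> Y) PZ r) (X.function_space ?H) f"
    using X.quotient_by_kernel(1)[OF Zsub Hsub surj add smult ker] by (auto simp: Z.reduced_homology_eq)
  then show ?thesis
    using X.linear_iso_comp[OF _ X.linear_iso_inv[OF g]] unfolding isomorphic_spaces_def by blast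
qed

end

theorem theorem6p5:
  fixes K :: "('k, 's) ring_scheme"
    and X Y :: "'v set" and PX PY :: "'v list set"
  assumes "field K"
    and "finite X" "X \<noteq> {}" "finite Y" "Y \<noteq> {}" "X \<inter> Y = {}"
    and "regular_path_complex X PX" "regular_path_complex Y PY"
  shows
    "(\<exists>\<phi>. chain_iso K
        (tensor_complex K (shift_complex (Omega_complex K X PX)) (Omega_complex K Y PY))
        (Omega_complex K (X \<union> Y) (join_paths PX PY)) \<phi> \<and>
      (\<forall>p q. \<forall>u \<in> carrier (Omega K X PX (p - 1)). \<forall>v \<in> carrier (Omega K Y PY q).
        \<phi> (p + q)
          (complex_tensor K (shift_complex (Omega_complex K X PX)) (Omega_complex K Y PY) p q u v)
        = join_chains K u v)) \<and>
     (\<forall>r \<ge> -1. isomorphic_spaces K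
        (Omega K (X \<union> Y) (join_paths PX PY) r)
        (direct_sum_space {(p, q). p \<ge> -1 \<and> q \<ge> -1 \<and> p + q = r - 1}
          (\<lambda>(p, q). tensor_product K (Omega K X PX p) (Omega K Y PY q)))) \<and>
     (\<forall>r \<ge> 0. isomorphic_spaces K
        (reduced_homology K (X \<union> Y) (join_paths PX PY) r)
        (direct_sum_space {(p, q). p \<ge> 0 \<and> q \<ge> 0 \<and> p + q = r - 1}
          (\<lambda>(p, q). tensor_product K (reduced_homology K X PX p) (reduced_homology K Y PY q))))"
proof -
  interpret disjoint_path_chains K X PX Y PY
    using assms by (simp add: disjoint_path_chains_def disjoint_path_chains_axioms_def
        path_chains_def path_chains_axioms_def)
  show ?thesis
    using join_chain_iso join_chain_iso_tensor Omega_join_iso homology_join_iso[OF assms(3,5)] by blast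
qed

end
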